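(* Let $\Omega$ be a bounded convex domain with smooth boundary, $\varepsilon>0$, $\kappa=\kappa(x)$ smooth with $|\kappa|\le\kappa^*$ for a constant $\kappa^*>0$, and let $u$ be a solution of $\partial_tu-\varepsilon\Delta u=\kappa(x)u+f$ in $\Omega\times(0,T)$, $u=0$ on $\partial\Omega$, $u(0)=u_0$, which is sufficiently smooth in time. Let $0=t_0<\dots<t_N=T$ be a time mesh with steps $\tau_k$, maximum step $\tau$, and ratios $r_k=\tau_k/\tau_{k-1}$ satisfying $0<r_k<R_e$ for $k\ge2$, where $R_e\approx1.4877$ is the unique positive root of $\frac{10}{7(R+1)}-\frac{R^2\sqrt{R}}{R^2+R+1}=0$. Let $K_3>0$ be a constant such that $\sum_{j=3}^n|\vartheta^{(n)}_{n-j}|\le K_3$ and $\sum_{j=i}^n|\vartheta^{(j)}_{j-i}|\le K_3$ for all $n\ge3$, $i\ge3$, independent of $t_n$ and the step ratios, and assume $\tau\le1/(4K_3\kappa^* )$. Let $u^0,u^1,u^2$ be given and $u^k$ (vanishing on $\partial\Omega$) solve $D_3u^k=\varepsilon\Delta u^k+\kappa u^k+f(t_k,\cdot)$ for $3\le k\le N$, and let $\tilde u^n=u(t_n)-u^n$. Then there is a constant $K_u$, depending on $u$ but independent of $t_n$, the step sizes $\tau_n$ and the step ratios $r_n$, such that for $3\le n\le N$, $$\|\tilde u^n\|\le2\exp(4K_3\kappa^*t_{n-1})\Big(\|\tilde u^2\|+K_3\tau\|\partial_\tau\tilde u^1\|+4K_3\tau\|\partial_\tau\tilde u^2\|+2K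_3K_ut_n\tau^3\Big).$$
   Context: $\|\cdot\|$ is the $L^2(\Omega)$ norm; $\partial_\tau v^n=(v^n-v^{n-1})/\tau_n$. For $x,y\ge0$: $d_0(x,y)=\frac{1+2x}{1+x}+\frac{xy}{1+y+xy}$, $d_1(x,y)=-\frac{x}{1+x}-\frac{xy}{1+y+xy}-\frac{xy^2}{1+y+xy}\frac{1+x}{1+y}$, $d_2(x,y)=\frac{xy^2}{1+y+xy}\frac{1+x}{1+y}$. BDF3 kernels $d^{(n)}_j=d_j(r_n,r_{n-1})$ for $j=0,1,2$, $d^{(n)}_j=0$ for $j\ge3$; $D_3v^n=\sum_{j=1}^nd^{(n)}_{n-j}\partial_\tau v^j$. DOC kernels: $\vartheta^{(n)}_0=1/d^{(n)}_0$, $\vartheta^{(n)}_{n-j}=-\frac{1}{d^{(j)}_0}\sum_{i=j+1}^n\vartheta^{(n)}_{n-i}d^{(i)}_{i-j}$ for $3\le j\le n-1$. *)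

theory Defs
  imports "HOL-Analysis.Analysis"
begin

(* C^k regularity of a real-valued function on an open set S, via directional
   derivatives of all orders <= k along arbitrary directions, all continuous on S.
   D hs x is the iterated directional derivative along the directions in hs. *)
definition Ck_on :: "nat \<Rightarrow> 'a::euclidean_space set \<Rightarrow> ('a \<Rightarrow> real) \<Rightarrow> bool" where
  "Ck_on k S g \<longleftrightarrow>
     (\<exists>D :: 'a list \<Rightarrow> 'a \<Rightarrow> real.
        (\<forall>x\<in>S. D [] x = g x) \<and>
        (\<forall>hs h x. length hs < k \<longrightarrow> x \<in> S \<longrightarrow>
            ((\<lambda>s. D hs (x + s *\<^sub>R h)) has_real_derivative D (h # hs) x) (at 0)) \<and>
        (\<forall>hs. length hs \<le> k \<longrightarrow> continuous_on S (D hs)))"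

definition smooth_on :: "'a::euclidean_space set \<Rightarrow> ('a \<Rightarrow> real) \<Rightarrow> bool" where
  "smooth_on S g \<longleftrightarrow> (\<forall>k. Ck_on k S g)"

definition smooth_boundary :: "'a::euclidean_space set \<Rightarrow> bool" where
  "smooth_boundary \<Omega> \<longleftrightarrow>
     (\<exists>\<rho>. smooth_on UNIV \<rho> \<and> \<Omega> = {x. \<rho> x < 0} \<and>
          (\<forall>x. \<rho> x = 0 \<longrightarrow> \<not> (\<rho> has_derivative (\<lambda>_. 0)) (at x)))"

definition laplacian :: "('a::euclidean_space \<Rightarrow> real) \<Rightarrow> 'a \<Rightarrow> real" where
  "laplacian v x = (\<Sum>b\<in>Basis. deriv (deriv (\<lambda>s. v (x + s *\<^sub>R b))) 0)"

definition L2norm :: "'a::euclidean_space set \<Rightarrow> ('a \<Rightarrow> real) \<Rightarrow> real" where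
  "L2norm \<Omega> v = sqrt (LINT x:\<Omega>|lebesgue. (v x)\<^sup>2)"

definition square_integrable :: "'a::euclidean_space set \<Rightarrow> ('a \<Rightarrow> real) \<Rightarrow> bool" where
  "square_integrable \<Omega> v \<longleftrightarrow>
     set_borel_measurable lebesgue \<Omega> v \<and> set_integrable lebesgue \<Omega> (\<lambda>x. (v x)\<^sup>2)"

definition Re_crit :: real where
  "Re_crit = (THE R. R > 0 \<and> 10 / (7 * (R + 1)) - R\<^sup>2 * sqrt R / (R\<^sup>2 + R + 1) = 0)"

definition tau :: "(nat \<Rightarrow> real) \<Rightarrow> nat \<Rightarrow> real" where
  "tau t k = t k - t (k - 1)"

definition ratio :: "(nat \<Rightarrow> real) \<Rightarrow> nat \<Rightarrow> real" where
  "ratio t k = tau t k / tau t (k - 1)"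

definition max_step :: "(nat \<Rightarrow> real) \<Rightarrow> nat \<Rightarrow> real" where
  "max_step t N = Max (tau t ` {1..N})"

definition d0 :: "real \<Rightarrow> real \<Rightarrow> real" where
  "d0 x y = (1 + 2 * x) / (1 + x) + x * y / (1 + y + x * y)"

definition d1 :: "real \<Rightarrow> real \<Rightarrow> real" where
  "d1 x y = - x / (1 + x) - x * y / (1 + y + x * y)
            - x * y\<^sup>2 / (1 + y + x * y) * ((1 + x) / (1 + y))"

definition d2 :: "real \<Rightarrow> real \<Rightarrow> real" where
  "d2 x y = x * y\<^sup>2 / (1 + y + x * y) * ((1 + x) / (1 + y))"

definition bdf3 :: "(nat \<Rightarrow> real) \<Rightarrow> nat \<Rightarrow> nat \<Rightarrow> real" where
  "bdf3 t n j = (let x = ratio t n; y = ratio t (n - 1) in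
      if j = 0 then d0 x y else if j = 1 then d1 x y else if j = 2 then d2 x y else 0)"

(* DOC kernels: doc t n m = vartheta^(n)_m  (for 0 <= m <= n - 3), with j = n - m *)
fun doc :: "(nat \<Rightarrow> real) \<Rightarrow> nat \<Rightarrow> nat \<Rightarrow> real" where
  "doc t n 0 = 1 / bdf3 t n 0"
| "doc t n (Suc m) =
     - (1 / bdf3 t (n - Suc m) 0) * (\<Sum>k\<le>m. doc t n k * bdf3 t (n - k) (Suc m - k))"

definition dtau :: "(nat \<Rightarrow> real) \<Rightarrow> (nat \<Rightarrow> 'a \<Rightarrow> real) \<Rightarrow> nat \<Rightarrow> 'a \<Rightarrow> real" where
  "dtau t v j x = (v j x - v (j - 1) x) / tau t j"

definition D3 :: "(nat \<Rightarrow> real) \<Rightarrow> (nat \<Rightarrow> 'a \<Rightarrow> real) \<Rightarrow> nat \<Rightarrow> 'a \<Rightarrow> real" where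
  "D3 t v n x = (\<Sum>j=1..n. bdf3 t n (n - j) * dtau t v j x)"

end

theory Submission
  imports Defs
begin

text \<open>Convolving the error equation with the DOC kernels, which form the inverse of the BDF3
  kernel matrix, isolates the difference quotient of the error. Testing with the error and summing
  gives an energy inequality, provided that the diffusion term has a sign. Pointwise this is the
  positive semidefiniteness of the DOC kernels: in terms of the preimage \<^term>\<open>W\<close> of the
  gradient it becomes positivity of the BDF3 form, which telescopes with the Lyapunov function
  \<^term>\<open>tau t k * ((W k)\<^sup>2 + ratio t k / 4 * (W k - W (k - 1))\<^sup>2)\<close> as long as all ratios are at
  most \<^term>\<open>3/2 :: real\<close>; and \<^const>\<open>Re_crit\<close> lies below that bound.

  The errors are only twice differentiable inside the domain and continuous up to the boundary, so
  Green's formula is applied after multiplication with a cutoff in the variable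
  \<open>\<Sum>\<^sub>k e\<^sub>k\<^sup>2\<close>, which vanishes at the boundary; square integrability of the Laplacians controls
  the limit. The remaining ingredients are exactness of BDF3 on cubic polynomials and a discrete
  Gronwall argument applied to the running maximum of the error norms.\<close>

section \<open>The BDF3 and DOC kernels\<close>

text \<open>The ratio bound 3/2 fixes the constants: the largest value of \<open>d2\<close> is then
  27/38, and since the energy argument doubles the initial terms, the first difference quotient
  would enter with the factor 27/19 instead of 1. This deficit is what the Gronwall argument has to
  make good. The Lyapunov function carries the weight \<open>tau t k\<close> because division by the
  ratio turns \<open>tau t k\<close> into \<open>tau t (k - 1)\<close>, so that one inequality per
  step telescopes. On the analytic side no bound on gradients up to the boundary is at hand. Square
  integrability of the Laplacians is read off from the error equation, whose other terms are all
  square integrable. The cutoff variable combines all time levels because the form to be estimated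
  couples each error with the Laplacians of others; it is a sum of squares so that its gradient
  again contains factors \<open>e k\<close>, which makes the extra term in Green's formula
  proportional to \<rho>.\<close>

lemma quadratic_form_nonneg:
  fixes A B C p q :: real
  assumes "C > 0" "B\<^sup>2 \<le> 4 * A * C"
  shows "A * p\<^sup>2 + B * p * q + C * q\<^sup>2 \<ge> 0"
proof -
  have "4 * C * (A * p\<^sup>2 + B * p * q + C * q\<^sup>2) = (2 * C * q + B * p)\<^sup>2 + (4 * A * C - B\<^sup>2) * p\<^sup>2"
    by (simp add: power2_eq_square algebra_simps)
  also have "\<dots> \<ge> 0" using assms by simp
  finally show ?thesis using assms(1) by (simp add: zero_le_mult_iff)
qed

text \<open>Up to the factor \<open>x\<^sup>2\<close> and sign, this is the discriminant of the form
  that remains in \<open>bdf3_local_energy\<close>. Since \<open>p\<close> decreases in x while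
  \<open>x * p\<close> and \<open>(1 + x) * p\<close> increase, all terms can be compared with the
  single quantity \<open>s\<close>, the value of \<open>p\<close> at x = 3/2.\<close>

lemma bdf3_discriminant:
  fixes x y :: real
  assumes "0 < x" "x \<le> 3/2" "0 < y" "y \<le> 3/2"
  defines "p \<equiv> y / (1 + y + x * y)"
  shows "4 / (1 + x) + 4 * p - 1 - (x / (1 + x) + x * p)\<^sup>2
         - (4 - x\<^sup>2) * (x\<^sup>2 * p\<^sup>2 * (1 + x)\<^sup>2 * (y / (1 + y)\<^sup>2)) \<ge> 0"
proof -
  define s where "s = y / (1 + y + 3/2 * y)"
  have xy: "0 < x * y" "x * y \<le> 3/2 * y" using assms by (auto intro: mult_right_mono)
  have sp: "s \<le> p" unfolding s_def p_def
    using assms xy by (intro divide_left_mono mult_pos_pos) auto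
  have s0: "0 < s" "s \<le> 6/19" unfolding s_def using assms by (auto simp: divide_simps)
  have "x * p \<le> 3/2 * s"
  proof -
    have "x * (y * (1 + y + 3/2 * y)) \<le> 3/2 * (y * (1 + y + x * y))"
    proof -
      have "x * y * (1 + y) \<le> 3/2 * y * (1 + y)" using assms xy by (intro mult_right_mono) auto
      thus ?thesis by (simp add: algebra_simps)
    qed
    thus ?thesis unfolding s_def p_def using assms xy by (simp add: divide_simps algebra_simps)
  qed
  moreover have p1: "(1 + x) * p \<le> 5/2 * s"
  proof -
    have "(1 + x) * (y * (1 + y + 3/2 * y)) \<le> 5/2 * (y * (1 + y + x * y))"
    proof -
      have "5/2 * (y * (1 + y + x * y)) - (1 + x) * (y * (1 + y + 3/2 * y)) = 3/2 * y - x * y"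
        by (simp add: field_simps)
      thus ?thesis using xy by linarith
    qed
    thus ?thesis unfolding s_def p_def using assms xy by (simp add: divide_simps algebra_simps)
  qed
  moreover have "x / (1 + x) \<le> 3/5" "4 / (1 + x) \<ge> 8/5" using assms by (auto simp: divide_simps)
  moreover have p0: "0 < p" unfolding p_def using assms xy by auto
  ultimately have "(x / (1 + x) + x * p)\<^sup>2 \<le> (3/5 + 3/2 * s)\<^sup>2"
    using assms by (intro power_mono add_mono) auto
  moreover have "(4 - x\<^sup>2) * (x\<^sup>2 * p\<^sup>2 * (1 + x)\<^sup>2 * (y / (1 + y)\<^sup>2)) \<le> 25/4 * s\<^sup>2"
  proof -
    have 1: "((1 + x) * p)\<^sup>2 \<le> (5/2 * s)\<^sup>2" using p0 assms p1 by (intro power_mono) auto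
    have 2: "(4 - x\<^sup>2) * x\<^sup>2 \<le> 4" using zero_le_power2[of "x\<^sup>2 - 2"]
      by (simp add: power2_eq_square algebra_simps)
    have 3: "y / (1 + y)\<^sup>2 \<le> 1 / 4"
      using assms zero_le_power2[of "y - 1"] by (simp add: divide_simps power2_eq_square algebra_simps)
    have x4: "x\<^sup>2 \<le> 4" using assms power_mono[of x 2 2] by simp
    have "(4 - x\<^sup>2) * (x\<^sup>2 * p\<^sup>2 * (1 + x)\<^sup>2 * (y / (1 + y)\<^sup>2))
        = ((4 - x\<^sup>2) * x\<^sup>2) * (((1 + x) * p)\<^sup>2 * (y / (1 + y)\<^sup>2))"
      by (simp add: power_mult_distrib)
    also have "\<dots> \<le> 4 * ((5/2 * s)\<^sup>2 * (1/4))"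
      using 1 2 3 assms x4 by (intro mult_mono) auto
    finally show ?thesis by (simp add: power2_eq_square)
  qed
  \<comment> \<open>This is what the bounds collected so far leave. The value of \<open>s\<close> at
    y = 3/2 is 6/19, and up to there the quadratic stays positive.\<close>
  moreover have "6/25 + 11/5 * s - 17/2 * s\<^sup>2 \<ge> 0"
  proof -
    have "s\<^sup>2 \<le> 6/19 * s" using s0 by (simp add: power2_eq_square)
    thus ?thesis using s0 by linarith
  qed
  hence "8/5 + 4 * s - 1 - (3/5 + 3/2 * s)\<^sup>2 - 25/4 * s\<^sup>2 \<ge> 0"
    by (simp add: power2_eq_square algebra_simps)
  ultimately show ?thesis using sp \<open>4 / (1 + x) \<ge> 8/5\<close> by linarith
qed

text \<open>The three kernels sum to 1, because the scheme differentiates linear functions exactly;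
  the rest can therefore be written in differences. Both positivity and consistency start from this
  form.\<close>

lemma bdf3_kernels_difference_form:
  fixes x y w w1 w2 :: real
  assumes "0 < x" "0 < y"
  shows "d0 x y * w + d1 x y * w1 + d2 x y * w2
    = w + (x / (1 + x) + x * y / (1 + y + x * y)) * (w - w1) - d2 x y * (w1 - w2)"
proof -
  have "(1 + 2 * x) / (1 + x) = 1 + x / (1 + x)" using assms by (simp add: divide_simps)
  moreover have "d1 x y = - x / (1 + x) - x * y / (1 + y + x * y) - d2 x y"
    by (simp add: d1_def d2_def)
  ultimately have "d0 x y = 1 + x / (1 + x) + x * y / (1 + y + x * y)"
    "d1 x y = - (x / (1 + x)) - x * y / (1 + y + x * y) - d2 x y" by (simp_all add: d0_def)
  thus ?thesis by (simp only:) (simp add: ring_distribs)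
qed

text \<open>After multiplication by x the gap between the two sides is a quadratic form in w, D and
  D'. Completing the square in D' consumes the old jump term \<open>y / 4 * D'\<^sup>2\<close>; with
  \<open>w1 = w - D\<close> a form in w and D is left, whose discriminant is controlled by
  \<open>bdf3_discriminant\<close>.\<close>

lemma bdf3_local_energy:
  fixes x y w w1 w2 :: real
  assumes xy: "0 < x" "x \<le> 3/2" "0 < y" "y \<le> 3/2"
  shows "w * (d0 x y * w + d1 x y * w1 + d2 x y * w2)
     \<ge> (w\<^sup>2 + x / 4 * (w - w1)\<^sup>2) - (w1\<^sup>2 + y / 4 * (w1 - w2)\<^sup>2) / x"
proof -
  define p where "p = y / (1 + y + x * y)"
  define h where "h = x / (1 + x) + x * p"
  define c where "c = d2 x y"
  define D D' where "D = w - w1" and "D' = w1 - w2"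
  have cy: "c\<^sup>2 / y = x\<^sup>2 * p\<^sup>2 * (1 + x)\<^sup>2 * (y / (1 + y)\<^sup>2)"
    unfolding c_def d2_def p_def using xy
    by (simp add: power_mult_distrib power_divide) (simp add: power2_eq_square power4_eq_xxxx mult_ac)
  have eq: "d0 x y * w + d1 x y * w1 + d2 x y * w2 = w + h * D - c * D'"
    using bdf3_kernels_difference_form[of x y w w1 w2] xy by (simp add: h_def p_def c_def D_def D'_def)
  have disc: "4 / (1 + x) + 4 * p - 1 - h\<^sup>2 - (4 - x\<^sup>2) * (c\<^sup>2 / y) \<ge> 0"
    using bdf3_discriminant[OF xy] unfolding cy h_def p_def by simp
  have hx: "4 * h / x = 4 / (1 + x) + 4 * p" unfolding h_def using xy by (simp add: add_divide_distrib distrib_left)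
  have "x\<^sup>2 * (4 * h / x - 1 - h\<^sup>2 - (4 - x\<^sup>2) * (c\<^sup>2 / y)) \<ge> 0" using disc hx by simp
  moreover have "x\<^sup>2 * (4 * h / x - 1 - h\<^sup>2 - (4 - x\<^sup>2) * (c\<^sup>2 / y))
     = 4 * (1 - x\<^sup>2 * (c\<^sup>2 / y)) * (1 - x\<^sup>2 / 4) - (x * h - 2)\<^sup>2"
  proof -
    have "x\<^sup>2 * (4 * h / x - 1 - h\<^sup>2 - (4 - x\<^sup>2) * q)
       = 4 * (1 - x\<^sup>2 * q) * (1 - x\<^sup>2 / 4) - (x * h - 2)\<^sup>2" for q
      using xy by (simp add: power2_eq_square algebra_simps)
    thus ?thesis .
  qed
  ultimately have "(x * h - 2)\<^sup>2 \<le> 4 * (1 - x\<^sup>2 * (c\<^sup>2 / y)) * (1 - x\<^sup>2 / 4)" by linarith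
  moreover have "x\<^sup>2 \<le> (3/2)\<^sup>2" using xy by (intro power_mono) auto
  hence "1 - x\<^sup>2 / 4 > 0" by (simp add: power2_eq_square)
  ultimately have q: "(1 - x\<^sup>2 * (c\<^sup>2 / y)) * w\<^sup>2 + (x * h - 2) * w * D + (1 - x\<^sup>2 / 4) * D\<^sup>2 \<ge> 0"
    by (intro quadratic_form_nonneg)
  have sq: "y / 4 * (D' - 2 * c * x * w / y)\<^sup>2 \<ge> 0" using xy by simp
  have sqe: "y / 4 * (D' - 2 * c * x * w / y)\<^sup>2 = y / 4 * D'\<^sup>2 - c * x * w * D' + x\<^sup>2 * (c\<^sup>2 / y) * w\<^sup>2"
    using xy by (simp add: power2_eq_square field_simps)
  have w1: "w1 = w - D" by (simp add: D_def)
  have "0 \<le> (w\<^sup>2 + (x * h - 2) * w * D + (1 - x\<^sup>2 / 4) * D\<^sup>2) - c * x * w * D' + y / 4 * D'\<^sup>2"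
    using q sq unfolding sqe by (simp add: algebra_simps)
  also have "\<dots> = x * (w * (w + h * D - c * D') - w\<^sup>2 - x / 4 * D\<^sup>2) + (w1\<^sup>2 + y / 4 * D'\<^sup>2)"
    unfolding w1 by (simp add: power2_eq_square algebra_simps)
  finally have "0 \<le> (x * (w * (w + h * D - c * D') - w\<^sup>2 - x / 4 * D\<^sup>2) + (w1\<^sup>2 + y / 4 * D'\<^sup>2)) / x"
    using xy by simp
  also have "\<dots> = w * (w + h * D - c * D') - w\<^sup>2 - x / 4 * D\<^sup>2 + (w1\<^sup>2 + y / 4 * D'\<^sup>2) / x"
    using xy by (simp add: add_divide_distrib)
  finally show ?thesis unfolding eq D_def D'_def by linarith
qed

text \<open>Each factor is bounded by its value at ratio 3/2. The bound 27/38 is attained at x = y =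
  3/2 and is half of the later constant 27/19; the bounds for \<open>d0\<close> and
  \<open>d1\<close> are rounded up.\<close>

lemma bdf3_bounds:
  fixes x y :: real
  assumes "0 < x" "x \<le> 3/2" "0 < y" "y \<le> 3/2"
  shows "0 < d0 x y" "d0 x y \<le> 3" "0 \<le> d2 x y" "d2 x y \<le> 27/38" "\<bar>d1 x y\<bar> \<le> 9/5"
proof -
  have xy: "0 < x * y" using assms by simp
  have "x * y \<le> 3/2 * y" using assms by (intro mult_right_mono) auto
  hence "x * y \<le> 9/19 * (1 + y + x * y)" using assms(4) unfolding distrib_left by linarith
  hence b: "x * y / (1 + y + x * y) \<le> 9/19" "0 \<le> x * y / (1 + y + x * y)"
    using assms xy by (simp_all only: pos_divide_le_eq add_pos_pos zero_less_one) simp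
  have a: "x / (1 + x) \<le> 3/5" "0 \<le> x / (1 + x)" and a': "y / (1 + y) \<le> 3/5" "0 \<le> y / (1 + y)"
    using assms by (auto simp: divide_simps)
  have d2: "d2 x y = x * y / (1 + y + x * y) * (1 + x) * (y / (1 + y))"
    unfolding d2_def by (simp add: power2_eq_square)
  have "d2 x y \<le> 9/19 * (5/2) * (3/5)" unfolding d2 using a b a' assms
    by (intro mult_mono) auto
  thus c: "d2 x y \<le> 27/38" by simp
  show c0: "0 \<le> d2 x y" unfolding d2 using a b a' assms by simp
  have e0: "(1 + 2 * x) / (1 + x) = 1 + x / (1 + x)" using assms by (simp add: divide_simps)
  show "0 < d0 x y" "d0 x y \<le> 3" unfolding d0_def e0 using a b by linarith+
  have e1: "d1 x y = - (x / (1 + x)) - x * y / (1 + y + x * y) - d2 x y"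
    by (simp add: d1_def d2_def)
  show "\<bar>d1 x y\<bar> \<le> 9/5" unfolding e1 using a b c c0 by linarith
qed

text \<open>\<open>Re_crit\<close> is a definite description, so uniqueness must be shown too: the
  first fraction strictly decreases and the second strictly increases. A sign change between 1 and
  3/2 locates the root.\<close>

lemma Re_crit_less: "Re_crit < 3/2"
proof -
  define g h :: "real \<Rightarrow> real" where "g = (\<lambda>R. R\<^sup>2 * sqrt R / (R\<^sup>2 + R + 1))"
    and "h = (\<lambda>R. 10 / (7 * (R + 1)))"
  have mono: "h R' - g R' < h R - g R" if "0 < R" "R < R'" for R R'
  proof -
    have "h R' < h R" using that by (simp add: h_def divide_simps)
    moreover have "g R < g R'"
    proof -
      have "R\<^sup>2 / (R\<^sup>2 + R + 1) \<le> R'\<^sup>2 / (R'\<^sup>2 + R' + 1)"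
      proof -
        have "R\<^sup>2 * R' \<le> R'\<^sup>2 * R"
          using that by (simp add: power2_eq_square)
        moreover have "R\<^sup>2 \<le> R'\<^sup>2" using that by (intro power_mono) auto
        ultimately have "R\<^sup>2 * (R'\<^sup>2 + R' + 1) \<le> R'\<^sup>2 * (R\<^sup>2 + R + 1)"
          by (simp add: algebra_simps)
        moreover have "R\<^sup>2 + R + 1 > 0" "R'\<^sup>2 + R' + 1 > 0" using that by (auto intro!: add_pos_pos)
        ultimately show ?thesis by (simp add: divide_le_eq pos_le_divide_eq)
      qed
      moreover have "sqrt R < sqrt R'" using that by simp
      ultimately have "sqrt R * (R\<^sup>2 / (R\<^sup>2 + R + 1)) < sqrt R' * (R'\<^sup>2 / (R'\<^sup>2 + R' + 1))"
        using that by (intro mult_less_le_imp_less) (auto intro!: divide_pos_pos add_pos_pos)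
      thus ?thesis by (simp add: g_def mult.commute)
    qed
    ultimately show ?thesis by linarith
  qed
  have "(\<lambda>R. h R - g R) (3/2) < 0"
  proof -
    \<comment> \<open>At 3/2 the claim is that 9/19 times the root exceeds 4/7, for which 61/50
      suffices.\<close>
    have "sqrt (3/2 :: real) > 61/50" by (rule real_less_rsqrt) (simp add: power2_eq_square)
    thus ?thesis by (simp add: h_def g_def power2_eq_square)
  qed
  hence neg: "h (3/2) - g (3/2) < 0" .
  have pos: "h 1 - g 1 > 0" by (simp add: h_def g_def)
  have "continuous_on {1..3/2} (\<lambda>R. h R - g R)"
    unfolding h_def g_def by (intro continuous_intros) (auto simp: add_pos_pos less_imp_neq[symmetric] add_nonneg_pos)
  then obtain R where R: "1 \<le> R" "R \<le> 3/2" "h R - g R = 0"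
    using IVT2'[of "\<lambda>R. h R - g R" "3/2" 0 1] neg pos by auto
  have "R < 3/2" using R neg by (cases "R = 3/2") auto
  moreover have "Re_crit = R"
    unfolding Re_crit_def
  proof (rule the_equality)
    show "R > 0 \<and> 10 / (7 * (R + 1)) - R\<^sup>2 * sqrt R / (R\<^sup>2 + R + 1) = 0"
      using R by (simp add: h_def g_def)
    fix S assume "S > 0 \<and> 10 / (7 * (S + 1)) - S\<^sup>2 * sqrt S / (S\<^sup>2 + S + 1) = 0"
    hence "S > 0" "h S - g S = 0" by (auto simp: h_def g_def)
    thus "S = R" using mono[of S R] mono[of R S] R by (cases S R rule: linorder_cases) auto
  qed
  ultimately show ?thesis by simp
qed

section \<open>Meshes with ratios at most 3/2 and their triangular kernel matrices\<close>

locale bdf3_mesh =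
  fixes t :: "nat \<Rightarrow> real" and N :: nat
  assumes t_0: "t 0 = 0"
    and t_less_Suc: "k < N \<Longrightarrow> t k < t (Suc k)"
    and ratio_le: "2 \<le> k \<Longrightarrow> k \<le> N \<Longrightarrow> ratio t k \<le> 3/2"
begin

lemma tau_pos: "1 \<le> k \<Longrightarrow> k \<le> N \<Longrightarrow> tau t k > 0"
  using t_less_Suc[of "k - 1"] by (simp add: tau_def)

lemma ratio_pos: "2 \<le> k \<Longrightarrow> k \<le> N \<Longrightarrow> ratio t k > 0"
  using tau_pos[of k] tau_pos[of "k - 1"] by (simp add: ratio_def)

lemma t_mono: "i \<le> j \<Longrightarrow> j \<le> N \<Longrightarrow> t i \<le> t j"
proof (induction j)
  case (Suc j)
  thus ?case using t_less_Suc[of j] by (cases "i = Suc j") auto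
qed simp

lemma bdf3_zero_pos: "3 \<le> k \<Longrightarrow> k \<le> N \<Longrightarrow> bdf3 t k 0 > 0"
  unfolding bdf3_def Let_def using bdf3_bounds(1)[of "ratio t k" "ratio t (k - 1)"]
    ratio_pos ratio_le by simp

lemma sum_bdf3:
  fixes g :: "nat \<Rightarrow> real"
  assumes "3 \<le> k"
  shows "(\<Sum>j=1..k. bdf3 t k (k - j) * g j)
    = bdf3 t k 0 * g k + bdf3 t k 1 * g (k - 1) + bdf3 t k 2 * g (k - 2)"
proof -
  have "(\<Sum>j=1..k. bdf3 t k (k - j) * g j) = (\<Sum>j\<in>{k - 2, k - 1, k}. bdf3 t k (k - j) * g j)"
    using assms by (intro sum.mono_neutral_right) (auto simp: bdf3_def Let_def)
  also have "\<dots> = bdf3 t k 0 * g k + bdf3 t k 1 * g (k - 1) + bdf3 t k 2 * g (k - 2)"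
  proof -
    have "k - 2 \<notin> {k - 1, k}" "k - 1 \<notin> {k}" using assms by auto
    moreover have "k - (k - 2) = 2" "k - (k - 1) = 1" using assms by auto
    ultimately show ?thesis by (simp del: One_nat_def)
  qed
  finally show ?thesis .
qed

text \<open>Starting the sum at 3 drops the two starting levels. Extending W by zero below 3
  expresses this without special cases for k = 3 and k = 4.\<close>

lemma sum_bdf3_from_3:
  fixes W :: "nat \<Rightarrow> real"
  assumes "3 \<le> k"
  defines "W' \<equiv> \<lambda>j. if 3 \<le> j then W j else 0"
  shows "(\<Sum>j=3..k. bdf3 t k (k - j) * W j)
    = bdf3 t k 0 * W' k + bdf3 t k 1 * W' (k - 1) + bdf3 t k 2 * W' (k - 2)"
proof -
  have "(\<Sum>j=3..k. bdf3 t k (k - j) * W j) = (\<Sum>j=1..k. bdf3 t k (k - j) * W' j)"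
    unfolding W'_def by (rule sum.mono_neutral_cong_left) auto
  also note sum_bdf3[OF assms(1), of W']
  finally show ?thesis .
qed

text \<open>The induction starts at M = 2, where the zero extension makes the Lyapunov function
  vanish. The local inequality is multiplied by \<open>tau t k\<close>; as
  \<open>tau t k / ratio t k\<close> is the previous step, its subtracted term is the Lyapunov
  function one level earlier.\<close>

lemma bdf3_energy:
  fixes W :: "nat \<Rightarrow> real"
  defines "W' \<equiv> \<lambda>j. if 3 \<le> j then W j else 0"
  assumes "2 \<le> M" "M \<le> N"
  shows "(\<Sum>k=3..M. tau t k * (W k * (\<Sum>j=3..k. bdf3 t k (k - j) * W j)))
     \<ge> tau t M * ((W' M)\<^sup>2 + ratio t M / 4 * (W' M - W' (M - 1))\<^sup>2)"
  using assms(2,3)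
proof (induction M rule: dec_induct)
  case base
  show ?case by (simp add: W'_def)
next
  case (step M)
  define k where "k = Suc M"
  define x y where "x = ratio t k" and "y = ratio t (k - 1)"
  have k: "3 \<le> k" "k \<le> N" "k - 1 = M" "k - 2 = M - 1" using step by (auto simp: k_def)
  have "tau t M > 0" "tau t k > 0" using tau_pos step k by auto
  hence tx: "tau t k / x = tau t M" unfolding x_def ratio_def k(3) by simp
  have xy: "0 < x" "x \<le> 3/2" "0 < y" "y \<le> 3/2"
    unfolding x_def y_def using ratio_pos ratio_le k(1,2) by auto
  have b: "bdf3 t k 0 = d0 x y" "bdf3 t k 1 = d1 x y" "bdf3 t k 2 = d2 x y"
    by (simp_all add: bdf3_def x_def y_def Let_def)
  have "W' k * (d0 x y * W' k + d1 x y * W' M + d2 x y * W' (M - 1))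
     \<ge> ((W' k)\<^sup>2 + x / 4 * (W' k - W' M)\<^sup>2) - ((W' M)\<^sup>2 + y / 4 * (W' M - W' (M - 1))\<^sup>2) / x"
    by (rule bdf3_local_energy[OF xy])
  hence "tau t k * (W' k * (d0 x y * W' k + d1 x y * W' M + d2 x y * W' (M - 1)))
     \<ge> tau t k * (((W' k)\<^sup>2 + x / 4 * (W' k - W' M)\<^sup>2) - ((W' M)\<^sup>2 + y / 4 * (W' M - W' (M - 1))\<^sup>2) / x)"
    using \<open>tau t k > 0\<close> by (intro mult_left_mono) auto
  also have "tau t k * (((W' k)\<^sup>2 + x / 4 * (W' k - W' M)\<^sup>2) - ((W' M)\<^sup>2 + y / 4 * (W' M - W' (M - 1))\<^sup>2) / x)
    = tau t k * ((W' k)\<^sup>2 + x / 4 * (W' k - W' M)\<^sup>2) - tau t M * ((W' M)\<^sup>2 + y / 4 * (W' M - W' (M - 1))\<^sup>2)"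
    unfolding tx[symmetric] by (simp add: right_diff_distrib)
  finally have *: "\<dots> \<le> tau t k * (W' k * (d0 x y * W' k + d1 x y * W' M + d2 x y * W' (M - 1)))" .
  have inner: "(\<Sum>j=3..k. bdf3 t k (k - j) * W j) = d0 x y * W' k + d1 x y * W' M + d2 x y * W' (M - 1)"
    unfolding sum_bdf3_from_3[OF k(1)] b k(3,4) by (simp add: W'_def)
  have "W' k = W k" using k by (simp add: W'_def)
  moreover have "{3..Suc M} = insert k {3..M}" "k \<notin> {3..M}" using k by (auto simp: k_def)
  ultimately have "(\<Sum>k=3..Suc M. tau t k * (W k * (\<Sum>j=3..k. bdf3 t k (k - j) * W j)))
    = (\<Sum>k=3..M. tau t k * (W k * (\<Sum>j=3..k. bdf3 t k (k - j) * W j)))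
      + tau t k * (W' k * (d0 x y * W' k + d1 x y * W' M + d2 x y * W' (M - 1)))"
    by (simp add: inner)
  moreover have "(\<Sum>k=3..M. tau t k * (W k * (\<Sum>j=3..k. bdf3 t k (k - j) * W j)))
     \<ge> tau t M * ((W' M)\<^sup>2 + y / 4 * (W' M - W' (M - 1))\<^sup>2)"
    using step k by (simp add: y_def)
  ultimately show ?case using * by (simp add: x_def k_def)
qed

text \<open>The DOC kernels form a left inverse of the lower triangular kernel matrix: the recursion
  chooses the entry in column k of row n such that the product vanishes there.\<close>

lemma doc_orthogonality:
  assumes "3 \<le> k" "k \<le> n" "n \<le> N"
  shows "(\<Sum>j=k..n. doc t n (n - j) * bdf3 t j (j - k)) = (if k = n then 1 else 0)"
proof (cases "k = n")
  case True
  thus ?thesis using bdf3_zero_pos[of n] assms by simp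
next
  case False
  then obtain m where m: "n - k = Suc m" using assms by (metis Suc_diff_le diff_is_0_eq less_eq_Suc_le nat_less_le old.nat.exhaust)
  have "doc t n (n - k) * bdf3 t k 0 = - (\<Sum>i\<le>m. doc t n i * bdf3 t (n - i) (Suc m - i))"
  proof -
    have "n - Suc m = k" using m assms by simp
    thus ?thesis using bdf3_zero_pos[of k] assms by (simp add: m)
  qed
  \<comment> \<open>The recursion counts from the diagonal, the claim by row index;
    \<open>j = n - i\<close> translates.\<close>
  also have "(\<Sum>i\<le>m. doc t n i * bdf3 t (n - i) (Suc m - i))
      = (\<Sum>j\<in>{Suc k..n}. doc t n (n - j) * bdf3 t j (j - k))"
  proof (rule sum.reindex_bij_witness[of _ "\<lambda>j. n - j" "\<lambda>i. n - i"])
    fix i assume "i \<in> {..m}"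
    hence "n - (n - i) = i" "n - i - k = Suc m - i" using m by auto
    thus "doc t n (n - (n - i)) * bdf3 t (n - i) (n - i - k) = doc t n i * bdf3 t (n - i) (Suc m - i)"
      by simp
  qed (use m assms in auto)
  finally show ?thesis using False assms by (simp add: sum.atLeast_Suc_atMost)
qed

lemma doc_inverts_bdf3:
  fixes W :: "nat \<Rightarrow> real"
  assumes "3 \<le> m" "m \<le> N"
  shows "(\<Sum>k=3..m. doc t m (m - k) * (\<Sum>j=3..k. bdf3 t k (k - j) * W j)) = W m"
proof -
  have "(\<Sum>k=3..m. doc t m (m - k) * (\<Sum>j=3..k. bdf3 t k (k - j) * W j))
    = (\<Sum>k=3..m. \<Sum>j | j \<in> {3..m} \<and> j \<le> k. doc t m (m - k) * bdf3 t k (k - j) * W j)"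
    by (intro sum.cong refl) (auto simp: sum_distrib_left mult.assoc intro!: sum.cong)
  also have "\<dots> = (\<Sum>j=3..m. \<Sum>k | k \<in> {3..m} \<and> j \<le> k. doc t m (m - k) * bdf3 t k (k - j) * W j)"
    by (rule sum.swap_restrict) auto
  also have "\<dots> = (\<Sum>j=3..m. (\<Sum>k=j..m. doc t m (m - k) * bdf3 t k (k - j)) * W j)"
    by (intro sum.cong refl) (auto simp: sum_distrib_right intro!: sum.cong)
  also have "\<dots> = (\<Sum>j=3..m. (if j = m then 1 else 0) * W j)"
    using assms by (intro sum.cong refl) (simp add: doc_orthogonality)
  also have "\<dots> = W m" using assms by (simp add: if_distrib[of "\<lambda>x. x * _"] cong: if_cong)
  finally show ?thesis .
qed

text \<open>Forward substitution, possible because the diagonal is positive. Combined with the left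
  inverse it shows that the preimage of V is its convolution with the DOC kernels.\<close>

lemma bdf3_solvable:
  fixes V :: "nat \<Rightarrow> real"
  shows "M \<le> N \<Longrightarrow> \<exists>W. \<forall>k. 3 \<le> k \<and> k \<le> M \<longrightarrow> (\<Sum>j=3..k. bdf3 t k (k - j) * W j) = V k"
proof (induction M)
  case (Suc M)
  then obtain W where W: "\<And>k. 3 \<le> k \<Longrightarrow> k \<le> M \<Longrightarrow> (\<Sum>j=3..k. bdf3 t k (k - j) * W j) = V k"
    by auto
  define S where "S = (\<Sum>j=3..M. bdf3 t (Suc M) (Suc M - j) * W j)"
  define W' where "W' = W(Suc M := (V (Suc M) - S) / bdf3 t (Suc M) 0)"
  have "(\<Sum>j=3..k. bdf3 t k (k - j) * W' j) = V k" if k: "3 \<le> k" "k \<le> Suc M" for k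
  proof (cases "k = Suc M")
    case True
    have "(\<Sum>j=3..M. bdf3 t (Suc M) (Suc M - j) * W' j) = S"
      unfolding S_def W'_def by (intro sum.cong) auto
    thus ?thesis using True k bdf3_zero_pos[of "Suc M"] Suc.prems
      by (simp add: W'_def)
  next
    case False
    have "(\<Sum>j=3..k. bdf3 t k (k - j) * W' j) = (\<Sum>j=3..k. bdf3 t k (k - j) * W j)"
      using False k unfolding W'_def by (intro sum.cong) auto
    thus ?thesis using W[of k] k False by simp
  qed
  thus ?case by blast
qed simp

lemma doc_positive_semidefinite:
  fixes V :: "nat \<Rightarrow> real"
  assumes "2 \<le> M" "M \<le> N"
  shows "(\<Sum>m=3..M. tau t m * (V m * (\<Sum>k=3..m. doc t m (m - k) * V k))) \<ge> 0"
proof -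
  obtain W where W: "\<And>k. 3 \<le> k \<Longrightarrow> k \<le> M \<Longrightarrow> (\<Sum>j=3..k. bdf3 t k (k - j) * W j) = V k"
    using bdf3_solvable[OF assms(2)] by blast
  have "(\<Sum>m=3..M. tau t m * (V m * (\<Sum>k=3..m. doc t m (m - k) * V k)))
    = (\<Sum>m=3..M. tau t m * (W m * (\<Sum>j=3..m. bdf3 t m (m - j) * W j)))"
  proof (intro sum.cong refl)
    fix m assume m: "m \<in> {3..M}"
    have "(\<Sum>k=3..m. doc t m (m - k) * V k)
       = (\<Sum>k=3..m. doc t m (m - k) * (\<Sum>j=3..k. bdf3 t k (k - j) * W j))"
      using m W by (intro sum.cong) auto
    also have "\<dots> = W m" using m assms by (intro doc_inverts_bdf3) auto
    finally show "tau t m * (V m * (\<Sum>k=3..m. doc t m (m - k) * V k))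
      = tau t m * (W m * (\<Sum>j=3..m. bdf3 t m (m - j) * W j))" using m W by simp
  qed
  also have "\<dots> \<ge> 0"
    by (rule order_trans[OF _ bdf3_energy[OF assms]])
      (use tau_pos[of M] ratio_pos[of M] assms in \<open>auto intro!: mult_nonneg_nonneg add_nonneg_nonneg\<close>)
  finally show ?thesis .
qed

end

section \<open>Discrete Gronwall estimate\<close>

text \<open>\<open>exp (2 * p) * (1 - p)\<close> increases on [0, 1/2], so p may be lowered to q;
  there the quadratic Taylor polynomial of \<open>exp (2 * q)\<close> times \<open>1 - q\<close> is
  exactly the right side. The excess over 1 is the resource that pays for 27/19.\<close>

lemma exp_mult_one_minus_ge:
  fixes q p :: real
  assumes "0 \<le> q" "q \<le> p" "p \<le> 1/2"
  shows "exp (2 * p) * (1 - p) \<ge> 1 + q - 2 * q^3"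
proof -
  have "1 + q - 2 * q^3 = (1 + 2 * q + (2 * q)\<^sup>2 / 2) * (1 - q)"
    by (simp add: power2_eq_square power3_eq_cube algebra_simps)
  also have "\<dots> \<le> exp (2 * q) * (1 - q)"
    using exp_lower_Taylor_quadratic[of "2 * q"] assms by (intro mult_right_mono) auto
  also have "\<dots> \<le> exp (2 * p) * (1 - p)"
  proof -
    have "1 - q \<le> (1 + 2 * (p - q)) * (1 - p)"
    proof -
      have "(1 + 2 * (p - q)) * (1 - p) - (1 - q) = (p - q) * (1 - 2 * p)"
        by (simp add: algebra_simps)
      also have "\<dots> \<ge> 0" using assms by simp
      finally show ?thesis by linarith
    qed
    also have "\<dots> \<le> exp (2 * (p - q)) * (1 - p)"
      using exp_ge_add_one_self[of "2 * (p - q)"] assms by (intro mult_right_mono) auto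
    finally have "exp (2 * q) * (1 - q) \<le> exp (2 * q) * (exp (2 * (p - q)) * (1 - p))"
      by (intro mult_left_mono) auto
    also have "\<dots> = exp (2 * p) * (1 - p)" by (simp add: exp_add[symmetric] mult.assoc[symmetric] algebra_simps)
    finally show ?thesis .
  qed
  finally show ?thesis .
qed

text \<open>The constants in front of the initial data in the theorem are smaller than what the energy
  argument yields; the missing factor 27/19 is recovered from the gap between
  \<^term>\<open>1 / (1 - p)\<close> and \<^term>\<open>exp (2 * p)\<close> in the two steps that precede the last one,
  whose lengths are controlled from below by the ratio bound.\<close>

lemma gronwall_gap:
  fixes p p' p'' :: real
  assumes "0 \<le> p" "p \<le> 1/2" "2/3 * p \<le> p'" "p' \<le> 1/2" "2/3 * p' \<le> p''" "p'' \<le> 1/2"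
  shows "27/19 \<le> 2 * (1 - p) * (exp (2 * p') * (1 - p')) * (exp (2 * p'') * (1 - p''))"
proof -
  have p2: "p\<^sup>2 \<le> 1/4" using assms power_mono[of p "1/2" 2] by (simp add: power2_eq_square)
  have p3: "p^3 \<le> p / 4" using assms mult_left_mono[OF p2, of p]
    by (simp add: power2_eq_square power3_eq_cube)
  \<comment> \<open>The cubic term is absorbed by \<open>p^3 \<le> p / 4\<close>. The factors 2/3
    here and 4/9 below are powers of the reciprocal ratio bound.\<close>
  have "1 + p / 2 \<le> 1 + 2/3 * p - 2 * (2/3 * p)^3"
    using p3 assms by (simp add: power_mult_distrib power3_eq_cube)
  also have "\<dots> \<le> exp (2 * p') * (1 - p')"
    using assms by (intro exp_mult_one_minus_ge) auto
  finally have 1: "1 + p / 2 \<le> exp (2 * p') * (1 - p')" .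
  have "1 + 2/5 * p \<le> 1 + 4/9 * p - 2 * (4/9 * p)^3"
    using p3 assms by (simp add: power_mult_distrib power3_eq_cube)
  also have "\<dots> \<le> exp (2 * p'') * (1 - p'')"
    using assms by (intro exp_mult_one_minus_ge) auto
  finally have 2: "1 + 2/5 * p \<le> exp (2 * p'') * (1 - p'')" .
  \<comment> \<open>On [0, 1/2] this cubic decreases, down to 3/2 at the right end, which is still
    above 27/19.\<close>
  have "27/19 \<le> 2 * (1 - p) * (1 + p / 2) * (1 + 2/5 * p)"
  proof -
    have "2 * (1 - p) * (1 + p / 2) * (1 + 2/5 * p) = 2 - 1/5 * p - 7/5 * p\<^sup>2 - 2/5 * p^3"
      by (simp add: power2_eq_square power3_eq_cube field_simps)
    thus ?thesis using p2 p3 assms by linarith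
  qed
  also have "\<dots> \<le> 2 * (1 - p) * (exp (2 * p') * (1 - p')) * (exp (2 * p'') * (1 - p''))"
    using 1 2 assms by (intro mult_mono) auto
  finally show ?thesis .
qed

text \<open>The recursion is implicit, \<open>a M\<close> being on both sides, so each step costs a
  factor \<open>1 - p M\<close>. The factors are kept as a product instead of being replaced by
  exponentials, because the last three are estimated more sharply later.\<close>

lemma discrete_gronwall:
  fixes a p :: "nat \<Rightarrow> real"
  assumes "\<And>m. 3 \<le> m \<Longrightarrow> m \<le> n \<Longrightarrow> 0 \<le> p m \<and> p m \<le> 1/2"
    and "\<And>M. 3 \<le> M \<Longrightarrow> M \<le> n \<Longrightarrow> a M \<le> A + (\<Sum>m=3..M. p m * a m)" and "2 \<le> n"
  shows "(A + (\<Sum>m=3..n. p m * a m)) * (\<Prod>m=3..n. 1 - p m) \<le> A"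
  using assms(3,1,2)
proof (induction n rule: dec_induct)
  case (step n)
  define S where "S = (\<Sum>m=3..n. p m * a m)"
  have n: "3 \<le> Suc n" using step by simp
  have p: "0 \<le> p (Suc n)" "p (Suc n) \<le> 1/2" using step.prems(1)[OF n] by auto
  have eq: "A + (\<Sum>m=3..Suc n. p m * a m) = A + S + p (Suc n) * a (Suc n)"
    using n by (simp add: S_def)
  have "a (Suc n) \<le> A + S + p (Suc n) * a (Suc n)" using step.prems(2)[OF n] eq by simp
  hence "p (Suc n) * a (Suc n) \<le> p (Suc n) * (A + S + p (Suc n) * a (Suc n))"
    using p by (intro mult_left_mono) auto
  hence "(A + S + p (Suc n) * a (Suc n)) * (1 - p (Suc n)) \<le> A + S"
    by (simp add: algebra_simps)
  moreover have pr: "(\<Prod>m=3..n. 1 - p m) \<ge> 0"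
    using step.prems(1) by (intro prod_nonneg) (force simp: le_Suc_eq)
  ultimately have "(A + S + p (Suc n) * a (Suc n)) * (1 - p (Suc n)) * (\<Prod>m=3..n. 1 - p m)
     \<le> (A + S) * (\<Prod>m=3..n. 1 - p m)"
    by (intro mult_right_mono) auto
  also have "\<dots> \<le> A" unfolding S_def using step by (intro step.IH) auto
  finally show ?case unfolding eq using n by (simp add: mult_ac)
qed simp

text \<open>The exponential stops at \<open>t (n - 1)\<close>, so only the leading 2 can compensate
  the last factor \<open>1 - p n\<close>. What is left of that 2, together with the excess from the
  two preceding steps, is at least 27/19.\<close>

lemma (in bdf3_mesh) gronwall_bdf3:
  fixes a :: "nat \<Rightarrow> real" and g A :: real
  assumes n: "3 \<le> n" "n \<le> N" and g: "0 \<le> g" and A: "0 \<le> A"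
    and small: "\<And>m. 1 \<le> m \<Longrightarrow> m \<le> N \<Longrightarrow> g * tau t m \<le> 1/2"
    and rec: "\<And>M. 3 \<le> M \<Longrightarrow> M \<le> n \<Longrightarrow> a M \<le> A + (\<Sum>m=3..M. g * tau t m * a m)"
  shows "a n \<le> exp (2 * g * t (n - 1)) * 2 * (19/27 * A)"
proof -
  define p where "p m = g * tau t m" for m
  have p: "0 \<le> p m \<and> p m \<le> 1/2" if "1 \<le> m" "m \<le> N" for m
    using small[OF that] g tau_pos[OF that] by (simp add: p_def)
  have pr: "2/3 * p m \<le> p (m - 1)" if "2 \<le> m" "m \<le> N" for m
  proof -
    have "tau t (m - 1) > 0" using tau_pos[of "m - 1"] that by auto
    hence "tau t m \<le> 3/2 * tau t (m - 1)"
      using ratio_le[OF that] by (simp add: ratio_def divide_le_eq)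
    thus ?thesis using mult_left_mono[of "tau t m" "3/2 * tau t (m - 1)" g] g by (simp add: p_def)
  qed
  define P where "P = (\<Prod>m=1..n. 1 - p m)"
  have pos: "1 - p m > 0" if "m \<in> {1..n}" for m using p[of m] that n by auto
  have exp_ge: "1 \<le> exp (2 * p m) * (1 - p m)" if "1 \<le> m" "m \<le> n" for m
    using exp_mult_one_minus_ge[of 0 "p m"] p[of m] that n by simp
  have t_sum: "t k = (\<Sum>m=1..k. tau t m)" for k
  proof (induction k)
    case (Suc k)
    thus ?case by (simp add: tau_def)
  qed (simp add: t_0)
  have main: "27/19 \<le> 2 * exp (2 * g * t (n - 1)) * (\<Prod>m=3..n. 1 - p m)"
  proof -
    define I where "I = {1..n - 3}"
    have "exp (2 * g * t (n - 1)) = (\<Prod>m=1..n - 1. exp (2 * p m))"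
      by (simp add: t_sum exp_sum[symmetric] p_def sum_distrib_left mult_ac)
    also have "{1..n - 1} = insert (n - 1) (insert (n - 2) I)" using n by (auto simp: I_def)
    also have "(\<Prod>m\<in>\<dots>. exp (2 * p m)) = exp (2 * p (n - 1)) * (exp (2 * p (n - 2)) * (\<Prod>m\<in>I. exp (2 * p m)))"
    proof -
      have "finite I" "n - 2 \<notin> I" "n - 1 \<notin> insert (n - 2) I" using n by (auto simp: I_def)
      thus ?thesis by (simp del: One_nat_def)
    qed
    finally have e: "exp (2 * g * t (n - 1)) = \<dots>" .
    \<comment> \<open>Extending the product down to m = 1 only decreases it. Then the steps n - 1
      and n - 2 are among its factors even for n = 3, and every exponential factor of
      \<open>exp (2 * g * t (n - 1))\<close> has a partner.\<close>
    have "(\<Prod>m=3..n. 1 - p m) \<ge> P"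
    proof -
      have "{1..n} = {1, 2} \<union> {3..n}" using n by auto
      hence "P = (1 - p 1) * (1 - p 2) * (\<Prod>m=3..n. 1 - p m)"
        unfolding P_def by (subst (1) \<open>{1..n} = _\<close>, subst prod.union_disjoint) auto
      also have "\<dots> \<le> 1 * (\<Prod>m=3..n. 1 - p m)"
      proof (rule mult_right_mono)
        show "(1 - p 1) * (1 - p 2) \<le> 1"
          using p[of 1] p[of 2] n by (intro mult_le_one) auto
        show "0 \<le> (\<Prod>m=3..n. 1 - p m)"
          using pos by (intro prod_nonneg) (force intro: less_imp_le)
      qed
      finally show ?thesis by simp
    qed
    moreover have Psplit: "P = (1 - p n) * ((1 - p (n - 1)) * ((1 - p (n - 2)) * (\<Prod>m\<in>I. 1 - p m)))"
    proof -
      have "finite I" "n - 2 \<notin> I" "n - 1 \<notin> insert (n - 2) I" "n \<notin> insert (n - 1) (insert (n - 2) I)"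
        using n by (auto simp: I_def)
      moreover have "{1..n} = insert n (insert (n - 1) (insert (n - 2) I))" using n by (auto simp: I_def)
      ultimately show ?thesis unfolding P_def by (simp del: One_nat_def)
    qed
    moreover have "27/19 \<le> 2 * exp (2 * g * t (n - 1)) * P"
    proof -
      have "27/19 * 1 \<le> (2 * (1 - p n) * (exp (2 * p (n - 1)) * (1 - p (n - 1))) * (exp (2 * p (n - 2)) * (1 - p (n - 2))))
         * (\<Prod>m\<in>I. exp (2 * p m) * (1 - p m))"
      proof (rule mult_mono)
        have "n - 1 - 1 = n - 2" by simp
        thus gap: "27/19 \<le> 2 * (1 - p n) * (exp (2 * p (n - 1)) * (1 - p (n - 1))) * (exp (2 * p (n - 2)) * (1 - p (n - 2)))"
          using pr[of n] pr[of "n - 1"] p[of n] p[of "n - 1"] p[of "n - 2"] n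
          by (intro gronwall_gap) auto
        show "1 \<le> (\<Prod>m\<in>I. exp (2 * p m) * (1 - p m))"
          using exp_ge by (intro prod_ge_1) (auto simp: I_def)
        show "0 \<le> 2 * (1 - p n) * (exp (2 * p (n - 1)) * (1 - p (n - 1))) * (exp (2 * p (n - 2)) * (1 - p (n - 2)))"
          using gap by linarith
      qed simp
      also have "\<dots> = 2 * exp (2 * g * t (n - 1)) * P"
        unfolding e Psplit by (simp add: prod.distrib mult_ac)
      finally show ?thesis by simp
    qed
    ultimately show ?thesis
      by (meson exp_ge_zero mult_left_mono mult_nonneg_nonneg order_trans zero_le_numeral)
  qed
  define S where "S = A + (\<Sum>m=3..n. p m * a m)"
  have "S * (\<Prod>m=3..n. 1 - p m) \<le> A"
    unfolding S_def by (rule discrete_gronwall) (use p n rec in \<open>auto simp: p_def\<close>)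
  define X where "X = 2 * exp (2 * g * t (n - 1))"
  have X: "X \<ge> 0" by (simp add: X_def)
  have aS: "a n \<le> S" using rec[of n] n by (simp add: S_def p_def)
  have "a n \<le> X * (19/27 * A)"
  \<comment> \<open>The sequence \<open>a\<close> carries no sign here, so S could be
    negative.\<close>
  proof (cases "S \<ge> 0")
    case True
    have "S * (27/19) \<le> S * (X * (\<Prod>m=3..n. 1 - p m))"
      using main True unfolding X_def by (rule mult_left_mono)
    also have "\<dots> = X * (S * (\<Prod>m=3..n. 1 - p m))" by simp
    also have "\<dots> \<le> X * A" using \<open>S * _ \<le> A\<close> X by (rule mult_left_mono)
    finally show ?thesis using aS by simp
  next
    case False
    moreover have "0 \<le> X * (19/27 * A)" using X A by simp
    ultimately show ?thesis using aS by linarith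
  qed
  thus ?thesis by (simp add: X_def mult_ac)
qed

lemma (in bdf3_mesh) sum_tau_le:
  assumes "2 \<le> M" "M \<le> N"
  shows "(\<Sum>m=3..M. tau t m) \<le> t M"
  using assms
proof (induction M rule: dec_induct)
  case base
  thus ?case using t_mono[of 0 2] by (simp add: t_0)
next
  case (step M)
  thus ?case by (simp add: tau_def)
qed

text \<open>The energy inequality is quadratic in \<open>a\<close>; cancelling one running maximum
  makes it linear. Row sums of the DOC kernels handle \<kappa> and h, whose weights
  \<open>tau t m\<close> add up to a time. Column sums handle the \<open>I k\<close>: their total J
  is then charged with a single step length \<tau>, not with the elapsed time.\<close>

lemma (in bdf3_mesh) bound_from_energy_estimate:
  fixes a I :: "nat \<Rightarrow> real" and \<tau> K \<kappa> h J :: real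
  assumes n: "3 \<le> n" "n \<le> N" and pos: "K > 0" "\<kappa> > 0" "h \<ge> 0"
    and a: "\<And>m. a m \<ge> 0" and I: "\<And>m. I m \<ge> 0" and J: "\<And>M. M \<le> n \<Longrightarrow> (\<Sum>k=3..M. I k) \<le> J"
    and step: "\<And>m. 1 \<le> m \<Longrightarrow> m \<le> N \<Longrightarrow> tau t m \<le> \<tau>" and small: "\<tau> \<le> 1 / (4 * K * \<kappa>)"
    and row: "\<And>m. 3 \<le> m \<Longrightarrow> m \<le> n \<Longrightarrow> (\<Sum>k=3..m. \<bar>doc t m (m - k)\<bar>) \<le> K"
    and col: "\<And>k M. 3 \<le> k \<Longrightarrow> k \<le> M \<Longrightarrow> M \<le> n \<Longrightarrow> (\<Sum>m=k..M. \<bar>doc t m (m - k)\<bar>) \<le> K"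
    and energy: "\<And>M. 3 \<le> M \<Longrightarrow> M \<le> n \<Longrightarrow> (a M)\<^sup>2 \<le> (a 2)\<^sup>2
      + 2 * (\<Sum>m=3..M. tau t m * (\<Sum>k=3..m. \<bar>doc t m (m - k)\<bar> * (\<kappa> * a k + h + I k)) * a m)"
  shows "a n \<le> exp (4 * K * \<kappa> * t (n - 1)) * 2 * (19/27 * (a 2 + 2 * K * \<tau> * J + 2 * K * h * t n))"
proof -
  define A where "A = a 2 + 2 * K * \<tau> * J + 2 * K * h * t n"
  define b where "b M = Max (a ` {2..M})" for M
  have \<tau>: "\<tau> > 0" using step[of 1] tau_pos[of 1] n by force
  have J0: "J \<ge> 0" using J[of 0] by simp
  have tn: "t n \<ge> 0" using t_mono[of 0 n] n t_0 by simp
  have A2: "a 2 \<le> A" using \<tau> J0 tn pos unfolding A_def by simp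
  have tp: "tau t m \<ge> 0" if "3 \<le> m" "m \<le> n" for m using tau_pos[of m] that n by simp
  have ab: "a m \<le> b M" if "2 \<le> m" "m \<le> M" for m M
    unfolding b_def using that by (intro Max_ge) auto
  have b0: "b M \<ge> 0" if "2 \<le> M" for M using ab[of 2 M] a[of 2] that by linarith
  have rec: "b M \<le> A + (\<Sum>m=3..M. 2 * K * \<kappa> * tau t m * b m)" if M: "3 \<le> M" "M \<le> n" for M
  proof -
    have "b M \<in> a ` {2..M}" unfolding b_def using M by (intro Max_in) auto
    then obtain m0 where m0: "2 \<le> m0" "m0 \<le> M" "b M = a m0" by auto
    define E where "E = b M"
    have le_E: "a m \<le> E" if "2 \<le> m" "m \<le> m0" for m using ab[of m M] that m0 by (simp add: E_def)
    have nonneg: "0 \<le> (\<Sum>m=3..M. 2 * K * \<kappa> * tau t m * b m)"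
      using pos tp M b0 by (intro sum_nonneg mult_nonneg_nonneg) auto
    show ?thesis
    \<comment> \<open>The energy inequality is applied at m0, where the maximum is attained, and
      divided by E. For m0 = 2 the initial value alone suffices, and E = 0 forbids the
      division.\<close>
    proof (cases "m0 = 2 \<or> E = 0")
      case True
      have "A \<ge> 0" using A2 a[of 2] by linarith
      thus ?thesis using True A2 nonneg m0 E_def by auto
    next
      case False
      hence m3: "3 \<le> m0" "E > 0" using m0 b0[of M] M by (auto simp: E_def)
      define S where "S = (\<Sum>m=3..m0. tau t m * (\<Sum>k=3..m. \<bar>doc t m (m - k)\<bar> * (\<kappa> * a k + h + I k)) * a m)"
      define B where "B = (\<Sum>m=3..M. tau t m * b m)"
      have "S \<le> (\<Sum>m=3..m0. E * (K * \<kappa> * (tau t m * b m) + K * h * tau t m + \<tau> * (\<Sum>k=3..m. \<bar>doc t m (m - k)\<bar> * I k)))"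
        unfolding S_def
      proof (rule sum_mono)
        fix m assume m: "m \<in> {3..m0}"
        have tm: "tau t m \<ge> 0" "tau t m \<le> \<tau>" using tp[of m] step[of m] m m0 M n by auto
        have R: "(\<Sum>k=3..m. \<bar>doc t m (m - k)\<bar>) \<le> K" using row[of m] m m0 M by auto
        define s where "s = (\<Sum>k=3..m. \<bar>doc t m (m - k)\<bar> * I k)"
        have s: "s \<ge> 0" unfolding s_def using I by (intro sum_nonneg) auto
        have "(\<Sum>k=3..m. \<bar>doc t m (m - k)\<bar> * (\<kappa> * a k + h + I k))
          \<le> (\<Sum>k=3..m. \<bar>doc t m (m - k)\<bar> * (\<kappa> * E + h) + \<bar>doc t m (m - k)\<bar> * I k)"
        proof (rule sum_mono)
          fix k assume "k \<in> {3..m}"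
          hence "\<kappa> * a k + h + I k \<le> \<kappa> * E + h + I k" using le_E[of k] m pos by simp
          thus "\<bar>doc t m (m - k)\<bar> * (\<kappa> * a k + h + I k) \<le> \<bar>doc t m (m - k)\<bar> * (\<kappa> * E + h) + \<bar>doc t m (m - k)\<bar> * I k"
            unfolding distrib_left[symmetric] by (intro mult_left_mono) auto
        qed
        also have "\<dots> = (\<Sum>k=3..m. \<bar>doc t m (m - k)\<bar>) * (\<kappa> * E + h) + s"
          by (simp add: sum.distrib sum_distrib_right s_def)
        also have "\<dots> \<le> K * (\<kappa> * E + h) + s"
          using R pos m3 by (intro add_right_mono mult_right_mono) auto
        finally have "tau t m * (\<Sum>k=3..m. \<bar>doc t m (m - k)\<bar> * (\<kappa> * a k + h + I k)) * a m
          \<le> tau t m * (K * (\<kappa> * E + h) + s) * a m"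
          using tm a by (intro mult_right_mono mult_left_mono) auto
        also have "\<dots> = (K * \<kappa> * tau t m * E) * a m + (K * h * tau t m) * a m + (tau t m * s) * a m"
          by (simp add: algebra_simps)
        \<comment> \<open>The \<kappa> term already contains one E, so its other factor is kept at
          the smaller \<open>b m\<close>, which feeds the Gronwall sum. In the other two terms
          \<open>a m\<close> is raised to the E that is cancelled later.\<close>
        also have "\<dots> \<le> (K * \<kappa> * tau t m * E) * b m + (K * h * tau t m) * E + (\<tau> * s) * E"
          using tm s pos m3 m le_E[of m] ab[of m m] a[of m] \<tau>
          by (intro add_mono mult_mono) auto
        finally show "tau t m * (\<Sum>k=3..m. \<bar>doc t m (m - k)\<bar> * (\<kappa> * a k + h + I k)) * a m
          \<le> E * (K * \<kappa> * (tau t m * b m) + K * h * tau t m + \<tau> * (\<Sum>k=3..m. \<bar>doc t m (m - k)\<bar> * I k))"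
          unfolding s_def by (simp add: algebra_simps)
      qed
      also have "\<dots> = E * (K * \<kappa> * (\<Sum>m=3..m0. tau t m * b m) + K * h * (\<Sum>m=3..m0. tau t m)
          + \<tau> * (\<Sum>m=3..m0. \<Sum>k=3..m. \<bar>doc t m (m - k)\<bar> * I k))"
        by (simp only: sum.distrib sum_distrib_left[symmetric])
      also have "\<dots> \<le> E * (K * \<kappa> * B + K * h * t n + \<tau> * (K * J))"
      proof (intro mult_left_mono add_mono)
        show "(\<Sum>m=3..m0. tau t m * b m) \<le> B"
          unfolding B_def using m0 M tp b0 by (intro sum_mono2) auto
        show "(\<Sum>m=3..m0. tau t m) \<le> t n"
          using sum_tau_le[of m0] t_mono[of m0 n] m0 M n by linarith
        have "(\<Sum>m=3..m0. \<Sum>k=3..m. \<bar>doc t m (m - k)\<bar> * I k)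
          = (\<Sum>m=3..m0. \<Sum>k | k \<in> {3..m0} \<and> k \<le> m. \<bar>doc t m (m - k)\<bar> * I k)"
          by (intro sum.cong) auto
        also have "\<dots> = (\<Sum>k=3..m0. \<Sum>m | m \<in> {3..m0} \<and> k \<le> m. \<bar>doc t m (m - k)\<bar> * I k)"
          by (rule sum.swap_restrict) auto
        also have "\<dots> = (\<Sum>k=3..m0. (\<Sum>m=k..m0. \<bar>doc t m (m - k)\<bar>) * I k)"
          by (intro sum.cong refl) (auto simp: sum_distrib_right intro!: sum.cong)
        also have "\<dots> \<le> (\<Sum>k=3..m0. K * I k)"
          using col m0 M I by (intro sum_mono mult_right_mono) auto
        also have "\<dots> \<le> K * J"
          using J[of m0] m0 M pos by (simp add: sum_distrib_left[symmetric])
        finally show "(\<Sum>m=3..m0. \<Sum>k=3..m. \<bar>doc t m (m - k)\<bar> * I k) \<le> K * J" .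
      qed (use pos m3 \<tau> in auto)
      finally have S: "S \<le> E * (K * \<kappa> * B + K * h * t n + \<tau> * (K * J))" .
      have "E * E \<le> (a 2)\<^sup>2 + 2 * S"
        using energy[of m0] m3 m0 M unfolding S_def E_def by (simp add: power2_eq_square)
      also have "\<dots> \<le> E * a 2 + 2 * (E * (K * \<kappa> * B + K * h * t n + \<tau> * (K * J)))"
        using S le_E[of 2] a[of 2] m0 by (intro add_mono) (auto simp: power2_eq_square intro: mult_right_mono)
      also have "\<dots> = E * (A + 2 * K * \<kappa> * B)"
        by (simp add: A_def algebra_simps)
      finally have "E \<le> A + 2 * K * \<kappa> * B" using m3 by simp
      thus ?thesis by (simp add: E_def B_def sum_distrib_left mult.assoc)
    qed
  qed
  have "b n \<le> exp (2 * (2 * K * \<kappa>) * t (n - 1)) * 2 * (19/27 * A)"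
  proof (rule gronwall_bdf3[OF n])
    show "0 \<le> A" using A2 a[of 2] by linarith
    fix m assume "1 \<le> m" "m \<le> N"
    hence "tau t m \<le> 1 / (4 * K * \<kappa>)" using step[of m] small by linarith
    thus "2 * K * \<kappa> * tau t m \<le> 1/2" using pos by (simp add: field_simps)
  qed (use rec pos in auto)
  moreover have "a n \<le> b n" using ab[of n n] n by simp
  ultimately show ?thesis by (simp add: A_def mult.assoc)
qed

section \<open>Consistency\<close>

text \<open>Seen from the newest node, the four nodes are 0, -h, -h p and -h q, and
  \<open>slope r s\<close> is the divided difference of \<open>A * z + B * z^2 + C * z^3\<close>
  between -h r and -h s. Expressed in p and q, the difference form of the kernels is Newton's
  interpolation formula differentiated at 0.\<close>

lemma bdf3_exact_on_cubics:
  fixes x y h A B C :: real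
  assumes "0 < x" "0 < y"
  defines "p \<equiv> 1 + 1 / x" and "q \<equiv> 1 + 1 / x + 1 / (x * y)"
    and "slope \<equiv> \<lambda>r s. A - B * h * (r + s) + C * h\<^sup>2 * (r\<^sup>2 + r * s + s\<^sup>2)"
  shows "d0 x y * slope 0 1 + d1 x y * slope 1 p + d2 x y * slope p q = A"
proof -
  have pq: "p > 0" "q > 1" unfolding p_def q_def using assms(1,2) by (auto simp: add_pos_pos)
  have a: "x / (1 + x) = 1 / p" unfolding p_def using assms(1,2) by (simp add: field_simps)
  have b: "x * y / (1 + y + x * y) = 1 / q"
    unfolding q_def using assms(1,2) by (simp add: field_simps)
  have "y * (1 + x) / (1 + y) = p / (q - 1)"
    unfolding p_def q_def using assms(1,2) by (simp add: divide_simps) (simp add: algebra_simps)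
  moreover have "d2 x y = x * y / (1 + y + x * y) * (y * (1 + x) / (1 + y))"
    by (simp add: d2_def power2_eq_square)
  ultimately have c: "d2 x y = p / (q * (q - 1))" unfolding b by simp
  have "slope 0 1 - slope 1 p = B * h * p - C * h\<^sup>2 * (p * (1 + p))"
    unfolding slope_def by (simp add: power2_eq_square algebra_simps)
  hence 1: "(1 / p + 1 / q) * (slope 0 1 - slope 1 p)
     = B * h * (1 + p / q) - C * h\<^sup>2 * ((1 + p / q) * (1 + p))"
    using pq by (simp only:) (simp add: field_simps)
  have "slope 1 p - slope p q = (B * h - C * h\<^sup>2 * (1 + p + q)) * (q - 1)"
    unfolding slope_def by (simp add: power2_eq_square algebra_simps)
  hence 2: "p / (q * (q - 1)) * (slope 1 p - slope p q) = p / q * (B * h - C * h\<^sup>2 * (1 + p + q))"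
    using pq by simp
  have "d0 x y * slope 0 1 + d1 x y * slope 1 p + d2 x y * slope p q
    = slope 0 1 + (1 / p + 1 / q) * (slope 0 1 - slope 1 p) - p / (q * (q - 1)) * (slope 1 p - slope p q)"
    by (subst bdf3_kernels_difference_form[OF assms(1,2)]) (simp add: a b c)
  also have "\<dots> = A" unfolding 1 2 slope_def using pq
    by (simp add: field_simps power2_eq_square)
  finally show ?thesis .
qed

text \<open>The bound on the fourth derivative is integrated up through \<open>R3\<close>,
  \<open>R2\<close> and \<open>R1\<close>, each of which vanishes at s. The last step uses only a
  Lipschitz bound for \<open>R0\<close>, so the denominator \<open>r - r'\<close> cancels however
  short that step is.\<close>

lemma taylor_slope_remainder:
  fixes \<phi> :: "nat \<Rightarrow> real \<Rightarrow> real"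
  assumes deriv: "\<And>j z. j < 4 \<Longrightarrow> z \<in> {a..s} \<Longrightarrow> (\<phi> j has_real_derivative \<phi> (Suc j) z) (at z within {a..s})"
    and M: "\<And>z. z \<in> {a..s} \<Longrightarrow> \<bar>\<phi> 4 z\<bar> \<le> M"
    and rr: "a \<le> r'" "r' < r" "r \<le> s" and L: "s - a \<le> L"
  shows "\<bar>(\<phi> 0 r - \<phi> 0 r') / (r - r') - (\<phi> 1 s + \<phi> 2 s / 2 * ((r - s) + (r' - s))
      + \<phi> 3 s / 6 * ((r - s)\<^sup>2 + (r - s) * (r' - s) + (r' - s)\<^sup>2))\<bar> \<le> M * L^3"
proof -
  define R3 where "R3 z = \<phi> 3 z - \<phi> 3 s" for z
  define R2 where "R2 z = \<phi> 2 z - \<phi> 2 s - \<phi> 3 s * (z - s)" for z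
  define R1 where "R1 z = \<phi> 1 z - \<phi> 1 s - \<phi> 2 s * (z - s) - \<phi> 3 s * (z - s)\<^sup>2 / 2" for z
  \<comment> \<open>The constant \<open>\<phi> 0 s\<close> is not subtracted: only differences of
    \<open>R0\<close> occur.\<close>
  define R0 where "R0 z = \<phi> 0 z - \<phi> 1 s * (z - s) - \<phi> 2 s * (z - s)\<^sup>2 / 2 - \<phi> 3 s * (z - s)^3 / 6" for z
  have M0: "M \<ge> 0" using M[of s] rr by force
  have L0: "L \<ge> 0" using L rr by linarith
  have d: "(\<phi> 0 has_real_derivative \<phi> 1 z) (at z within {a..s})"
     "(\<phi> 1 has_real_derivative \<phi> 2 z) (at z within {a..s})"
     "(\<phi> 2 has_real_derivative \<phi> 3 z) (at z within {a..s})"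
     "(\<phi> 3 has_real_derivative \<phi> 4 z) (at z within {a..s})" if "z \<in> {a..s}" for z
    using deriv[of 0 z] deriv[of 1 z] deriv[of 2 z] deriv[of 3 z] that by (simp_all add: numeral_eq_Suc)
  have step: "\<bar>f z - f s\<bar> \<le> B * L"
    if "\<And>z. z \<in> {a..s} \<Longrightarrow> (f has_real_derivative f' z) (at z within {a..s})"
      "\<And>z. z \<in> {a..s} \<Longrightarrow> \<bar>f' z\<bar> \<le> B" "z \<in> {a..s}" "B \<ge> 0" for f f' :: "real \<Rightarrow> real" and B z
  proof -
    have "norm (f z - f s) \<le> B * norm (z - s)"
      using that by (intro field_differentiable_bound[of "{a..s}" f f']) auto
    also have "\<dots> \<le> B * L" using that L by (intro mult_left_mono) auto
    finally show ?thesis by simp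
  qed
  have b3: "\<bar>R3 z\<bar> \<le> M * L" if "z \<in> {a..s}" for z
    using step[of "\<phi> 3" "\<phi> 4" M z] d(4) M that M0 by (simp add: R3_def)
  have b2: "\<bar>R2 z\<bar> \<le> M * L * L" if "z \<in> {a..s}" for z
  proof -
    have "\<bar>R2 z - R2 s\<bar> \<le> M * L * L"
      by (rule step[of R2 R3])
        (use that M0 L0 b3 in \<open>auto simp: R2_def[abs_def] R3_def simp del: One_nat_def intro!: derivative_eq_intros d\<close>)
    thus ?thesis by (simp add: R2_def)
  qed
  have b1: "\<bar>R1 z\<bar> \<le> M * L * L * L" if "z \<in> {a..s}" for z
  proof -
    have "\<bar>R1 z - R1 s\<bar> \<le> M * L * L * L"
      by (rule step[of R1 R2])
        (use that M0 L0 b2 in \<open>auto simp: R1_def[abs_def] R2_def power2_eq_square simp del: One_nat_def intro!: derivative_eq_intros d\<close>)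
    thus ?thesis by (simp add: R1_def)
  qed
  have "norm (R0 r - R0 r') \<le> M * L * L * L * norm (r - r')"
  proof (rule field_differentiable_bound[of "{a..s}" R0 R1])
    show "(R0 has_field_derivative R1 z) (at z within {a..s})" if "z \<in> {a..s}" for z
      unfolding R0_def R1_def using that
      by (auto intro!: derivative_eq_intros d simp: power2_eq_square field_simps simp del: One_nat_def)
  qed (use b1 rr in auto)
  hence "\<bar>(R0 r - R0 r') / (r - r')\<bar> \<le> M * L^3"
    using rr by (simp add: divide_le_eq power3_eq_cube mult_ac)
  moreover have "(R0 r - R0 r') / (r - r') = (\<phi> 0 r - \<phi> 0 r') / (r - r') - (\<phi> 1 s + \<phi> 2 s / 2 * ((r - s) + (r' - s))
      + \<phi> 3 s / 6 * ((r - s)\<^sup>2 + (r - s) * (r' - s) + (r' - s)\<^sup>2))"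
  proof -
    have "R0 r - R0 r' = (\<phi> 0 r - \<phi> 0 r') - (\<phi> 1 s + \<phi> 2 s / 2 * ((r - s) + (r' - s))
      + \<phi> 3 s / 6 * ((r - s)\<^sup>2 + (r - s) * (r' - s) + (r' - s)\<^sup>2)) * (r - r')"
      unfolding R0_def by (simp add: field_simps power2_eq_square power3_eq_cube)
    thus ?thesis using rr by (simp only:) (simp add: diff_divide_distrib)
  qed
  ultimately show ?thesis by simp
qed

text \<open>Here 162 is 27 * (3 + 2 + 1): the nodes span at most 3 \<tau>, which gives 27 M \<tau>^3
  for each quotient, and 3, 2, 1 bound the three kernels.\<close>

lemma (in bdf3_mesh) bdf3_consistency:
  fixes \<phi> :: "nat \<Rightarrow> real \<Rightarrow> real"
  assumes k: "3 \<le> k" "k \<le> N"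
    and deriv: "\<And>j z. j < 4 \<Longrightarrow> z \<in> {0..t N} \<Longrightarrow> (\<phi> j has_real_derivative \<phi> (Suc j) z) (at z within {0..t N})"
    and M: "\<And>z. z \<in> {0..t N} \<Longrightarrow> \<bar>\<phi> 4 z\<bar> \<le> M"
    and step: "\<And>m. 1 \<le> m \<Longrightarrow> m \<le> N \<Longrightarrow> tau t m \<le> \<tau>"
  shows "\<bar>(\<Sum>j=1..k. bdf3 t k (k - j) * ((\<phi> 0 (t j) - \<phi> 0 (t (j - 1))) / tau t j)) - \<phi> 1 (t k)\<bar> \<le> 162 * M * \<tau>^3"
proof -
  define x y h s where "x = ratio t k" and "y = ratio t (k - 1)" and "h = tau t k" and "s = t k"
  have xy: "0 < x" "x \<le> 3/2" "0 < y" "y \<le> 3/2"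
    unfolding x_def y_def using ratio_pos ratio_le k by auto
  have b: "bdf3 t k 0 = d0 x y" "bdf3 t k 1 = d1 x y" "bdf3 t k 2 = d2 x y"
    by (simp_all add: bdf3_def x_def y_def Let_def)
  define p q where "p = 1 + 1 / x" and "q = 1 + 1 / x + 1 / (x * y)"
  have tp: "tau t k > 0" "tau t (k - 1) > 0" "tau t (k - 2) > 0" using tau_pos k by auto
  have km: "k - 1 - 1 = k - 2" "k - 2 - 1 = k - 3" by simp_all
  have hx: "tau t (k - 1) = h / x" unfolding h_def x_def ratio_def using tp by simp
  have hxy: "tau t (k - 2) = h / (x * y)"
    unfolding h_def x_def y_def ratio_def km using tp by simp
  have t1: "t (k - 1) - s = - h" by (simp add: h_def s_def tau_def)
  have t2: "t (k - 2) - s = - (h * p)"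
    using hx t1 unfolding tau_def km by (simp add: p_def algebra_simps)
  have t3: "t (k - 3) - s = - (h * q)"
    using hxy t2 unfolding tau_def km by (simp add: p_def q_def algebra_simps)
  define A B C where "A = \<phi> 1 s" and "B = \<phi> 2 s / 2" and "C = \<phi> 3 s / 6"
  define slope where "slope r r' = A - B * h * (r + r') + C * h\<^sup>2 * (r\<^sup>2 + r * r' + r'\<^sup>2)" for r r'
  have exact: "d0 x y * slope 0 1 + d1 x y * slope 1 p + d2 x y * slope p q = A"
    unfolding slope_def p_def q_def by (rule bdf3_exact_on_cubics) (use xy in auto)
  define g where "g j = (\<phi> 0 (t j) - \<phi> 0 (t (j - 1))) / tau t j" for j
  define E where "E = 27 * M * \<tau>^3"
  have lenk: "t k - t (k - 3) \<le> 3 * \<tau>"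
  proof -
    have "tau t k \<le> \<tau>" "tau t (k - 1) \<le> \<tau>" "tau t (k - 2) \<le> \<tau>" using step k by auto
    thus ?thesis unfolding tau_def km by simp
  qed
  have sub: "{t (k - 3)..s} \<subseteq> {0..t N}"
    using t_mono[of 0 "k - 3"] t_mono[of k N] k t_0 by (auto simp: s_def)
  have rem: "\<bar>g j - (A + B * ((t j - s) + (t (j - 1) - s))
      + C * ((t j - s)\<^sup>2 + (t j - s) * (t (j - 1) - s) + (t (j - 1) - s)\<^sup>2))\<bar> \<le> E"
    if "j \<in> {k - 2..k}" for j
  proof -
    have "\<bar>g j - (A + B * ((t j - s) + (t (j - 1) - s))
      + C * ((t j - s)\<^sup>2 + (t j - s) * (t (j - 1) - s) + (t (j - 1) - s)\<^sup>2))\<bar> \<le> M * (3 * \<tau>)^3"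
      unfolding g_def tau_def A_def B_def C_def
    proof (rule taylor_slope_remainder[of "t (k - 3)"])
      show "(\<phi> i has_real_derivative \<phi> (Suc i) z) (at z within {t (k - 3)..s})"
        if "i < 4" "z \<in> {t (k - 3)..s}" for i z
        using deriv[of i z] that sub by (auto intro: DERIV_subset)
      show "\<bar>\<phi> 4 z\<bar> \<le> M" if "z \<in> {t (k - 3)..s}" for z using M that sub by auto
      show "t (k - 3) \<le> t (j - 1)" "t j \<le> s" using that k unfolding s_def by (auto intro!: t_mono)
      show "t (j - 1) < t j" using tau_pos[of j] that k by (auto simp: tau_def)
      show "s - t (k - 3) \<le> 3 * \<tau>" using lenk by (simp add: s_def)
    qed
    thus ?thesis by (simp add: E_def power_mult_distrib)
  qed
  have r0: "\<bar>g k - slope 0 1\<bar> \<le> E" and r1: "\<bar>g (k - 1) - slope 1 p\<bar> \<le> E" and r2: "\<bar>g (k - 2) - slope p q\<bar> \<le> E"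
    using rem[of k] rem[of "k - 1"] rem[of "k - 2"] k
    unfolding km t1 t2 t3 slope_def by (simp_all add: s_def algebra_simps power2_eq_square)
  have E0: "E \<ge> 0" using r0 by linarith
  have "(\<Sum>j=1..k. bdf3 t k (k - j) * g j) - A
     = d0 x y * (g k - slope 0 1) + d1 x y * (g (k - 1) - slope 1 p) + d2 x y * (g (k - 2) - slope p q)"
    unfolding sum_bdf3[OF k(1)] b using exact by (simp add: algebra_simps)
  also have "\<bar>\<dots>\<bar> \<le> \<bar>d0 x y\<bar> * \<bar>g k - slope 0 1\<bar> + \<bar>d1 x y\<bar> * \<bar>g (k - 1) - slope 1 p\<bar> + \<bar>d2 x y\<bar> * \<bar>g (k - 2) - slope p q\<bar>"
    unfolding abs_mult[symmetric] by (intro order_trans[OF abs_triangle_ineq] add_right_mono abs_triangle_ineq)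
  also have "\<dots> \<le> 3 * E + 2 * E + 1 * E"
    using r0 r1 r2 bdf3_bounds[OF xy] E0 by (intro add_mono mult_mono) auto
  finally show ?thesis by (simp add: g_def A_def s_def E_def)
qed

section \<open>Green's formula with a cutoff\<close>

lemma integrable_lborel_compact_support:
  fixes f :: "'a::euclidean_space \<Rightarrow> real"
  assumes "compact K" "continuous_on K f" "\<And>x. x \<notin> K \<Longrightarrow> f x = 0"
  shows "integrable lborel f"
proof -
  have "(\<lambda>x. indicator K x *\<^sub>R f x) = f"
  proof
    show "indicator K x *\<^sub>R f x = f x" for x using assms(3)[of x] by (cases "x \<in> K") auto
  qed
  thus ?thesis using borel_integrable_compact[OF assms(1,2)] by simp
qed

text \<open>By translation invariance of Lebesgue measure every difference quotient of F along b has
  integral zero; dominated convergence passes to the derivative. This replaces the divergence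
  theorem.\<close>

lemma integral_directional_derivative_eq_0:
  fixes F F' :: "'a::euclidean_space \<Rightarrow> real" and b :: 'a
  assumes K: "compact K" "\<And>x. x \<notin> K \<Longrightarrow> F x = 0" "\<And>x. x \<notin> K \<Longrightarrow> F' x = 0"
    and cont: "continuous_on UNIV F" "continuous_on UNIV F'"
    and deriv: "\<And>x. ((\<lambda>s. F (x + s *\<^sub>R b)) has_real_derivative F' x) (at 0)"
  shows "integral\<^sup>L lborel F' = 0"
proof -
  have "compact (F' ` K)" using K cont(2) by (meson compact_continuous_image continuous_on_subset subset_UNIV)
  then obtain M0 where "\<And>x. x \<in> K \<Longrightarrow> \<bar>F' x\<bar> \<le> M0"
    using compact_imp_bounded[of "F' ` K"] by (auto simp: bounded_iff)
  hence "\<bar>F' x\<bar> \<le> max M0 0" for x using K(3)[of x] by (cases "x \<in> K") (auto simp: le_max_iff_disj)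
  then obtain M where M: "\<And>x. \<bar>F' x\<bar> \<le> M" "M \<ge> 0" by (metis max.cobounded2)
  obtain R where R: "\<And>x. x \<in> K \<Longrightarrow> norm x \<le> R"
    using compact_imp_bounded[OF K(1)] by (auto simp: bounded_iff)
  have deriv': "((\<lambda>s. F (x + s *\<^sub>R b)) has_real_derivative F' (x + s *\<^sub>R b)) (at s)" for x s
  proof -
    have "((\<lambda>h. F (x + s *\<^sub>R b + h *\<^sub>R b)) has_real_derivative F' (x + s *\<^sub>R b)) (at 0)"
      by (rule deriv)
    hence "((\<lambda>h. F (x + (h + s) *\<^sub>R b)) has_real_derivative F' (x + s *\<^sub>R b)) (at 0)"
      by (simp add: scaleR_add_left algebra_simps)
    thus ?thesis using DERIV_shift[of "\<lambda>s. F (x + s *\<^sub>R b)" _ 0 s] by simp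
  qed
  have lip: "\<bar>F (x + s *\<^sub>R b) - F x\<bar> \<le> M * \<bar>s\<bar>" for x s
    using field_differentiable_bound[of UNIV "\<lambda>s. F (x + s *\<^sub>R b)" "\<lambda>s. F' (x + s *\<^sub>R b)" M s 0] deriv' M
    by simp
  have iF: "integrable lborel F"
    using K cont by (intro integrable_lborel_compact_support[of K]) (auto intro: continuous_on_subset)
  have shift: "integrable lborel (\<lambda>x. F (x + c))" "integral\<^sup>L lborel (\<lambda>x. F (x + c)) = integral\<^sup>L lborel F" for c
  proof -
    have "integrable (distr lborel borel ((+) c)) F" using iF by (simp add: lborel_distr_plus)
    thus "integrable lborel (\<lambda>x. F (x + c))" by (subst (asm) integrable_distr_eq) (use iF in \<open>auto simp: add.commute\<close>)
    have "integral\<^sup>L lborel F = integral\<^sup>L (distr lborel borel ((+) c)) F" by (simp add: lborel_distr_plus)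
    also have "\<dots> = integral\<^sup>L lborel (\<lambda>x. F (c + x))" using iF by (intro integral_distr) auto
    finally show "integral\<^sup>L lborel (\<lambda>x. F (x + c)) = integral\<^sup>L lborel F" by (simp add: add.commute)
  qed
  define h where "h i = inverse (real (Suc i))" for i
  have h: "h i > 0" "h i \<le> 1" for i unfolding h_def by (auto simp: divide_simps)
  have h0: "h \<longlonglongrightarrow> 0" unfolding h_def by (rule LIMSEQ_inverse_real_of_nat)
  define S where "S i x = (F (x + h i *\<^sub>R b) - F x) / h i" for i x
  have "(\<lambda>i. integral\<^sup>L lborel (S i)) \<longlonglongrightarrow> integral\<^sup>L lborel F'"
  proof (rule integral_dominated_convergence)
    show "F' \<in> borel_measurable lborel" using cont(2) by (simp add: borel_measurable_continuous_onI)
    show "S i \<in> borel_measurable lborel" for i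
      unfolding S_def using shift(1)[of "h i *\<^sub>R b"] iF by measurable
    \<comment> \<open>The increments \<open>h i\<close> are at most 1, so all quotients vanish
      outside this ball, and M is a Lipschitz constant of F along b.\<close>
    show "integrable lborel (\<lambda>x. M * indicator (cball (0::'a) (R + norm b)) x)"
      by (intro integrable_mult_right integrable_real_indicator) (use emeasure_bounded_finite[OF bounded_cball, of "0::'a" "R + norm b"] in \<open>auto simp: less_top\<close>)
    show "AE x in lborel. (\<lambda>i. S i x) \<longlonglongrightarrow> F' x"
    proof (rule AE_I2)
      fix x
      have "((\<lambda>s. (F (x + s *\<^sub>R b) - F x) / s) \<longlongrightarrow> F' x) (at 0)"
        using deriv[of x] by (simp add: DERIV_def)
      moreover have "filterlim h (at 0) sequentially"
        using h0 h by (intro filterlim_atI) (auto intro!: always_eventually less_imp_neq[symmetric])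
      ultimately show "(\<lambda>i. S i x) \<longlonglongrightarrow> F' x"
        unfolding S_def by (rule filterlim_compose)
    qed
    show "AE x in lborel. norm (S i x) \<le> M * indicator (cball 0 (R + norm b)) x" for i
    proof (rule AE_I2)
      fix x
      show "norm (S i x) \<le> M * indicator (cball 0 (R + norm b)) x"
      proof (cases "x \<in> cball 0 (R + norm b)")
        case True
        thus ?thesis using lip[of x "h i"] h[of i] by (simp add: S_def divide_le_eq)
      next
        case False
        hence nx: "norm x > R + norm b" by simp
        have "x \<notin> K" using R[of x] nx norm_ge_zero[of b] by linarith
        moreover have "x + h i *\<^sub>R b \<notin> K"
        proof
          assume "x + h i *\<^sub>R b \<in> K"
          hence "norm (x + h i *\<^sub>R b) \<le> R" by (rule R)
          moreover have "norm (h i *\<^sub>R b) \<le> norm b" using h[of i] by (simp add: mult_left_le_one_le)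
          moreover have "norm x \<le> norm (x + h i *\<^sub>R b) + norm (h i *\<^sub>R b)"
            using norm_triangle_ineq4[of "x + h i *\<^sub>R b" "h i *\<^sub>R b"] by simp
          ultimately show False using nx by linarith
        qed
        ultimately show ?thesis using K(2) M(2) by (simp add: S_def)
      qed
    qed
  qed
  moreover have "integral\<^sup>L lborel (S i) = 0" for i
    unfolding S_def using shift[of "h i *\<^sub>R b"] iF by simp
  ultimately show ?thesis by (simp add: LIMSEQ_const_iff)
qed

section \<open>A cutoff profile that vanishes near zero\<close>

lemma has_real_derivative_max_0_squared:
  "((\<lambda>w::real. (max 0 w)\<^sup>2) has_real_derivative 2 * max 0 w) (at w)"
proof -
  have "((\<lambda>h. ((max 0 (w + h))\<^sup>2 - (max 0 w)\<^sup>2) / h - 2 * max 0 w) \<longlongrightarrow> 0) (at 0)"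
  proof (rule Lim_null_comparison)
    have "\<bar>((max 0 (w + h))\<^sup>2 - (max 0 w)\<^sup>2) / h - 2 * max 0 w\<bar> \<le> \<bar>h\<bar>" if "h \<noteq> 0" for h
    proof -
      have "\<bar>(max 0 (w + h))\<^sup>2 - (max 0 w)\<^sup>2 - 2 * max 0 w * h\<bar> \<le> h\<^sup>2"
      proof (cases "w \<ge> 0"; cases "w + h \<ge> 0")
        assume "w \<ge> 0" "\<not> w + h \<ge> 0"
        hence "w * (w + 2 * h) \<le> 0" by (intro mult_nonneg_nonpos) auto
        moreover have "h\<^sup>2 \<ge> 0" by simp
        moreover have "(w + h)\<^sup>2 \<ge> 0" by simp
        ultimately show ?thesis using \<open>w \<ge> 0\<close> \<open>\<not> w + h \<ge> 0\<close>
          by (simp add: power2_eq_square algebra_simps)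
      next
        assume "\<not> w \<ge> 0" "w + h \<ge> 0"
        hence "(w + h)\<^sup>2 \<le> h\<^sup>2" by (intro power_mono) auto
        thus ?thesis using \<open>\<not> w \<ge> 0\<close> \<open>w + h \<ge> 0\<close> by simp
      qed (auto simp: power2_eq_square algebra_simps)
      hence "\<bar>((max 0 (w + h))\<^sup>2 - (max 0 w)\<^sup>2 - 2 * max 0 w * h) / h\<bar> \<le> \<bar>h\<bar>"
        using that by (simp add: divide_le_eq power2_eq_square abs_mult[symmetric])
      thus ?thesis using that by (simp add: diff_divide_distrib)
    qed
    thus "\<forall>\<^sub>F h in at 0. norm (((max 0 (w + h))\<^sup>2 - (max 0 w)\<^sup>2) / h - 2 * max 0 w) \<le> \<bar>h\<bar>"
      by (auto simp: eventually_at_filter)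
    show "((\<lambda>h::real. \<bar>h\<bar>) \<longlongrightarrow> 0) (at 0)" by (intro tendsto_rabs_zero tendsto_ident_at)
  qed
  thus ?thesis unfolding DERIV_def by (simp add: LIM_zero_iff)
qed

text \<open>Squaring the positive part makes the profile continuously differentiable, which is all
  that one integration by parts asks for. It vanishes for \<open>c * s \<le> 1\<close> and tends to
  1 as c grows when s > 0; the rational form keeps the bounds on \<open>s * cutoff' c s\<close>
  elementary.\<close>

definition cutoff :: "real \<Rightarrow> real \<Rightarrow> real" where
  "cutoff c s = (max 0 (c * s - 1))\<^sup>2 / (1 + (max 0 (c * s - 1))\<^sup>2)"

definition cutoff' :: "real \<Rightarrow> real \<Rightarrow> real" where
  "cutoff' c s = 2 * c * max 0 (c * s - 1) / (1 + (max 0 (c * s - 1))\<^sup>2)\<^sup>2"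

lemma one_plus_square_pos: "0 < 1 + (z::real)\<^sup>2"
  by (simp add: add_pos_nonneg)

lemma DERIV_cutoff: "(cutoff c has_real_derivative cutoff' c s) (at s)"
proof -
  have m: "((\<lambda>s. (max 0 (c * s - 1))\<^sup>2) has_real_derivative 2 * max 0 (c * s - 1) * c) (at s)"
    by (rule DERIV_chain2[of "\<lambda>w. (max 0 w)\<^sup>2"]) (auto intro!: has_real_derivative_max_0_squared derivative_eq_intros)
  have nz: "1 + (max 0 (c * s - 1))\<^sup>2 \<noteq> 0" using one_plus_square_pos[of "max 0 (c * s - 1)"] by linarith
  have m': "((\<lambda>s. 1 + (max 0 (c * s - 1))\<^sup>2) has_real_derivative 2 * max 0 (c * s - 1) * c) (at s)"
    using DERIV_add[OF DERIV_const m] by simp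
  show ?thesis
    unfolding cutoff_def[abs_def] cutoff'_def
    by (rule DERIV_cong[OF DERIV_divide[OF m m' nz]]) (simp add: power2_eq_square algebra_simps)
qed

lemma continuous_on_cutoff: "continuous_on A (cutoff c)" "continuous_on A (cutoff' c)"
  unfolding cutoff_def[abs_def] cutoff'_def[abs_def]
  by (auto intro!: continuous_intros simp: power2_eq_square add_nonneg_eq_0_iff)

lemma cutoff_eq_0: "c * s \<le> 1 \<Longrightarrow> cutoff c s = 0" "c * s \<le> 1 \<Longrightarrow> cutoff' c s = 0"
  by (simp_all add: cutoff_def cutoff'_def max_def)

lemma cutoff_bounds: "0 \<le> cutoff c s" "cutoff c s \<le> 1" "c \<ge> 0 \<Longrightarrow> 0 \<le> cutoff' c s"
  by (auto simp: cutoff_def cutoff'_def divide_le_eq one_plus_square_pos add_pos_nonneg)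

lemma cutoff_mono:
  assumes "c \<le> d" "s \<ge> 0" shows "cutoff c s \<le> cutoff d s"
proof -
  have "c * s \<le> d * s" using assms by (rule mult_right_mono)
  hence "(max 0 (c * s - 1))\<^sup>2 \<le> (max 0 (d * s - 1))\<^sup>2" by (intro power_mono) auto
  moreover have "p / (1 + p) \<le> q / (1 + q)" if "0 \<le> p" "p \<le> q" for p q :: real
    using that by (simp add: divide_simps algebra_simps)
  ultimately show ?thesis unfolding cutoff_def by simp
qed

lemma one_minus_cutoff_le:
  assumes "c > 0" "s > 0" shows "1 - cutoff c s \<le> 2 / (c * s)"
proof -
  define z where "z = max 0 (c * s - 1)"
  have z: "c * s \<le> 1 + z" "c * s > 0" using assms by (auto simp: z_def)
  have "1 + z \<le> 2 * (1 + z\<^sup>2)"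
  proof -
    have "2 * (1 + z\<^sup>2) - (1 + z) = (z - 1)\<^sup>2 + z\<^sup>2 + z" by (simp add: power2_eq_square algebra_simps)
    thus ?thesis by (smt (verit) max.cobounded1 z_def zero_le_power2)
  qed
  hence "c * s \<le> 2 * (1 + z\<^sup>2)" using z by linarith
  moreover have "1 - cutoff c s = 1 / (1 + z\<^sup>2)"
    unfolding cutoff_def z_def[symmetric] using one_plus_square_pos[of z] by (simp add: field_simps)
  moreover have "1 / w \<le> 2 / r" if "r \<le> 2 * w" "0 < r" "0 < w" for r w :: real
    using that by (simp add: field_simps)
  ultimately show ?thesis using z(2) one_plus_square_pos[of z] by simp
qed

text \<open>In terms of z = c s - 1 the left side is
  \<open>2 * (z + 1) * z / (1 + z\<^sup>2)\<^sup>2\<close>, free of c. The bound has two uses: it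
  dominates the commutator term uniformly in c, and it forces that term to zero.\<close>

lemma mult_cutoff'_le:
  assumes "c > 0" "s \<ge> 0"
  shows "s * cutoff' c s \<le> 3 * (1 - cutoff c s)"
proof (cases "c * s \<le> 1")
  case True
  thus ?thesis by (simp add: cutoff_eq_0)
next
  case False
  define z where "z = c * s - 1"
  have z: "z > 0" "max 0 (c * s - 1) = z" "s * c = z + 1" using False by (auto simp: z_def)
  have p: "0 < 1 + z\<^sup>2" by (rule one_plus_square_pos)
  have "2 * (z + 1) * z \<le> 3 * (1 + z\<^sup>2)"
    using zero_le_power2[of "z - 1"] by (simp add: power2_eq_square algebra_simps)
  hence "2 * (z + 1) * z / (1 + z\<^sup>2)\<^sup>2 \<le> 3 * (1 + z\<^sup>2) / (1 + z\<^sup>2)\<^sup>2"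
    by (rule divide_right_mono) simp
  also have "\<dots> = 3 * (1 / (1 + z\<^sup>2))"
  proof -
    have "3 * w / w\<^sup>2 = 3 * (1 / w)" for w :: real by (simp add: power2_eq_square)
    thus ?thesis .
  qed
  also have "1 / (1 + z\<^sup>2) = 1 - cutoff c s"
    unfolding cutoff_def z(2) using p by (simp add: field_simps)
  finally show ?thesis unfolding cutoff'_def z(2) z(3)[symmetric] by (simp add: mult_ac)
qed

lemma cutoff_tendsto:
  assumes "s > 0"
  shows "(\<lambda>i. cutoff (real (Suc i)) s) \<longlonglongrightarrow> 1" "(\<lambda>i. s * cutoff' (real (Suc i)) s) \<longlonglongrightarrow> 0"
proof -
  have c: "real (Suc i) > 0" for i by simp
  have "(\<lambda>i. inverse (real (Suc i)) * (2 / s)) \<longlonglongrightarrow> 0"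
    by (rule tendsto_mult_left_zero[OF LIMSEQ_inverse_real_of_nat])
  moreover have "inverse r * (2 / s) = 2 / (r * s)" for r by (simp add: divide_simps)
  ultimately have 0: "(\<lambda>i. 2 / (real (Suc i) * s)) \<longlonglongrightarrow> 0" by (simp only:)
  have 1: "(\<lambda>i. 1 - cutoff (real (Suc i)) s) \<longlonglongrightarrow> 0"
  proof (rule tendsto_sandwich[OF _ _ tendsto_const 0])
    show "\<forall>\<^sub>F i in sequentially. 0 \<le> 1 - cutoff (real (Suc i)) s"
      using cutoff_bounds(2) by (intro always_eventually allI) (simp del: of_nat_Suc)
    show "\<forall>\<^sub>F i in sequentially. 1 - cutoff (real (Suc i)) s \<le> 2 / (real (Suc i) * s)"
      by (intro always_eventually allI one_minus_cutoff_le c assms)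
  qed
  show "(\<lambda>i. cutoff (real (Suc i)) s) \<longlonglongrightarrow> 1"
    using tendsto_diff[OF tendsto_const[of 1] 1] by (simp del: of_nat_Suc)
  have 3: "(\<lambda>i. 3 * (1 - cutoff (real (Suc i)) s)) \<longlonglongrightarrow> 0"
    by (rule tendsto_mult_right_zero[OF 1])
  show "(\<lambda>i. s * cutoff' (real (Suc i)) s) \<longlonglongrightarrow> 0"
  proof (rule tendsto_sandwich[OF _ _ tendsto_const 3])
    show "\<forall>\<^sub>F i in sequentially. 0 \<le> s * cutoff' (real (Suc i)) s"
      using assms c by (intro always_eventually allI mult_nonneg_nonneg cutoff_bounds(3)) (auto intro: less_imp_le)
    show "\<forall>\<^sub>F i in sequentially. s * cutoff' (real (Suc i)) s \<le> 3 * (1 - cutoff (real (Suc i)) s)"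
      using assms c by (intro always_eventually allI mult_cutoff'_le) (auto intro: less_imp_le)
  qed
qed

section \<open>Integrability on bounded open sets\<close>

lemma eventually_line_in_open:
  fixes x b :: "'a::real_normed_vector"
  assumes "open S" "x \<in> S"
  shows "\<forall>\<^sub>F s in nhds 0. x + s *\<^sub>R b \<in> S"
proof -
  have "((\<lambda>s::real. x + s *\<^sub>R b) \<longlongrightarrow> x) (nhds 0)"
    by (rule tendsto_eq_intros filterlim_ident refl | simp)+
  thus ?thesis using assms by (rule topological_tendstoD)
qed

lemma set_integrable_compact_support:
  fixes f :: "'a::euclidean_space \<Rightarrow> real"
  assumes "compact K" "K \<subseteq> \<Omega>" "continuous_on \<Omega> f" "\<And>x. x \<in> \<Omega> - K \<Longrightarrow> f x = 0"
  shows "set_integrable lebesgue \<Omega> f"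
    and "(LINT x:\<Omega>|lebesgue. f x) = integral\<^sup>L lborel (\<lambda>x. indicator \<Omega> x *\<^sub>R f x)"
proof -
  have eq: "indicator \<Omega> x *\<^sub>R f x = indicator K x *\<^sub>R f x" for x
    using assms(2) assms(4)[of x] by (cases "x \<in> K"; cases "x \<in> \<Omega>") auto
  have i: "integrable lborel (\<lambda>x. indicator \<Omega> x *\<^sub>R f x)"
    unfolding eq by (rule borel_integrable_compact[OF assms(1) continuous_on_subset[OF assms(3,2)]])
  show "set_integrable lebesgue \<Omega> f"
    unfolding set_integrable_def using i by (subst integrable_completion[OF borel_measurable_integrable]) (simp_all del: real_scaleR_def)
  show "(LINT x:\<Omega>|lebesgue. f x) = integral\<^sup>L lborel (\<lambda>x. indicator \<Omega> x *\<^sub>R f x)"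
    unfolding set_lebesgue_integral_def using i by (subst integral_completion[OF borel_measurable_integrable]) (simp_all del: real_scaleR_def)
qed

lemma set_borel_measurable_continuous_on_open:
  fixes f :: "'a::euclidean_space \<Rightarrow> real"
  assumes "open \<Omega>" "continuous_on \<Omega> f"
  shows "set_borel_measurable lebesgue \<Omega> f"
  unfolding set_borel_measurable_def
  using borel_measurable_continuous_on_indicator[of \<Omega> f] assms
  by (intro measurable_completion) auto

lemma set_integrable_const_bounded:
  fixes \<Omega> :: "'a::euclidean_space set"
  assumes "open \<Omega>" "bounded \<Omega>"
  shows "set_integrable lebesgue \<Omega> (\<lambda>x. c :: real)"
proof -
  have "emeasure lebesgue \<Omega> < \<infinity>" using emeasure_bounded_finite[OF assms(2)] assms(1) by simp
  moreover have "\<Omega> \<in> sets lebesgue" using assms(1) by simp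
  ultimately show ?thesis unfolding set_integrable_def by (auto intro!: integrable_scaleR_left)
qed

lemma set_integrable_mult_of_squares:
  fixes f h :: "'a::euclidean_space \<Rightarrow> real"
  assumes "set_borel_measurable lebesgue \<Omega> f" "set_integrable lebesgue \<Omega> (\<lambda>x. (f x)\<^sup>2)"
    and "set_borel_measurable lebesgue \<Omega> h" "set_integrable lebesgue \<Omega> (\<lambda>x. (h x)\<^sup>2)"
  shows "set_integrable lebesgue \<Omega> (\<lambda>x. f x * h x)"
proof (rule set_integrable_bound)
  show "set_integrable lebesgue \<Omega> (\<lambda>x. (f x)\<^sup>2 + (h x)\<^sup>2)" using assms by (intro set_integral_add)
  have "(\<lambda>x. (indicator \<Omega> x *\<^sub>R f x) * (indicator \<Omega> x *\<^sub>R h x)) \<in> borel_measurable lebesgue"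
    using assms unfolding set_borel_measurable_def by (intro borel_measurable_times)
  moreover have "(indicator \<Omega> x *\<^sub>R f x) * (indicator \<Omega> x *\<^sub>R h x) = indicator \<Omega> x *\<^sub>R (f x * h x)" for x
    by (simp add: indicator_def)
  ultimately show "set_borel_measurable lebesgue \<Omega> (\<lambda>x. f x * h x)"
    unfolding set_borel_measurable_def by (simp only:)
  have "\<bar>p * q\<bar> \<le> p\<^sup>2 + q\<^sup>2" for p q :: real
  proof -
    have "2 * (\<bar>p\<bar> * \<bar>q\<bar>) \<le> p\<^sup>2 + q\<^sup>2"
      using zero_le_power2[of "\<bar>p\<bar> - \<bar>q\<bar>"] by (simp add: power2_diff)
    moreover have "0 \<le> \<bar>p\<bar> * \<bar>q\<bar>" by simp
    ultimately show ?thesis unfolding abs_mult by linarith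
  qed
  thus "AE x in lebesgue. x \<in> \<Omega> \<longrightarrow> norm (f x * h x) \<le> norm ((f x)\<^sup>2 + (h x)\<^sup>2)"
    by (intro AE_I2) (simp add: abs_of_nonneg)
qed

lemma set_integrable_bounded_continuous:
  fixes f :: "'a::euclidean_space \<Rightarrow> real"
  assumes "open \<Omega>" "bounded \<Omega>" "continuous_on (closure \<Omega>) f"
  shows "set_integrable lebesgue \<Omega> f"
proof -
  have "compact (f ` closure \<Omega>)"
    using assms by (intro compact_continuous_image) auto
  then obtain B where B: "\<And>x. x \<in> closure \<Omega> \<Longrightarrow> \<bar>f x\<bar> \<le> B"
    using compact_imp_bounded[of "f ` closure \<Omega>"] by (auto simp: bounded_iff)
  have "continuous_on \<Omega> f" using continuous_on_subset[OF assms(3) closure_subset] .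
  hence "set_borel_measurable lebesgue \<Omega> f" by (rule set_borel_measurable_continuous_on_open[OF assms(1)])
  moreover have "AE x in lebesgue. x \<in> \<Omega> \<longrightarrow> norm (f x) \<le> norm B"
  proof (intro AE_I2 impI)
    fix x assume "x \<in> \<Omega>"
    hence "\<bar>f x\<bar> \<le> B" using B closure_subset by blast
    thus "norm (f x) \<le> norm B" by simp
  qed
  ultimately show ?thesis
    using set_integrable_bound[OF set_integrable_const_bounded[OF assms(1,2), of B]] by blast
qed

text \<open>The functions are treated as one family because the energy form pairs \<open>g j\<close>
  with the Laplacian of \<open>g k\<close>. \<open>G\<close> and \<open>H\<close> hold the pure
  first and second partial derivatives, which may blow up at the boundary; square integrability is
  asked only of the sums over the coordinate directions, since that is what the error equation
  provides.\<close>

locale dirichlet_family =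
  fixes \<Omega> :: "'a::euclidean_space set" and I :: "nat set"
    and g :: "nat \<Rightarrow> 'a \<Rightarrow> real" and G H :: "nat \<Rightarrow> 'a \<Rightarrow> 'a \<Rightarrow> real"
  assumes open_dom: "open \<Omega>" and bounded_dom: "bounded \<Omega>" and fin: "finite I"
    and g_cont: "k \<in> I \<Longrightarrow> continuous_on (closure \<Omega>) (g k)"
    and g_boundary: "k \<in> I \<Longrightarrow> x \<in> frontier \<Omega> \<Longrightarrow> g k x = 0"
    and G: "k \<in> I \<Longrightarrow> b \<in> Basis \<Longrightarrow> x \<in> \<Omega> \<Longrightarrow> ((\<lambda>s. g k (x + s *\<^sub>R b)) has_real_derivative G k b x) (at 0)"
    and H: "k \<in> I \<Longrightarrow> b \<in> Basis \<Longrightarrow> x \<in> \<Omega> \<Longrightarrow> ((\<lambda>s. G k b (x + s *\<^sub>R b)) has_real_derivative H k b x) (at 0)"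
    and G_cont: "k \<in> I \<Longrightarrow> b \<in> Basis \<Longrightarrow> continuous_on \<Omega> (G k b)"
    and H_cont: "k \<in> I \<Longrightarrow> b \<in> Basis \<Longrightarrow> continuous_on \<Omega> (H k b)"
    and H_L2: "k \<in> I \<Longrightarrow> set_integrable lebesgue \<Omega> (\<lambda>x. (\<Sum>b\<in>Basis. H k b x)\<^sup>2)"
begin

definition L where "L k x = (\<Sum>b\<in>Basis. H k b x)"
definition \<rho> where "\<rho> x = (\<Sum>k\<in>I. (g k x)\<^sup>2)"
definition \<rho>' where "\<rho>' b x = (\<Sum>k\<in>I. 2 * g k x * G k b x)"

definition pairing where "pairing a x = (\<Sum>j\<in>I. \<Sum>k\<in>I. a j k * (g j x * L k x))"
definition gradient_form where
  "gradient_form a x = (\<Sum>j\<in>I. \<Sum>k\<in>I. a j k * (\<Sum>b\<in>Basis. G j b x * G k b x))"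
text \<open>The term that arises when the derivative in Green's formula falls on the cutoff.\<close>

definition commutator where
  "commutator a x = (\<Sum>j\<in>I. \<Sum>k\<in>I. a j k * (\<Sum>b\<in>Basis. \<rho>' b x * (g j x * G k b x)))"

lemma g_cont_dom: "k \<in> I \<Longrightarrow> continuous_on \<Omega> (g k)"
  by (rule continuous_on_subset[OF g_cont closure_subset])

lemma L_cont: "k \<in> I \<Longrightarrow> continuous_on \<Omega> (L k)"
  unfolding L_def[abs_def] by (intro continuous_intros H_cont)

lemma \<rho>_cont_closure: "continuous_on (closure \<Omega>) \<rho>"
  unfolding \<rho>_def[abs_def] by (intro continuous_intros g_cont)

lemma \<rho>_cont: "continuous_on \<Omega> \<rho>"
  by (rule continuous_on_subset[OF \<rho>_cont_closure closure_subset])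

lemma \<rho>'_cont: "b \<in> Basis \<Longrightarrow> continuous_on \<Omega> (\<rho>' b)"
  unfolding \<rho>'_def[abs_def] by (intro continuous_intros g_cont_dom G_cont)

lemma \<rho>_nonneg: "\<rho> x \<ge> 0"
  unfolding \<rho>_def by (intro sum_nonneg) auto

lemma pairing_cont: "continuous_on \<Omega> (pairing a)"
  unfolding pairing_def[abs_def] by (intro continuous_intros g_cont_dom L_cont)

lemma gradient_form_cont: "continuous_on \<Omega> (gradient_form a)"
  unfolding gradient_form_def[abs_def] by (intro continuous_intros G_cont)

lemma commutator_cont: "continuous_on \<Omega> (commutator a)"
  unfolding commutator_def[abs_def] by (intro continuous_intros g_cont_dom \<rho>'_cont G_cont)

lemma \<rho>_DERIV:
  assumes "b \<in> Basis" "x \<in> \<Omega>"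
  shows "((\<lambda>s. \<rho> (x + s *\<^sub>R b)) has_real_derivative \<rho>' b x) (at 0)"
proof -
  have "((\<lambda>s. (g k (x + s *\<^sub>R b))\<^sup>2) has_real_derivative 2 * g k x * G k b x) (at 0)" if "k \<in> I" for k
    using DERIV_power[OF G[OF that assms], of 2] by (simp add: mult_ac)
  thus ?thesis unfolding \<rho>_def[abs_def] \<rho>'_def by (intro DERIV_sum)
qed

text \<open>Taken inside the closure so as to be compact; since \<rho> vanishes on the frontier, it
  still lies in \<Omega> and confines the support of the cutoff.\<close>

definition superlevel where "superlevel c = {x \<in> closure \<Omega>. 1 \<le> c * \<rho> x}"

lemma superlevel: "compact (superlevel c)" "superlevel c \<subseteq> \<Omega>"
proof -
  have "continuous_on (closure \<Omega>) (\<lambda>x. c * \<rho> x)" by (intro continuous_intros \<rho>_cont_closure)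
  from continuous_closed_preimage[OF this closed_closure closed_atLeast[of 1]]
  have "closed (superlevel c)" by (simp add: superlevel_def vimage_def Int_def)
  moreover have "bounded (superlevel c)"
    using bounded_closure[OF bounded_dom] by (rule bounded_subset) (auto simp: superlevel_def)
  ultimately show "compact (superlevel c)" by (simp add: compact_eq_bounded_closed)
  have "\<rho> x = 0" if "x \<in> frontier \<Omega>" for x
    using that g_boundary unfolding \<rho>_def by (intro sum.neutral) auto
  hence "x \<notin> frontier \<Omega>" if "x \<in> superlevel c" for x using that by (force simp: superlevel_def)
  thus "superlevel c \<subseteq> \<Omega>"
    using interior_open[OF open_dom] unfolding superlevel_def frontier_def by blast
qed

lemma cutoff_outside:
  assumes "x \<in> \<Omega> - superlevel c"
  shows "cutoff c (\<rho> x) = 0" "cutoff' c (\<rho> x) = 0"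
  using assms closure_subset[of \<Omega>] by (auto simp: superlevel_def intro!: cutoff_eq_0)

lemma cutoff_\<rho>_cont: "continuous_on \<Omega> (\<lambda>x. cutoff c (\<rho> x))" "continuous_on \<Omega> (\<lambda>x. cutoff' c (\<rho> x))"
  by (rule continuous_on_compose2[OF continuous_on_cutoff(1)[of UNIV c] \<rho>_cont], simp)
    (rule continuous_on_compose2[OF continuous_on_cutoff(2)[of UNIV c] \<rho>_cont], simp)

lemma cutoff_integrable:
  assumes "continuous_on \<Omega> f"
  shows "set_integrable lebesgue \<Omega> (\<lambda>x. cutoff c (\<rho> x) * f x)"
    and "set_integrable lebesgue \<Omega> (\<lambda>x. cutoff' c (\<rho> x) * f x)"
proof -
  show "set_integrable lebesgue \<Omega> (\<lambda>x. cutoff c (\<rho> x) * f x)"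
    by (rule set_integrable_compact_support(1)[OF superlevel[of c]])
      (simp_all add: cutoff_outside continuous_on_mult cutoff_\<rho>_cont assms)
  show "set_integrable lebesgue \<Omega> (\<lambda>x. cutoff' c (\<rho> x) * f x)"
    by (rule set_integrable_compact_support(1)[OF superlevel[of c]])
      (simp_all add: cutoff_outside continuous_on_mult cutoff_\<rho>_cont assms)
qed

text \<open>The integrand is the derivative along b of
  \<open>cutoff c (\<rho> x) * (g j x * G k b x)\<close>, which extends by zero to a compactly
  supported function on the whole space.\<close>

lemma cutoff_divergence:
  assumes jk: "j \<in> I" "k \<in> I" and b: "b \<in> Basis"
  shows "(LINT x:\<Omega>|lebesgue. cutoff c (\<rho> x) * (g j x * H k b x) + cutoff c (\<rho> x) * (G j b x * G k b x)
      + cutoff' c (\<rho> x) * (\<rho>' b x * (g j x * G k b x))) = 0"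
proof -
  define f where "f x = cutoff c (\<rho> x) * (g j x * H k b x) + cutoff c (\<rho> x) * (G j b x * G k b x)
      + cutoff' c (\<rho> x) * (\<rho>' b x * (g j x * G k b x))" for x
  define F where "F x = (if x \<in> \<Omega> then cutoff c (\<rho> x) * (g j x * G k b x) else 0)" for x
  define F' where "F' x = (if x \<in> \<Omega> then f x else 0)" for x
  define K where "K = superlevel c"
  have K: "compact K" "K \<subseteq> \<Omega>" unfolding K_def by (rule superlevel)+
  have op: "open (- K)" using K(1) compact_imp_closed by blast
  \<comment> \<open>On this open cover the extension is either given by its formula or identically
    zero, so points of the boundary need no separate treatment.\<close>
  have U: "UNIV = \<Omega> \<union> (- K)" using K(2) by auto
  have F0: "F x = 0" "F' x = 0" if "x \<notin> K" for x
    using that cutoff_outside[of x c] by (auto simp: F_def F'_def f_def K_def)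
  have f_cont: "continuous_on \<Omega> f"
    unfolding f_def[abs_def] using assms
    by (intro continuous_intros cutoff_\<rho>_cont g_cont_dom G_cont H_cont \<rho>'_cont)
  have cont: "continuous_on UNIV F" "continuous_on UNIV F'"
  proof -
    have "continuous_on \<Omega> F"
      by (rule continuous_on_eq[of _ "\<lambda>x. cutoff c (\<rho> x) * (g j x * G k b x)"])
        (use assms in \<open>auto simp: F_def intro!: continuous_intros cutoff_\<rho>_cont g_cont_dom G_cont\<close>)
    moreover have "continuous_on (- K) F"
      by (rule continuous_on_eq[of _ "\<lambda>_. 0"]) (auto simp: F0)
    ultimately show "continuous_on UNIV F"
      unfolding U using open_dom op by (intro continuous_on_open_Un)
    have "continuous_on \<Omega> F'"
      by (rule continuous_on_eq[OF f_cont]) (auto simp: F'_def)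
    moreover have "continuous_on (- K) F'"
      by (rule continuous_on_eq[of _ "\<lambda>_. 0"]) (auto simp: F0)
    ultimately show "continuous_on UNIV F'"
      unfolding U using open_dom op by (intro continuous_on_open_Un)
  qed
  have "((\<lambda>s. F (x + s *\<^sub>R b)) has_real_derivative F' x) (at 0)" for x
  proof (cases "x \<in> \<Omega>")
    case True
    have c: "((\<lambda>s. cutoff c (\<rho> (x + s *\<^sub>R b))) has_real_derivative cutoff' c (\<rho> x) * \<rho>' b x) (at 0)"
      using DERIV_chain2[OF DERIV_cutoff[of c "\<rho> (x + 0 *\<^sub>R b)"] \<rho>_DERIV[OF b True]] by simp
    have "((\<lambda>s. cutoff c (\<rho> (x + s *\<^sub>R b)) * (g j (x + s *\<^sub>R b) * G k b (x + s *\<^sub>R b))) has_real_derivative f x) (at 0)"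
      using DERIV_mult[OF c DERIV_mult[OF G[OF jk(1) b True] H[OF jk(2) b True]]]
      by (simp add: f_def algebra_simps)
    moreover have "\<forall>\<^sub>F s in nhds 0. F (x + s *\<^sub>R b)
        = cutoff c (\<rho> (x + s *\<^sub>R b)) * (g j (x + s *\<^sub>R b) * G k b (x + s *\<^sub>R b))"
      using eventually_line_in_open[OF open_dom True, of b] by eventually_elim (simp add: F_def)
    ultimately show ?thesis using True by (subst DERIV_cong_ev[OF refl]) (auto simp: F'_def)
  next
    case False
    hence x: "x \<in> - K" using K by auto
    have "\<forall>\<^sub>F s in nhds 0. F (x + s *\<^sub>R b) = 0"
      using eventually_line_in_open[OF op x, of b] by eventually_elim (simp add: F0)
    thus ?thesis using False by (subst DERIV_cong_ev[OF refl, where g = "\<lambda>_. 0"]) (auto simp: F'_def)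
  qed
  hence "integral\<^sup>L lborel F' = 0"
    using integral_directional_derivative_eq_0[of K F F' b] K F0 cont by blast
  moreover have "F' = (\<lambda>x. indicator \<Omega> x *\<^sub>R f x)" by (auto simp: F'_def)
  moreover have "f x = 0" if "x \<in> \<Omega> - K" for x using F0(2)[of x] that by (simp add: F'_def)
  ultimately show ?thesis
    using set_integrable_compact_support(2)[OF K f_cont] by (simp add: f_def)
qed

lemma cutoff_green:
  "(LINT x:\<Omega>|lebesgue. cutoff c (\<rho> x) * pairing a x)
   = - (LINT x:\<Omega>|lebesgue. cutoff c (\<rho> x) * gradient_form a x)
     - (LINT x:\<Omega>|lebesgue. cutoff' c (\<rho> x) * commutator a x)"
proof -
  define f where "f j k b x = cutoff c (\<rho> x) * (g j x * H k b x) + cutoff c (\<rho> x) * (G j b x * G k b x)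
      + cutoff' c (\<rho> x) * (\<rho>' b x * (g j x * G k b x))" for j k b x
  have f_int: "set_integrable lebesgue \<Omega> (f j k b)" if "j \<in> I" "k \<in> I" "b \<in> Basis" for j k b
    unfolding f_def[abs_def] using that
    by (intro set_integral_add cutoff_integrable continuous_intros g_cont_dom G_cont H_cont \<rho>'_cont)
  have "cutoff c (\<rho> x) * pairing a x + cutoff c (\<rho> x) * gradient_form a x + cutoff' c (\<rho> x) * commutator a x
     = (\<Sum>j\<in>I. \<Sum>k\<in>I. \<Sum>b\<in>Basis. a j k * f j k b x)" for x
    unfolding pairing_def gradient_form_def commutator_def L_def f_def
    by (simp add: sum_distrib_left sum.distrib[symmetric] distrib_left mult_ac)
  hence "(LINT x:\<Omega>|lebesgue. cutoff c (\<rho> x) * pairing a x + cutoff c (\<rho> x) * gradient_form a x + cutoff' c (\<rho> x) * commutator a x)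
    = integral\<^sup>L lebesgue (\<lambda>x. \<Sum>j\<in>I. \<Sum>k\<in>I. \<Sum>b\<in>Basis. a j k * (indicator \<Omega> x *\<^sub>R f j k b x))"
    unfolding set_lebesgue_integral_def by (simp add: sum_distrib_left mult_ac)
  also have "\<dots> = (\<Sum>j\<in>I. \<Sum>k\<in>I. \<Sum>b\<in>Basis. a j k * (LINT x:\<Omega>|lebesgue. f j k b x))"
    using f_int unfolding set_integrable_def set_lebesgue_integral_def
    by (simp add: Bochner_Integration.integral_sum)
  also have "\<dots> = 0"
    using cutoff_divergence unfolding f_def by (intro sum.neutral ballI) simp
  finally have "(LINT x:\<Omega>|lebesgue. cutoff c (\<rho> x) * pairing a x + cutoff c (\<rho> x) * gradient_form a x + cutoff' c (\<rho> x) * commutator a x) = 0" .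
  moreover have "(LINT x:\<Omega>|lebesgue. cutoff c (\<rho> x) * pairing a x + cutoff c (\<rho> x) * gradient_form a x + cutoff' c (\<rho> x) * commutator a x)
    = (LINT x:\<Omega>|lebesgue. cutoff c (\<rho> x) * pairing a x) + (LINT x:\<Omega>|lebesgue. cutoff c (\<rho> x) * gradient_form a x)
     + (LINT x:\<Omega>|lebesgue. cutoff' c (\<rho> x) * commutator a x)"
    using cutoff_integrable pairing_cont gradient_form_cont commutator_cont
    by (simp add: set_integral_add)
  ultimately show ?thesis by linarith
qed

definition gradient_square where
  "gradient_square x = (\<Sum>k\<in>I. \<Sum>b\<in>Basis. (G k b x)\<^sup>2)"

lemma pairing_integrable: "set_integrable lebesgue \<Omega> (pairing a)"
proof -
  have "set_integrable lebesgue \<Omega> (\<lambda>x. g j x * L k x)" if "j \<in> I" "k \<in> I" for j k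
  proof (rule set_integrable_mult_of_squares)
    show "set_borel_measurable lebesgue \<Omega> (g j)" "set_borel_measurable lebesgue \<Omega> (L k)"
      using that by (auto intro!: set_borel_measurable_continuous_on_open open_dom g_cont_dom L_cont)
    show "set_integrable lebesgue \<Omega> (\<lambda>x. (g j x)\<^sup>2)"
      using that by (intro set_integrable_bounded_continuous open_dom bounded_dom continuous_intros g_cont)
    show "set_integrable lebesgue \<Omega> (\<lambda>x. (L k x)\<^sup>2)"
      unfolding L_def using that by (intro H_L2)
  qed
  hence "integrable lebesgue (\<lambda>x. \<Sum>j\<in>I. \<Sum>k\<in>I. a j k * (indicator \<Omega> x *\<^sub>R (g j x * L k x)))"
    unfolding set_integrable_def by (intro Bochner_Integration.integrable_sum integrable_mult_right)
  moreover have "(\<Sum>j\<in>I. \<Sum>k\<in>I. a j k * (indicator \<Omega> x *\<^sub>R (g j x * L k x))) = indicator \<Omega> x *\<^sub>R pairing a x" for x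
    unfolding pairing_def by (simp add: sum_distrib_left mult_ac)
  ultimately show ?thesis unfolding set_integrable_def by (simp only:)
qed

abbreviation (input) "delta \<equiv> \<lambda>j k :: nat. if j = k then 1 else 0 :: real"

lemma gradient_form_delta: "gradient_form delta x = gradient_square x"
proof -
  have "(\<Sum>k\<in>I. delta j k * (\<Sum>b\<in>Basis. G j b x * G k b x)) = (\<Sum>b\<in>Basis. (G j b x)\<^sup>2)" if "j \<in> I" for j
    using that fin by (simp add: if_distrib[of "\<lambda>z. z * _"] power2_eq_square cong: if_cong)
  thus ?thesis unfolding gradient_form_def gradient_square_def by simp
qed

text \<open>For the identity matrix the sum over j reproduces half of \<open>\<rho>'\<close>, so
  each direction contributes a square.\<close>

lemma commutator_delta_nonneg: "commutator delta x \<ge> 0"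
proof -
  have "commutator delta x = (\<Sum>j\<in>I. \<Sum>b\<in>Basis. \<rho>' b x * (g j x * G j b x))"
    unfolding commutator_def using fin
    by (intro sum.cong refl) (simp add: if_distrib[of "\<lambda>z. z * _"] cong: if_cong)
  also have "\<dots> = (\<Sum>b\<in>Basis. \<Sum>j\<in>I. \<rho>' b x * (g j x * G j b x))" by (rule sum.swap)
  also have "\<dots> = (\<Sum>b\<in>Basis. (\<rho>' b x)\<^sup>2 / 2)"
    unfolding \<rho>'_def
    by (simp add: power2_eq_square sum_distrib_left[symmetric] mult.assoc)
  also have "\<dots> \<ge> 0" by (intro sum_nonneg) auto
  finally show ?thesis .
qed

lemma gradient_square_nonneg: "gradient_square x \<ge> 0"
  unfolding gradient_square_def by (intro sum_nonneg) auto

lemma gradient_square_cont: "continuous_on \<Omega> gradient_square"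
  unfolding gradient_square_def[abs_def] by (intro continuous_intros G_cont)

text \<open>Green's formula for the identity matrix: the commutator has the favourable sign, so the
  cutoff Dirichlet energies stay below the integral of the modulus of the pairing. Monotone
  convergence yields the limit on the set where \<rho> is positive, the only one that the cutoffs
  reach.\<close>

lemma gradient_square_integrable:
  "set_integrable lebesgue \<Omega> (\<lambda>x. if \<rho> x > 0 then gradient_square x else 0)"
proof -
  define f where "f i x = indicator \<Omega> x *\<^sub>R (cutoff (real (Suc i)) (\<rho> x) * gradient_square x)" for i x
  define u where "u x = indicator \<Omega> x *\<^sub>R (if \<rho> x > 0 then gradient_square x else 0)" for x
  have f: "integrable lebesgue (f i)" for i
    using cutoff_integrable(1)[OF gradient_square_cont, of "real (Suc i)"]
    unfolding set_integrable_def f_def .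
  have mono: "mono (\<lambda>n. f n x)" for x
    unfolding f_def mono_def
    by (intro allI impI scaleR_left_mono mult_right_mono cutoff_mono \<rho>_nonneg gradient_square_nonneg) auto
  have lim: "(\<lambda>i. f i x) \<longlonglongrightarrow> u x" for x
  proof (cases "\<rho> x > 0")
    case True
    have "(\<lambda>i. f i x) \<longlonglongrightarrow> indicator \<Omega> x *\<^sub>R (1 * gradient_square x)"
      unfolding f_def by (intro tendsto_intros cutoff_tendsto True)
    thus ?thesis using True by (simp add: u_def)
  next
    case False
    hence "\<rho> x = 0" using \<rho>_nonneg[of x] by simp
    thus ?thesis by (simp add: f_def u_def cutoff_eq_0)
  qed
  have bound: "integral\<^sup>L lebesgue (f i) \<le> (LINT x:\<Omega>|lebesgue. \<bar>pairing delta x\<bar>)" for i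
  proof -
    have "(LINT x:\<Omega>|lebesgue. cutoff (real (Suc i)) (\<rho> x) * gradient_form delta x)
      = - (LINT x:\<Omega>|lebesgue. cutoff (real (Suc i)) (\<rho> x) * pairing delta x)
        - (LINT x:\<Omega>|lebesgue. cutoff' (real (Suc i)) (\<rho> x) * commutator delta x)"
      using cutoff_green[of "real (Suc i)" delta] by linarith
    moreover have "0 \<le> (LINT x:\<Omega>|lebesgue. cutoff' (real (Suc i)) (\<rho> x) * commutator delta x)"
      unfolding set_lebesgue_integral_def
      by (intro integral_nonneg_AE AE_I2 scaleR_nonneg_nonneg mult_nonneg_nonneg cutoff_bounds commutator_delta_nonneg) auto
    moreover have "- (LINT x:\<Omega>|lebesgue. cutoff (real (Suc i)) (\<rho> x) * pairing delta x)
       \<le> (LINT x:\<Omega>|lebesgue. \<bar>pairing delta x\<bar>)"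
    proof -
      have "(LINT x:\<Omega>|lebesgue. - (cutoff (real (Suc i)) (\<rho> x) * pairing delta x))
         \<le> (LINT x:\<Omega>|lebesgue. \<bar>pairing delta x\<bar>)"
      proof (rule set_integral_mono)
        show "set_integrable lebesgue \<Omega> (\<lambda>x. - (cutoff (real (Suc i)) (\<rho> x) * pairing delta x))"
          using cutoff_integrable(1)[OF pairing_cont] set_integrable_mult_right[of "-1"] by fastforce
        show "set_integrable lebesgue \<Omega> (\<lambda>x. \<bar>pairing delta x\<bar>)"
          by (rule set_integrable_abs[OF pairing_integrable])
        show "- (cutoff (real (Suc i)) (\<rho> x) * pairing delta x) \<le> \<bar>pairing delta x\<bar>" for x
        proof -
          have "- (cutoff (real (Suc i)) (\<rho> x) * pairing delta x)
             \<le> \<bar>cutoff (real (Suc i)) (\<rho> x) * pairing delta x\<bar>" by linarith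
          also have "\<dots> = cutoff (real (Suc i)) (\<rho> x) * \<bar>pairing delta x\<bar>"
            using cutoff_bounds(1) by (simp add: abs_mult del: of_nat_Suc)
          also have "\<dots> \<le> 1 * \<bar>pairing delta x\<bar>" by (intro mult_right_mono cutoff_bounds) auto
          finally show ?thesis by simp
        qed
      qed
      thus ?thesis
        using set_integral_uminus[OF cutoff_integrable(1)[OF pairing_cont, of "real (Suc i)" delta]] by simp
    qed
    ultimately show ?thesis
      unfolding f_def gradient_form_delta set_lebesgue_integral_def by linarith
  qed
  have "incseq (\<lambda>i. integral\<^sup>L lebesgue (f i))"
    unfolding mono_def using mono by (auto intro!: integral_mono f simp: mono_def)
  then obtain l where l: "(\<lambda>i. integral\<^sup>L lebesgue (f i)) \<longlonglongrightarrow> l"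
    using incseq_convergent bound by metis
  have um: "u \<in> borel_measurable lebesgue"
    by (rule borel_measurable_LIMSEQ_real[OF lim borel_measurable_integrable[OF f]])
  have "integrable lebesgue u"
    by (rule integrable_monotone_convergence[OF f _ _ l um]) (use mono lim in auto)
  thus ?thesis unfolding set_integrable_def u_def .
qed

text \<open>The gain is the factor \<rho>: every summand of \<open>\<rho>'\<close> brings a
  \<open>g l\<close>, and \<open>g j * g l\<close> is at most \<rho> in modulus. It turns
  \<open>cutoff'\<close> into the uniformly bounded \<open>\<rho> * cutoff'\<close>.\<close>

lemma commutator_bound:
  "\<bar>commutator a x\<bar> \<le> \<rho> x * ((\<Sum>j\<in>I. \<Sum>k\<in>I. \<bar>a j k\<bar>) * (2 * real (card I) * gradient_square x))"
proof -
  have g_le: "\<bar>g j x\<bar> * \<bar>g l x\<bar> \<le> \<rho> x" if "j \<in> I" "l \<in> I" for j l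
  proof -
    have sq: "(g i x)\<^sup>2 \<le> \<rho> x" if "i \<in> I" for i
      unfolding \<rho>_def using that fin by (intro member_le_sum) auto
    have "2 * (\<bar>g j x\<bar> * \<bar>g l x\<bar>) \<le> (g j x)\<^sup>2 + (g l x)\<^sup>2"
      using zero_le_power2[of "\<bar>g j x\<bar> - \<bar>g l x\<bar>"] by (simp add: power2_diff)
    thus ?thesis using sq[OF that(1)] sq[OF that(2)] by linarith
  qed
  have G_le: "(\<Sum>b\<in>Basis. (G k b x)\<^sup>2) \<le> gradient_square x" if "k \<in> I" for k
    unfolding gradient_square_def
    using member_le_sum[of k I "\<lambda>k. \<Sum>b\<in>Basis. (G k b x)\<^sup>2"] that fin by (simp add: sum_nonneg)
  have summand: "\<bar>\<Sum>b\<in>Basis. \<rho>' b x * (g j x * G k b x)\<bar> \<le> \<rho> x * (2 * real (card I) * gradient_square x)"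
    if jk: "j \<in> I" "k \<in> I" for j k
  proof -
    have "\<bar>\<Sum>b\<in>Basis. \<rho>' b x * (g j x * G k b x)\<bar>
      \<le> (\<Sum>b\<in>Basis. \<bar>\<rho>' b x * (g j x * G k b x)\<bar>)" by (rule sum_abs)
    also have "\<dots> \<le> (\<Sum>b\<in>Basis. \<Sum>l\<in>I. \<rho> x * ((G l b x)\<^sup>2 + (G k b x)\<^sup>2))"
    proof (rule sum_mono)
      fix b :: 'a assume "b \<in> Basis"
      have "\<bar>\<rho>' b x * (g j x * G k b x)\<bar> = \<bar>\<Sum>l\<in>I. 2 * g l x * G l b x * (g j x * G k b x)\<bar>"
        unfolding \<rho>'_def by (simp add: sum_distrib_right)
      also have "\<dots> \<le> (\<Sum>l\<in>I. \<bar>2 * g l x * G l b x * (g j x * G k b x)\<bar>)" by (rule sum_abs)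
      also have "\<dots> \<le> (\<Sum>l\<in>I. \<rho> x * ((G l b x)\<^sup>2 + (G k b x)\<^sup>2))"
      proof (rule sum_mono)
        fix l assume l: "l \<in> I"
        have "\<bar>2 * g l x * G l b x * (g j x * G k b x)\<bar> = (\<bar>g j x\<bar> * \<bar>g l x\<bar>) * (2 * \<bar>G l b x\<bar> * \<bar>G k b x\<bar>)"
          by (simp add: abs_mult)
        also have "\<dots> \<le> \<rho> x * ((G l b x)\<^sup>2 + (G k b x)\<^sup>2)"
          using g_le[OF jk(1) l] zero_le_power2[of "\<bar>G l b x\<bar> - \<bar>G k b x\<bar>"] \<rho>_nonneg
          by (intro mult_mono) (auto simp: power2_diff)
        finally show "\<bar>2 * g l x * G l b x * (g j x * G k b x)\<bar> \<le> \<rho> x * ((G l b x)\<^sup>2 + (G k b x)\<^sup>2)" .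
      qed
      finally show "\<bar>\<rho>' b x * (g j x * G k b x)\<bar> \<le> (\<Sum>l\<in>I. \<rho> x * ((G l b x)\<^sup>2 + (G k b x)\<^sup>2))" .
    qed
    also have "\<dots> = (\<Sum>l\<in>I. \<Sum>b\<in>Basis. \<rho> x * ((G l b x)\<^sup>2 + (G k b x)\<^sup>2))" by (rule sum.swap)
    also have "\<dots> = (\<Sum>l\<in>I. \<rho> x * ((\<Sum>b\<in>Basis. (G l b x)\<^sup>2) + (\<Sum>b\<in>Basis. (G k b x)\<^sup>2)))"
      by (simp only: sum_distrib_left sum.distrib distrib_left)
    also have "\<dots> \<le> (\<Sum>l\<in>I. \<rho> x * (gradient_square x + gradient_square x))"
      using G_le jk \<rho>_nonneg by (intro sum_mono mult_left_mono add_mono)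
    also have "\<dots> = \<rho> x * (2 * real (card I) * gradient_square x)" by simp
    finally show ?thesis .
  qed
  have "\<bar>commutator a x\<bar> \<le> (\<Sum>j\<in>I. \<Sum>k\<in>I. \<bar>a j k * (\<Sum>b\<in>Basis. \<rho>' b x * (g j x * G k b x))\<bar>)"
    unfolding commutator_def by (rule order_trans[OF sum_abs sum_mono[OF sum_abs]])
  also have "\<dots> \<le> (\<Sum>j\<in>I. \<Sum>k\<in>I. \<bar>a j k\<bar> * (\<rho> x * (2 * real (card I) * gradient_square x)))"
    unfolding abs_mult by (intro sum_mono mult_left_mono summand) auto
  also have "\<dots> = \<rho> x * ((\<Sum>j\<in>I. \<Sum>k\<in>I. \<bar>a j k\<bar>) * (2 * real (card I) * gradient_square x))"
    by (simp add: sum_distrib_right sum_distrib_left mult_ac)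
  finally show ?thesis .
qed

text \<open>In the cutoff Green formula the gradient form has a sign and is never passed to the
  limit. The pairing converges by domination, and the commutator tends to zero, dominated by a
  multiple of the integrable gradient square. Only the quadratic form of \<open>a\<close> is tested,
  which suits the triangular DOC matrix.\<close>

lemma integral_pairing_nonpos:
  assumes psd: "\<And>\<xi>. 0 \<le> (\<Sum>j\<in>I. \<Sum>k\<in>I. a j k * (\<xi> j * \<xi> k :: real))"
  shows "(LINT x:\<Omega>|lebesgue. pairing a x) \<le> 0"
proof -
  define C where "C = (\<Sum>j\<in>I. \<Sum>k\<in>I. \<bar>a j k\<bar>) * (2 * real (card I))"
  have C: "C \<ge> 0" unfolding C_def by (intro mult_nonneg_nonneg sum_nonneg) auto
  define w where "w x = (if \<rho> x > 0 then gradient_square x else 0)" for x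
  have w: "integrable lebesgue (\<lambda>x. indicator \<Omega> x *\<^sub>R w x)"
    using gradient_square_integrable unfolding set_integrable_def w_def .
  define e where "e i x = indicator \<Omega> x *\<^sub>R (cutoff (real (Suc i)) (\<rho> x) * pairing a x)" for i x
  define r where "r i x = indicator \<Omega> x *\<^sub>R (cutoff' (real (Suc i)) (\<rho> x) * commutator a x)" for i x
  have c0: "real (Suc i) \<ge> 0" for i by simp
  have "(\<lambda>i. integral\<^sup>L lebesgue (e i)) \<longlonglongrightarrow> integral\<^sup>L lebesgue (\<lambda>x. indicator \<Omega> x *\<^sub>R pairing a x)"
  proof (rule integral_dominated_convergence)
    show "integrable lebesgue (\<lambda>x. \<bar>indicator \<Omega> x *\<^sub>R pairing a x\<bar>)"
      using pairing_integrable[of a] unfolding set_integrable_def by (rule integrable_abs)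
    show "(\<lambda>x. indicator \<Omega> x *\<^sub>R pairing a x) \<in> borel_measurable lebesgue"
      using pairing_integrable[of a] unfolding set_integrable_def by (rule borel_measurable_integrable)
    show "e i \<in> borel_measurable lebesgue" for i
      using cutoff_integrable(1)[OF pairing_cont, of "real (Suc i)" a]
      unfolding set_integrable_def e_def by (rule borel_measurable_integrable)
    show "AE x in lebesgue. norm (e i x) \<le> \<bar>indicator \<Omega> x *\<^sub>R pairing a x\<bar>" for i
    proof (rule AE_I2)
      fix x
      have "\<bar>cutoff (real (Suc i)) (\<rho> x)\<bar> \<le> 1" using cutoff_bounds by (simp add: abs_le_iff del: of_nat_Suc)
      thus "norm (e i x) \<le> \<bar>indicator \<Omega> x *\<^sub>R pairing a x\<bar>"
        unfolding e_def by (simp add: abs_mult mult_left_mono mult_left_le_one_le del: of_nat_Suc)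
    qed
    show "AE x in lebesgue. (\<lambda>i. e i x) \<longlonglongrightarrow> indicator \<Omega> x *\<^sub>R pairing a x"
    proof (rule AE_I2)
      fix x
      show "(\<lambda>i. e i x) \<longlonglongrightarrow> indicator \<Omega> x *\<^sub>R pairing a x"
      proof (cases "\<rho> x > 0")
        case True
        have "(\<lambda>i. e i x) \<longlonglongrightarrow> indicator \<Omega> x *\<^sub>R (1 * pairing a x)"
          unfolding e_def by (intro tendsto_intros cutoff_tendsto True)
        thus ?thesis by simp
      next
        case False
        hence "\<rho> x = 0" using \<rho>_nonneg[of x] by simp
        \<comment> \<open>Where \<rho> vanishes so does the pairing; the cutoffs lose nothing
          there.\<close>
        hence "g j x = 0" if "j \<in> I" for j
          using that fin unfolding \<rho>_def by (subst (asm) sum_nonneg_eq_0_iff) auto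
        hence "pairing a x = 0" unfolding pairing_def by simp
        thus ?thesis by (simp add: e_def)
      qed
    qed
  qed
  moreover have "(\<lambda>i. integral\<^sup>L lebesgue (r i)) \<longlonglongrightarrow> integral\<^sup>L lebesgue (\<lambda>x::'a. 0::real)"
  proof (rule integral_dominated_convergence)
    show "integrable lebesgue (\<lambda>x. 3 * C * (indicator \<Omega> x *\<^sub>R w x))" using w by (rule integrable_mult_right)
    show "r i \<in> borel_measurable lebesgue" for i
      using cutoff_integrable(2)[OF commutator_cont, of "real (Suc i)" a]
      unfolding set_integrable_def r_def by (rule borel_measurable_integrable)
    have r_bound: "\<bar>r i x\<bar> \<le> \<rho> x * cutoff' (real (Suc i)) (\<rho> x) * (C * (indicator \<Omega> x *\<^sub>R gradient_square x))" for i x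
    proof -
      have "\<bar>r i x\<bar> = indicator \<Omega> x * (cutoff' (real (Suc i)) (\<rho> x) * \<bar>commutator a x\<bar>)"
        unfolding r_def using cutoff_bounds(3)[OF c0] by (simp add: abs_mult del: of_nat_Suc)
      also have "\<dots> \<le> indicator \<Omega> x * (cutoff' (real (Suc i)) (\<rho> x) * (\<rho> x * (C * gradient_square x)))"
        unfolding C_def using commutator_bound[of a x] cutoff_bounds(3)[OF c0]
        by (intro mult_left_mono) (auto simp: mult_ac simp del: of_nat_Suc)
      finally show ?thesis by (simp add: mult_ac)
    qed
    show "AE x in lebesgue. norm (r i x) \<le> 3 * C * (indicator \<Omega> x *\<^sub>R w x)" for i
    proof (rule AE_I2)
      fix x
      show "norm (r i x) \<le> 3 * C * (indicator \<Omega> x *\<^sub>R w x)"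
      proof (cases "\<rho> x > 0")
        case True
        have "\<rho> x * cutoff' (real (Suc i)) (\<rho> x) \<le> 3 * (1 - cutoff (real (Suc i)) (\<rho> x))"
          by (rule mult_cutoff'_le) (use \<rho>_nonneg in auto)
        also have "\<dots> \<le> 3" using cutoff_bounds(1)[of "real (Suc i)" "\<rho> x"] by (simp del: of_nat_Suc)
        finally have "\<rho> x * cutoff' (real (Suc i)) (\<rho> x) * (C * (indicator \<Omega> x *\<^sub>R gradient_square x))
           \<le> 3 * (C * (indicator \<Omega> x *\<^sub>R gradient_square x))"
          using C gradient_square_nonneg by (intro mult_right_mono mult_nonneg_nonneg scaleR_nonneg_nonneg) auto
        thus ?thesis using r_bound[of i x] True by (simp add: w_def mult.assoc del: of_nat_Suc)
      next
        case False
        hence "\<rho> x = 0" using \<rho>_nonneg[of x] by simp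
        thus ?thesis using r_bound[of i x] by (simp add: w_def del: of_nat_Suc)
      qed
    qed
    show "AE x in lebesgue. (\<lambda>i. r i x) \<longlonglongrightarrow> 0"
    proof (rule AE_I2)
      fix x
      have "(\<lambda>i. \<rho> x * cutoff' (real (Suc i)) (\<rho> x)) \<longlonglongrightarrow> 0"
      proof (cases "\<rho> x > 0")
        case False
        hence "\<rho> x = 0" using \<rho>_nonneg[of x] by simp
        thus ?thesis by simp
      qed (rule cutoff_tendsto)
      hence "(\<lambda>i. \<rho> x * cutoff' (real (Suc i)) (\<rho> x) * (C * (indicator \<Omega> x *\<^sub>R gradient_square x))) \<longlonglongrightarrow> 0"
        by (rule tendsto_mult_left_zero)
      thus "(\<lambda>i. r i x) \<longlonglongrightarrow> 0"
        by (rule Lim_null_comparison[rotated]) (use r_bound in \<open>simp del: of_nat_Suc\<close>)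
    qed
  qed simp
  hence "(\<lambda>i. - integral\<^sup>L lebesgue (r i)) \<longlonglongrightarrow> - 0" by (intro tendsto_minus) simp
  moreover have "integral\<^sup>L lebesgue (e i) \<le> - integral\<^sup>L lebesgue (r i)" for i
  proof -
    have "gradient_form a x \<ge> 0" for x
    proof -
      \<comment> \<open>For each direction b the partial derivatives at x serve as the vector
        \<xi>.\<close>
      have "gradient_form a x = (\<Sum>b\<in>Basis. \<Sum>j\<in>I. \<Sum>k\<in>I. a j k * (G j b x * G k b x))"
        unfolding gradient_form_def sum_distrib_left
        by (subst sum.swap[of _ I Basis], subst sum.swap[of _ Basis], rule refl)
      also have "\<dots> \<ge> 0" by (intro sum_nonneg psd)
      finally show ?thesis .
    qed
    hence "0 \<le> (LINT x:\<Omega>|lebesgue. cutoff (real (Suc i)) (\<rho> x) * gradient_form a x)"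
      unfolding set_lebesgue_integral_def
      by (intro integral_nonneg_AE AE_I2 scaleR_nonneg_nonneg mult_nonneg_nonneg cutoff_bounds) auto
    thus ?thesis using cutoff_green[of "real (Suc i)" a]
      unfolding e_def r_def set_lebesgue_integral_def by linarith
  qed
  ultimately have "integral\<^sup>L lebesgue (\<lambda>x. indicator \<Omega> x *\<^sub>R pairing a x) \<le> - 0"
    using LIMSEQ_le by blast
  thus ?thesis by (simp add: set_lebesgue_integral_def)
qed

end

section \<open>The energy estimate\<close>

abbreviation inner_L2 :: "'a::euclidean_space set \<Rightarrow> ('a \<Rightarrow> real) \<Rightarrow> ('a \<Rightarrow> real) \<Rightarrow> real" where
  "inner_L2 \<Omega> f h \<equiv> (LINT x:\<Omega>|lebesgue. f x * h x)"

lemma square_integrable_mult: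
  "square_integrable \<Omega> f \<Longrightarrow> square_integrable \<Omega> h \<Longrightarrow> set_integrable lebesgue \<Omega> (\<lambda>x. f x * h x)"
  unfolding square_integrable_def by (intro set_integrable_mult_of_squares) auto

lemma square_integrable_bound:
  assumes "square_integrable \<Omega> h" "set_borel_measurable lebesgue \<Omega> f"
    and "\<And>x. x \<in> \<Omega> \<Longrightarrow> \<bar>f x\<bar> \<le> c * \<bar>h x\<bar>"
  shows "square_integrable \<Omega> f"
  unfolding square_integrable_def
proof
  show "set_integrable lebesgue \<Omega> (\<lambda>x. (f x)\<^sup>2)"
  proof (rule set_integrable_bound)
    show "set_integrable lebesgue \<Omega> (\<lambda>x. c\<^sup>2 * (h x)\<^sup>2)"
      using assms(1) by (simp add: square_integrable_def)
    have "(\<lambda>x. (indicator \<Omega> x *\<^sub>R f x) * (indicator \<Omega> x *\<^sub>R f x)) \<in> borel_measurable lebesgue"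
      using assms(2) unfolding set_borel_measurable_def by (intro borel_measurable_times)
    moreover have "(indicator \<Omega> x *\<^sub>R f x) * (indicator \<Omega> x *\<^sub>R f x) = indicator \<Omega> x *\<^sub>R (f x)\<^sup>2" for x
      by (simp add: indicator_def power2_eq_square)
    ultimately show "set_borel_measurable lebesgue \<Omega> (\<lambda>x. (f x)\<^sup>2)"
      unfolding set_borel_measurable_def by (simp only:)
    have "(f x)\<^sup>2 \<le> c\<^sup>2 * (h x)\<^sup>2" if "x \<in> \<Omega>" for x
      using power_mono[OF assms(3)[OF that], of 2] by (simp add: power_mult_distrib)
    thus "AE x in lebesgue. x \<in> \<Omega> \<longrightarrow> norm ((f x)\<^sup>2) \<le> norm (c\<^sup>2 * (h x)\<^sup>2)"
      by (intro AE_I2) (simp add: abs_mult)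
  qed
qed (rule assms(2))

lemma square_integrable_add:
  assumes "square_integrable \<Omega> f" "square_integrable \<Omega> h"
  shows "square_integrable \<Omega> (\<lambda>x. f x + h x)"
proof -
  have "set_borel_measurable lebesgue \<Omega> (\<lambda>x. f x + h x)"
    using assms unfolding square_integrable_def set_borel_measurable_def scaleR_add_right
    by (intro borel_measurable_add) auto
  moreover have "set_integrable lebesgue \<Omega> (\<lambda>x. (f x)\<^sup>2 + (h x)\<^sup>2 + 2 * (f x * h x))"
    using assms square_integrable_mult[OF assms]
    by (intro set_integral_add) (auto simp: square_integrable_def)
  hence "set_integrable lebesgue \<Omega> (\<lambda>x. (f x + h x)\<^sup>2)"
    by (simp add: power2_sum mult.assoc)
  ultimately show ?thesis unfolding square_integrable_def by blast
qed

lemma square_integrable_cmult: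
  assumes "square_integrable \<Omega> f"
  shows "square_integrable \<Omega> (\<lambda>x. c * f x)"
proof (rule square_integrable_bound[where c = "\<bar>c\<bar>", OF assms])
  have "(\<lambda>x. c * (indicator \<Omega> x *\<^sub>R f x)) \<in> borel_measurable lebesgue"
    using assms unfolding square_integrable_def set_borel_measurable_def
    by (intro borel_measurable_times) auto
  thus "set_borel_measurable lebesgue \<Omega> (\<lambda>x. c * f x)"
    unfolding set_borel_measurable_def by (simp add: mult.left_commute)
qed (simp add: abs_mult)

lemma square_integrable_diff:
  "square_integrable \<Omega> f \<Longrightarrow> square_integrable \<Omega> h \<Longrightarrow> square_integrable \<Omega> (\<lambda>x. f x - h x)"
  using square_integrable_add[OF _ square_integrable_cmult[of \<Omega> h "-1"]] by simp

lemma square_integrable_sum: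
  assumes "finite A" "\<And>i. i \<in> A \<Longrightarrow> square_integrable \<Omega> (f i)"
  shows "square_integrable \<Omega> (\<lambda>x. \<Sum>i\<in>A. f i x)"
  using assms
proof (induction A rule: finite_induct)
  case empty
  show ?case by (simp add: square_integrable_def set_borel_measurable_def set_integrable_def)
next
  case (insert i A)
  thus ?case using square_integrable_add[of \<Omega> "f i" "\<lambda>x. \<Sum>i\<in>A. f i x"] by simp
qed

lemma square_integrable_continuous:
  fixes f :: "'a::euclidean_space \<Rightarrow> real"
  assumes "open \<Omega>" "bounded \<Omega>" "continuous_on (closure \<Omega>) f"
  shows "square_integrable \<Omega> f"
  unfolding square_integrable_def
  using assms continuous_on_subset[OF assms(3) closure_subset]
  by (auto intro!: set_borel_measurable_continuous_on_open set_integrable_bounded_continuous continuous_on_power)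

lemma square_integrable_cong:
  assumes "\<And>x. x \<in> \<Omega> \<Longrightarrow> f x = h x"
  shows "square_integrable \<Omega> f \<longleftrightarrow> square_integrable \<Omega> h"
proof -
  have "(\<lambda>x. indicator \<Omega> x *\<^sub>R f x) = (\<lambda>x. indicator \<Omega> x *\<^sub>R h x)"
    "(\<lambda>x. indicator \<Omega> x *\<^sub>R (f x)\<^sup>2) = (\<lambda>x. indicator \<Omega> x *\<^sub>R (h x)\<^sup>2)"
    using assms by (auto simp: indicator_def)
  thus ?thesis unfolding square_integrable_def set_borel_measurable_def set_integrable_def by simp
qed

lemma L2norm_nonneg: "L2norm \<Omega> f \<ge> 0"
  unfolding L2norm_def set_lebesgue_integral_def
  by (intro real_sqrt_ge_zero integral_nonneg_AE AE_I2) simp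

lemma L2norm_square: "(L2norm \<Omega> f)\<^sup>2 = inner_L2 \<Omega> f f"
proof -
  have "(LINT x:\<Omega>|lebesgue. (f x)\<^sup>2) \<ge> 0"
    unfolding set_lebesgue_integral_def by (intro integral_nonneg_AE AE_I2) simp
  thus ?thesis by (simp add: L2norm_def power2_eq_square)
qed

lemma Cauchy_Schwarz_L2:
  assumes "square_integrable \<Omega> f" "square_integrable \<Omega> h"
  shows "\<bar>inner_L2 \<Omega> f h\<bar> \<le> L2norm \<Omega> f * L2norm \<Omega> h"
proof -
  define A B C where "A = inner_L2 \<Omega> f f" and "B = inner_L2 \<Omega> f h" and "C = inner_L2 \<Omega> h h"
  note int = square_integrable_mult[OF assms(1) assms(1)] square_integrable_mult[OF assms]
    square_integrable_mult[OF assms(2) assms(2)]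
  have AC: "A \<ge> 0" "C \<ge> 0"
    unfolding A_def C_def L2norm_square[symmetric] by simp_all
  have q: "0 \<le> A + 2 * s * B + s\<^sup>2 * C" for s
  proof -
    have "0 \<le> (LINT x:\<Omega>|lebesgue. (f x + s * h x)\<^sup>2)"
      unfolding set_lebesgue_integral_def by (intro integral_nonneg_AE AE_I2) simp
    also have "\<dots> = (LINT x:\<Omega>|lebesgue. f x * f x + (2 * s) * (f x * h x) + s\<^sup>2 * (h x * h x))"
      by (simp add: power2_eq_square algebra_simps)
    also have "\<dots> = A + 2 * s * B + s\<^sup>2 * C"
      unfolding A_def B_def C_def using int by (simp add: set_integral_add)
    finally show ?thesis .
  qed
  have "B\<^sup>2 \<le> A * C"
  proof (cases "C = 0")
    case True
    have "B = 0"
    proof (rule ccontr)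
      assume B: "B \<noteq> 0"
      \<comment> \<open>With C = 0 the expression is affine in s; this s makes it -1.\<close>
      show False using q[of "- (A + 1) / (2 * B)"] B True by (simp add: field_simps)
    qed
    thus ?thesis using True by simp
  next
    case False
    hence "C > 0" using AC by simp
    moreover have "0 \<le> A + 2 * (- B / C) * B + (- B / C)\<^sup>2 * C" by (rule q)
    ultimately show ?thesis by (simp add: power2_eq_square field_simps)
  qed
  hence "\<bar>B\<bar>\<^sup>2 \<le> (L2norm \<Omega> f * L2norm \<Omega> h)\<^sup>2"
    by (simp add: power_mult_distrib L2norm_square A_def C_def)
  thus ?thesis unfolding B_def
    by (rule power2_le_imp_le) (simp add: L2norm_nonneg)
qed

lemma L2norm_triangle:
  assumes "square_integrable \<Omega> f" "square_integrable \<Omega> h"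
  shows "L2norm \<Omega> (\<lambda>x. f x + h x) \<le> L2norm \<Omega> f + L2norm \<Omega> h"
proof (rule power2_le_imp_le)
  note int = square_integrable_mult[OF assms(1) assms(1)] square_integrable_mult[OF assms]
    square_integrable_mult[OF assms(2) assms(2)]
  have "(L2norm \<Omega> (\<lambda>x. f x + h x))\<^sup>2 = (LINT x:\<Omega>|lebesgue. f x * f x + 2 * (f x * h x) + h x * h x)"
    unfolding L2norm_square by (simp add: algebra_simps)
  also have "\<dots> = (L2norm \<Omega> f)\<^sup>2 + 2 * inner_L2 \<Omega> f h + (L2norm \<Omega> h)\<^sup>2"
    unfolding L2norm_square using int by (simp add: set_integral_add)
  also have "\<dots> \<le> (L2norm \<Omega> f)\<^sup>2 + 2 * (L2norm \<Omega> f * L2norm \<Omega> h) + (L2norm \<Omega> h)\<^sup>2"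
    using Cauchy_Schwarz_L2[OF assms] by simp
  finally show "(L2norm \<Omega> (\<lambda>x. f x + h x))\<^sup>2 \<le> (L2norm \<Omega> f + L2norm \<Omega> h)\<^sup>2"
    by (simp add: power2_sum algebra_simps)
qed (simp add: L2norm_nonneg)

lemma L2norm_le:
  assumes "square_integrable \<Omega> f" "square_integrable \<Omega> h" "c \<ge> 0"
    and "\<And>x. x \<in> \<Omega> \<Longrightarrow> \<bar>f x\<bar> \<le> c * \<bar>h x\<bar>"
  shows "L2norm \<Omega> f \<le> c * L2norm \<Omega> h"
proof (rule power2_le_imp_le)
  have "(L2norm \<Omega> f)\<^sup>2 \<le> (LINT x:\<Omega>|lebesgue. c\<^sup>2 * (h x * h x))"
    unfolding L2norm_square
  proof (rule set_integral_mono)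
    show "set_integrable lebesgue \<Omega> (\<lambda>x. f x * f x)" "set_integrable lebesgue \<Omega> (\<lambda>x. c\<^sup>2 * (h x * h x))"
      using assms by (simp_all add: square_integrable_mult)
    show "f x * f x \<le> c\<^sup>2 * (h x * h x)" if "x \<in> \<Omega>" for x
      using power_mono[OF assms(4)[OF that], of 2]
      by (simp add: power_mult_distrib power2_eq_square[symmetric])
  qed
  also have "\<dots> = (c * L2norm \<Omega> h)\<^sup>2" by (simp add: L2norm_square power_mult_distrib)
  finally show "(L2norm \<Omega> f)\<^sup>2 \<le> (c * L2norm \<Omega> h)\<^sup>2" .
qed (intro mult_nonneg_nonneg assms(3) L2norm_nonneg)

lemma L2norm_uminus: "L2norm \<Omega> (\<lambda>x. - f x) = L2norm \<Omega> f"
  by (simp add: L2norm_def)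

text \<open>\<open>laplacian\<close> iterates \<open>deriv\<close> along lines, so the inner
  derivative must be known at all nearby points; openness of \<Omega> provides them. It also
  transfers derivatives from \<open>D []\<close>, which agrees with w on \<Omega> only.\<close>

lemma Ck_on_2_second_derivatives:
  fixes w :: "'a::euclidean_space \<Rightarrow> real"
  assumes \<Omega>: "open \<Omega>" and w: "Ck_on 2 \<Omega> w"
  obtains G H where
    "\<And>b x. b \<in> Basis \<Longrightarrow> x \<in> \<Omega> \<Longrightarrow> ((\<lambda>s. w (x + s *\<^sub>R b)) has_real_derivative G b x) (at 0)"
    "\<And>b x. b \<in> Basis \<Longrightarrow> x \<in> \<Omega> \<Longrightarrow> ((\<lambda>s. G b (x + s *\<^sub>R b)) has_real_derivative H b x) (at 0)"
    "\<And>b. b \<in> Basis \<Longrightarrow> continuous_on \<Omega> (G b)" "\<And>b. b \<in> Basis \<Longrightarrow> continuous_on \<Omega> (H b)"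
    "\<And>x. x \<in> \<Omega> \<Longrightarrow> laplacian w x = (\<Sum>b\<in>Basis. H b x)"
proof -
  obtain D where D: "\<And>x. x \<in> \<Omega> \<Longrightarrow> D [] x = w x"
    "\<And>hs h x. length hs < 2 \<Longrightarrow> x \<in> \<Omega> \<Longrightarrow> ((\<lambda>s. D hs (x + s *\<^sub>R h)) has_real_derivative D (h # hs) x) (at 0)"
    "\<And>hs. length hs \<le> 2 \<Longrightarrow> continuous_on \<Omega> (D hs)"
    using w unfolding Ck_on_def by blast
  define G H where "G b = D [b]" and "H b = D [b, b]" for b
  have G: "((\<lambda>s. w (x + s *\<^sub>R b)) has_real_derivative G b x) (at 0)" if "x \<in> \<Omega>" for b x
  proof -
    have "\<forall>\<^sub>F s in nhds 0. w (x + s *\<^sub>R b) = D [] (x + s *\<^sub>R b)"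
      using eventually_line_in_open[OF \<Omega> that, of b] by eventually_elim (simp add: D(1))
    thus ?thesis using D(2)[of "[]" x b] that by (subst DERIV_cong_ev[OF refl]) (auto simp: G_def)
  qed
  have H: "((\<lambda>s. G b (x + s *\<^sub>R b)) has_real_derivative H b x) (at 0)" if "x \<in> \<Omega>" for b x
    using D(2)[of "[b]" x b] that by (simp add: G_def H_def)
  have "deriv (deriv (\<lambda>s. w (x + s *\<^sub>R b))) 0 = H b x" if x: "x \<in> \<Omega>" for b x
  proof (rule DERIV_imp_deriv)
    have "\<forall>\<^sub>F s in nhds 0. deriv (\<lambda>s. w (x + s *\<^sub>R b)) s = G b (x + s *\<^sub>R b)"
      using eventually_line_in_open[OF \<Omega> x, of b]
    proof eventually_elim
      case (elim s)
      have "((\<lambda>h. w (x + (h + s) *\<^sub>R b)) has_real_derivative G b (x + s *\<^sub>R b)) (at 0)"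
        using G[OF elim, of b] by (simp add: scaleR_add_left algebra_simps)
      hence "((\<lambda>s. w (x + s *\<^sub>R b)) has_real_derivative G b (x + s *\<^sub>R b)) (at s)"
        using DERIV_shift[of "\<lambda>s. w (x + s *\<^sub>R b)" _ 0 s] by simp
      thus ?case by (rule DERIV_imp_deriv)
    qed
    thus "(deriv (\<lambda>s. w (x + s *\<^sub>R b)) has_real_derivative H b x) (at 0)"
      using H[OF x, of b] by (subst DERIV_cong_ev[OF refl]) auto
  qed
  hence "laplacian w x = (\<Sum>b\<in>Basis. H b x)" if "x \<in> \<Omega>" for x
    using that by (simp add: laplacian_def)
  moreover have "continuous_on \<Omega> (G b)" "continuous_on \<Omega> (H b)" for b
    unfolding G_def H_def by (auto intro: D(3))
  ultimately show thesis using G H that by blast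
qed

text \<open>The Dirichlet family starts at level 3, and the sum in the equation omits the quotients
  at levels 1 and 2, which the source S has to carry. The matrix tested is
  \<open>tau t j * doc t j (j - k)\<close> below the diagonal, positive semidefinite by
  \<open>doc_positive_semidefinite\<close>.\<close>

lemma (in bdf3_mesh) energy_estimate:
  fixes e :: "nat \<Rightarrow> 'a::euclidean_space \<Rightarrow> real" and S :: "nat \<Rightarrow> 'a \<Rightarrow> real"
  assumes M: "3 \<le> M" "M \<le> N" and eps: "0 \<le> \<epsilon>"
    and df: "dirichlet_family \<Omega> {3..M} e G H"
    and sq: "\<And>k. 2 \<le> k \<Longrightarrow> k \<le> M \<Longrightarrow> square_integrable \<Omega> (e k)"
    and S: "\<And>k. 3 \<le> k \<Longrightarrow> k \<le> M \<Longrightarrow> square_integrable \<Omega> (S k)"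
    and eq: "\<And>k x. 3 \<le> k \<Longrightarrow> k \<le> M \<Longrightarrow> x \<in> \<Omega> \<Longrightarrow>
      (\<Sum>j=3..k. bdf3 t k (k - j) * dtau t e j x) = \<epsilon> * (\<Sum>b\<in>Basis. H k b x) + S k x"
  shows "(L2norm \<Omega> (e M))\<^sup>2 \<le> (L2norm \<Omega> (e 2))\<^sup>2
     + 2 * (\<Sum>m=3..M. tau t m * (\<Sum>k=3..m. \<bar>doc t m (m - k)\<bar> * L2norm \<Omega> (S k)) * L2norm \<Omega> (e m))"
proof -
  interpret dirichlet_family \<Omega> "{3..M}" e G H by (rule df)
  define a where "a j k = (if k \<le> j then tau t j * doc t j (j - k) else 0)" for j k
  have a_sum: "(\<Sum>j=3..M. \<Sum>k=3..M. a j k * f j k) = (\<Sum>j=3..M. \<Sum>k=3..j. tau t j * doc t j (j - k) * f j k)"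
    for f :: "nat \<Rightarrow> nat \<Rightarrow> real"
    by (intro sum.cong[OF refl] sum.mono_neutral_cong_right) (auto simp: a_def)
  have psd: "0 \<le> (\<Sum>j=3..M. \<Sum>k=3..M. a j k * (\<xi> j * \<xi> k))" for \<xi> :: "nat \<Rightarrow> real"
  proof -
    have "(\<Sum>j=3..M. \<Sum>k=3..M. a j k * (\<xi> j * \<xi> k)) = (\<Sum>m=3..M. tau t m * (\<xi> m * (\<Sum>k=3..m. doc t m (m - k) * \<xi> k)))"
      unfolding a_sum by (simp add: sum_distrib_left mult_ac)
    thus ?thesis using doc_positive_semidefinite[of M \<xi>] M by simp
  qed
  define Q where "Q x = (\<Sum>m=3..M. \<Sum>k=3..m. tau t m * doc t m (m - k) * (S k x * e m x))" for x
  have pointwise: "(e M x)\<^sup>2 - (e 2 x)\<^sup>2 \<le> 2 * \<epsilon> * pairing a x + 2 * Q x" if x: "x \<in> \<Omega>" for x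
  proof -
    have "(e M x)\<^sup>2 - (e 2 x)\<^sup>2 = (\<Sum>m=3..M. (e m x)\<^sup>2 - (e (m - 1) x)\<^sup>2)"
      using sum_telescope''[of 2 M "\<lambda>m. (e m x)\<^sup>2"] M by (simp add: numeral_3_eq_3 numeral_2_eq_2)
    also have "\<dots> \<le> (\<Sum>m=3..M. 2 * (\<Sum>k=3..m. tau t m * doc t m (m - k) * (\<epsilon> * (e m x * L k x) + S k x * e m x)))"
    proof (rule sum_mono)
      fix m assume m: "m \<in> {3..M}"
      have "dtau t e m x = (\<Sum>k=3..m. doc t m (m - k) * (\<Sum>j=3..k. bdf3 t k (k - j) * dtau t e j x))"
        using doc_inverts_bdf3[of m "\<lambda>j. dtau t e j x"] m M by simp
      also have "\<dots> = (\<Sum>k=3..m. doc t m (m - k) * (\<epsilon> * L k x + S k x))"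
        using m M eq x by (intro sum.cong refl) (simp add: L_def)
      finally have d: "dtau t e m x = \<dots>" .
      have "e m x - e (m - 1) x = tau t m * dtau t e m x"
        using tau_pos[of m] m M by (simp add: dtau_def)
      \<comment> \<open>The right side exceeds the left by the square of the increment, which is
        discarded.\<close>
      moreover have "(e m x)\<^sup>2 - (e (m - 1) x)\<^sup>2 \<le> 2 * ((e m x - e (m - 1) x) * e m x)"
        using zero_le_power2[of "e m x - e (m - 1) x"] by (simp add: power2_eq_square algebra_simps)
      ultimately have "(e m x)\<^sup>2 - (e (m - 1) x)\<^sup>2 \<le> 2 * (tau t m * dtau t e m x * e m x)" by simp
      also have "\<dots> = 2 * (\<Sum>k=3..m. tau t m * doc t m (m - k) * (\<epsilon> * (e m x * L k x) + S k x * e m x))"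
        unfolding d by (simp add: sum_distrib_left sum_distrib_right algebra_simps)
      finally show "(e m x)\<^sup>2 - (e (m - 1) x)\<^sup>2
        \<le> 2 * (\<Sum>k=3..m. tau t m * doc t m (m - k) * (\<epsilon> * (e m x * L k x) + S k x * e m x))" .
    qed
    also have "\<dots> = 2 * \<epsilon> * (\<Sum>m=3..M. \<Sum>k=3..m. tau t m * doc t m (m - k) * (e m x * L k x)) + 2 * Q x"
      unfolding Q_def by (simp add: distrib_left sum.distrib sum_distrib_left mult_ac)
    finally show ?thesis unfolding pairing_def a_sum .
  qed
  have int: "set_integrable lebesgue \<Omega> (\<lambda>x. S k x * e m x)" if "m \<in> {3..M}" "k \<in> {3..m}" for m k
    using that by (intro square_integrable_mult S sq) auto
  have Q_int: "integrable lebesgue (\<lambda>x. \<Sum>m=3..M. \<Sum>k=3..m. tau t m * doc t m (m - k) * (indicator \<Omega> x *\<^sub>R (S k x * e m x)))"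
    using int unfolding set_integrable_def
    by (intro Bochner_Integration.integrable_sum integrable_mult_right)
  have Q_eq: "(\<Sum>m=3..M. \<Sum>k=3..m. tau t m * doc t m (m - k) * (indicator \<Omega> x *\<^sub>R (S k x * e m x))) = indicator \<Omega> x *\<^sub>R Q x" for x
    unfolding Q_def by (simp add: sum_distrib_left mult_ac)
  have Qi: "set_integrable lebesgue \<Omega> Q" unfolding set_integrable_def using Q_int unfolding Q_eq .
  have Q_le: "(LINT x:\<Omega>|lebesgue. Q x)
     \<le> (\<Sum>m=3..M. tau t m * (\<Sum>k=3..m. \<bar>doc t m (m - k)\<bar> * L2norm \<Omega> (S k)) * L2norm \<Omega> (e m))"
  proof -
    have "(LINT x:\<Omega>|lebesgue. Q x) = (\<Sum>m=3..M. \<Sum>k=3..m. tau t m * doc t m (m - k) * inner_L2 \<Omega> (S k) (e m))"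
    proof -
      have i: "integrable lebesgue (\<lambda>x. tau t m * doc t m (m - k) * (indicator \<Omega> x *\<^sub>R (S k x * e m x)))"
        if "m \<in> {3..M}" "k \<in> {3..m}" for m k
        using int[OF that] unfolding set_integrable_def by (rule integrable_mult_right)
      show ?thesis
        unfolding set_lebesgue_integral_def Q_eq[symmetric]
        by (subst Bochner_Integration.integral_sum, intro Bochner_Integration.integrable_sum i, assumption+,
            intro sum.cong[OF refl], subst Bochner_Integration.integral_sum, intro i, assumption+)
          (intro sum.cong[OF refl] integral_mult_right_zero)
    qed
    also have "\<dots> \<le> (\<Sum>m=3..M. \<Sum>k=3..m. tau t m * (\<bar>doc t m (m - k)\<bar> * (L2norm \<Omega> (S k) * L2norm \<Omega> (e m))))"
    proof (intro sum_mono)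
      fix m k assume mk: "m \<in> {3..M}" "k \<in> {3..m}"
      have "doc t m (m - k) * inner_L2 \<Omega> (S k) (e m) \<le> \<bar>doc t m (m - k)\<bar> * \<bar>inner_L2 \<Omega> (S k) (e m)\<bar>"
        unfolding abs_mult[symmetric] by (rule abs_ge_self)
      also have "\<dots> \<le> \<bar>doc t m (m - k)\<bar> * (L2norm \<Omega> (S k) * L2norm \<Omega> (e m))"
        using mk by (intro mult_left_mono Cauchy_Schwarz_L2 S sq) auto
      finally show "tau t m * doc t m (m - k) * inner_L2 \<Omega> (S k) (e m)
        \<le> tau t m * (\<bar>doc t m (m - k)\<bar> * (L2norm \<Omega> (S k) * L2norm \<Omega> (e m)))"
        unfolding mult.assoc using tau_pos[of m] mk M by (intro mult_left_mono) auto
    qed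
    also have "\<dots> = (\<Sum>m=3..M. tau t m * (\<Sum>k=3..m. \<bar>doc t m (m - k)\<bar> * L2norm \<Omega> (S k)) * L2norm \<Omega> (e m))"
      by (simp add: sum_distrib_left sum_distrib_right mult_ac)
    finally show ?thesis .
  qed
  have ei: "set_integrable lebesgue \<Omega> (\<lambda>x. (e k x)\<^sup>2)" if "2 \<le> k" "k \<le> M" for k
    using sq[OF that] by (simp add: square_integrable_def)
  have "(L2norm \<Omega> (e M))\<^sup>2 - (L2norm \<Omega> (e 2))\<^sup>2 = (LINT x:\<Omega>|lebesgue. (e M x)\<^sup>2 - (e 2 x)\<^sup>2)"
    unfolding L2norm_square power2_eq_square[symmetric] using ei M by (simp add: set_integral_diff)
  also have "\<dots> \<le> (LINT x:\<Omega>|lebesgue. 2 * \<epsilon> * pairing a x + 2 * Q x)"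
    using ei M pointwise pairing_integrable Qi
    by (intro set_integral_mono set_integral_diff set_integral_add set_integrable_mult_right) auto
  also have "\<dots> = 2 * \<epsilon> * (LINT x:\<Omega>|lebesgue. pairing a x) + 2 * (LINT x:\<Omega>|lebesgue. Q x)"
    using pairing_integrable[of a] Qi by (simp add: set_integral_add)
  also have "\<dots> \<le> 0 + 2 * (\<Sum>m=3..M. tau t m * (\<Sum>k=3..m. \<bar>doc t m (m - k)\<bar> * L2norm \<Omega> (S k)) * L2norm \<Omega> (e m))"
    using integral_pairing_nonpos[of a, OF psd] eps Q_le
    by (intro add_mono mult_nonneg_nonpos) auto
  finally show ?thesis by simp
qed

section \<open>The error equation and its constants\<close>

lemma Ck_on_imp_continuous_on:
  assumes "Ck_on k S g" shows "continuous_on S g"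
proof -
  obtain D where D: "(\<forall>x\<in>S. D [] x = g x) \<and>
      (\<forall>hs h x. length hs < k \<longrightarrow> x \<in> S \<longrightarrow>
        ((\<lambda>s. D hs (x + s *\<^sub>R h)) has_real_derivative D (h # hs) x) (at 0)) \<and>
      (\<forall>hs. length hs \<le> k \<longrightarrow> continuous_on S (D hs))"
    using assms unfolding Ck_on_def by (rule exE)
  have "continuous_on S (D [])" using D[THEN conjunct2, THEN conjunct2] by simp
  moreover have "D [] x = g x" if "x \<in> S" for x using D that by simp
  ultimately show ?thesis by (rule continuous_on_eq)
qed

theorem theorem4p5:
  fixes \<Omega> :: "'a::euclidean_space set"
    and \<epsilon> \<kappa>star T :: real
    and \<kappa> :: "'a \<Rightarrow> real"
    and u f :: "real \<Rightarrow> 'a \<Rightarrow> real"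
    and u0 :: "'a \<Rightarrow> real"
    and Du :: "nat \<Rightarrow> real \<Rightarrow> 'a \<Rightarrow> real"
  assumes dom: "open \<Omega>" "\<Omega> \<noteq> {}" "connected \<Omega>" "bounded \<Omega>" "convex \<Omega>"
    and bdry: "smooth_boundary \<Omega>"
    and eps: "\<epsilon> > 0"
    and kap: "smooth_on \<Omega> \<kappa>" "\<kappa>star > 0" "\<forall>x\<in>\<Omega>. \<bar>\<kappa> x\<bar> \<le> \<kappa>star"
    and Du0: "Du 0 = u"
    and Du_deriv: "\<forall>j<4. \<forall>x\<in>closure \<Omega>. \<forall>s\<in>{0..T}.
                     ((\<lambda>s'. Du j s' x) has_real_derivative Du (Suc j) s x) (at s within {0..T})"
    and Du_cont: "\<forall>j\<le>4. continuous_on ({0..T} \<times> closure \<Omega>) (\<lambda>(s, x). Du j s x)"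
    and u_space: "\<forall>s\<in>{0..T}. Ck_on 2 \<Omega> (u s)"
    and pde: "\<forall>s\<in>{0<..T}. \<forall>x\<in>\<Omega>.
                Du 1 s x - \<epsilon> * laplacian (u s) x = \<kappa> x * u s x + f s x"
    and bc: "\<forall>s\<in>{0..T}. \<forall>x\<in>frontier \<Omega>. u s x = 0"
    and init: "\<forall>x\<in>\<Omega>. u 0 x = u0 x"
  shows "\<exists>Ku. \<forall>(N::nat) (t::nat \<Rightarrow> real) (K3::real) (v::nat \<Rightarrow> 'a \<Rightarrow> real).
     (t 0 = 0 \<and> t N = T \<and> (\<forall>k<N. t k < t (Suc k))
      \<and> (\<forall>k. 2 \<le> k \<and> k \<le> N \<longrightarrow> 0 < ratio t k \<and> ratio t k < Re_crit)
      \<and> K3 > 0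
      \<and> (\<forall>n. 3 \<le> n \<and> n \<le> N \<longrightarrow> (\<Sum>j=3..n. \<bar>doc t n (n - j)\<bar>) \<le> K3)
      \<and> (\<forall>i n. 3 \<le> i \<and> i \<le> n \<and> n \<le> N \<longrightarrow> (\<Sum>j=i..n. \<bar>doc t j (j - i)\<bar>) \<le> K3)
      \<and> max_step t N \<le> 1 / (4 * K3 * \<kappa>star)
      \<and> (\<forall>k\<le>2. square_integrable \<Omega> (v k))
      \<and> (\<forall>k. 3 \<le> k \<and> k \<le> N \<longrightarrow>
           Ck_on 2 \<Omega> (v k) \<and> continuous_on (closure \<Omega>) (v k)
           \<and> (\<forall>x\<in>frontier \<Omega>. v k x = 0)
           \<and> (\<forall>x\<in>\<Omega>. D3 t v k x = \<epsilon> * laplacian (v k) x + \<kappa> x * v k x + f (t k) x)))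
     \<longrightarrow> (\<forall>n. 3 \<le> n \<and> n \<le> N \<longrightarrow>
           (let e = (\<lambda>k x. u (t k) x - v k x); \<tau> = max_step t N in
            L2norm \<Omega> (e n)
              \<le> 2 * exp (4 * K3 * \<kappa>star * t (n - 1))
                 * (L2norm \<Omega> (e 2) + K3 * \<tau> * L2norm \<Omega> (dtau t e 1)
                    + 4 * K3 * \<tau> * L2norm \<Omega> (dtau t e 2) + 2 * K3 * Ku * t n * \<tau> ^ 3)))"
proof -
  have cont_u: "continuous_on (closure \<Omega>) (Du j s)" if "j \<le> 4" "s \<in> {0..T}" for j s
  proof -
    have "continuous_on ({0..T} \<times> closure \<Omega>) (\<lambda>(s, x). Du j s x)" using Du_cont that(1) by blast
    moreover have "continuous_on (closure \<Omega>) (Pair s)"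
      by (rule continuous_on_Pair[OF continuous_on_const continuous_on_id])
    moreover have "Pair s ` closure \<Omega> \<subseteq> {0..T} \<times> closure \<Omega>" using that(2) by blast
    ultimately have "continuous_on (closure \<Omega>) (\<lambda>x. (\<lambda>(s, x). Du j s x) (s, x))"
      by (rule continuous_on_compose2)
    thus ?thesis by simp
  qed
  have "compact (closure \<Omega>)" using dom(4) by simp
  hence "compact ({0..T} \<times> closure \<Omega>)" by (rule compact_Times[OF compact_Icc])
  moreover have "continuous_on ({0..T} \<times> closure \<Omega>) (\<lambda>(s, x). Du 4 s x)" using Du_cont by blast
  ultimately have "bounded ((\<lambda>(s, x). Du 4 s x) ` ({0..T} \<times> closure \<Omega>))"
    by (intro compact_imp_bounded compact_continuous_image)
  then obtain M0 where bdd: "\<forall>z\<in>(\<lambda>(s, x). Du 4 s x) ` ({0..T} \<times> closure \<Omega>). norm z \<le> M0"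
    unfolding bounded_iff by blast
  hence M0: "\<bar>Du 4 s x\<bar> \<le> M0" if "s \<in> {0..T}" "x \<in> closure \<Omega>" for s x
  proof -
    have "(s, x) \<in> {0..T} \<times> closure \<Omega>" using that by (rule SigmaI)
    from bspec[OF bdd imageI[OF this]] show ?thesis by simp
  qed
  \<comment> \<open>For an empty time interval \<open>M0\<close> would be unconstrained in
    sign.\<close>
  define M where "M = max M0 0"
  have M: "M \<ge> 0" "s \<in> {0..T} \<Longrightarrow> x \<in> closure \<Omega> \<Longrightarrow> \<bar>Du 4 s x\<bar> \<le> M" for s x
    unfolding M_def by (rule max.cobounded2, rule order_trans[OF M0 max.cobounded1])
  \<comment> \<open>Chosen before the mesh and \<open>K3\<close>. The norm of 1 turns the pointwise
    consistency bound into one in the mean.\<close>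
  define Ku where "Ku = 162 * M * L2norm \<Omega> (\<lambda>_. 1)"
  have Ku: "Ku \<ge> 0" using M(1) by (simp add: Ku_def L2norm_nonneg)
  have \<kappa>_cont: "continuous_on \<Omega> \<kappa>"
    using kap(1) by (intro Ck_on_imp_continuous_on[of 0]) (simp add: smooth_on_def)
  have one: "square_integrable \<Omega> (\<lambda>_. 1)"
    by (rule square_integrable_continuous[OF dom(1,4) continuous_on_const])
  show ?thesis
  proof (intro exI[of _ Ku] allI impI)
    fix N :: nat and t :: "nat \<Rightarrow> real" and K3 :: real and v :: "nat \<Rightarrow> 'a \<Rightarrow> real" and n :: nat
    assume hyps: "t 0 = 0 \<and> t N = T \<and> (\<forall>k<N. t k < t (Suc k))
      \<and> (\<forall>k. 2 \<le> k \<and> k \<le> N \<longrightarrow> 0 < ratio t k \<and> ratio t k < Re_crit)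
      \<and> K3 > 0
      \<and> (\<forall>n. 3 \<le> n \<and> n \<le> N \<longrightarrow> (\<Sum>j=3..n. \<bar>doc t n (n - j)\<bar>) \<le> K3)
      \<and> (\<forall>i n. 3 \<le> i \<and> i \<le> n \<and> n \<le> N \<longrightarrow> (\<Sum>j=i..n. \<bar>doc t j (j - i)\<bar>) \<le> K3)
      \<and> max_step t N \<le> 1 / (4 * K3 * \<kappa>star)
      \<and> (\<forall>k\<le>2. square_integrable \<Omega> (v k))
      \<and> (\<forall>k. 3 \<le> k \<and> k \<le> N \<longrightarrow>
           Ck_on 2 \<Omega> (v k) \<and> continuous_on (closure \<Omega>) (v k)
           \<and> (\<forall>x\<in>frontier \<Omega>. v k x = 0)
           \<and> (\<forall>x\<in>\<Omega>. D3 t v k x = \<epsilon> * laplacian (v k) x + \<kappa> x * v k x + f (t k) x))"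
    assume n': "3 \<le> n \<and> n \<le> N"
    note t0 = hyps[THEN conjunct1] note hyps1 = hyps[THEN conjunct2]
    note tN = hyps1[THEN conjunct1] note hyps2 = hyps1[THEN conjunct2]
    note tinc = hyps2[THEN conjunct1] note hyps3 = hyps2[THEN conjunct2]
    note rat = hyps3[THEN conjunct1] note hyps4 = hyps3[THEN conjunct2]
    note K3 = hyps4[THEN conjunct1] note hyps5 = hyps4[THEN conjunct2]
    note row = hyps5[THEN conjunct1] note hyps6 = hyps5[THEN conjunct2]
    note col = hyps6[THEN conjunct1] note hyps7 = hyps6[THEN conjunct2]
    note small = hyps7[THEN conjunct1] note hyps8 = hyps7[THEN conjunct2]
    note v2 = hyps8[THEN conjunct1] note vk = hyps8[THEN conjunct2]
    have n: "3 \<le> n" "n \<le> N" using n' by simp_all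
    interpret bdf3_mesh t N
    proof
      show "t 0 = 0" by (rule t0)
      show "t k < t (Suc k)" if "k < N" for k using tinc that by blast
      show "ratio t k \<le> 3/2" if "2 \<le> k" "k \<le> N" for k
      proof -
        have "ratio t k < Re_crit" using rat that by blast
        thus ?thesis using Re_crit_less by linarith
      qed
    qed
    define e where "e k x = u (t k) x - v k x" for k x
    define \<tau> where "\<tau> = max_step t N"
    have step: "tau t m \<le> \<tau>" if "1 \<le> m" "m \<le> N" for m
      unfolding \<tau>_def max_step_def using that by (intro Max_ge) auto
    have \<tau>: "\<tau> > 0" using step[of 1] tau_pos[of 1] n by force
    have tT: "t k \<in> {0..T}" if "k \<le> N" for k
      using t_mono[of 0 k] t_mono[of k N] that t0 tN by auto
    have uk_cont: "continuous_on (closure \<Omega>) (u (t k))" if "k \<le> N" for k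
      using cont_u[of 0 "t k"] tT[OF that] Du0 by simp
    have e_sq: "square_integrable \<Omega> (e k)" if "k \<le> N" for k
    proof -
      have "square_integrable \<Omega> (v k)"
        using v2 vk that dom by (cases "k \<le> 2") (auto intro!: square_integrable_continuous)
      thus ?thesis unfolding e_def[abs_def]
        using square_integrable_continuous[OF dom(1,4) uk_cont[OF that]] by (intro square_integrable_diff)
    qed
    have dtau_sq: "square_integrable \<Omega> (dtau t e j)" if "1 \<le> j" "j \<le> N" for j
    proof -
      have "square_integrable \<Omega> (\<lambda>x. (1 / tau t j) * (e j x - e (j - 1) x))"
        using that by (intro square_integrable_cmult square_integrable_diff e_sq) auto
      thus ?thesis by (simp add: dtau_def[abs_def])
    qed
    \<comment> \<open>The truncation error. Consistency is applied in time at each fixed x, with a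
      constant uniform over the closure.\<close>
    define \<eta> where "\<eta> k x = D3 t (\<lambda>j. u (t j)) k x - Du 1 (t k) x" for k x
    have \<eta>_le: "\<bar>\<eta> k x\<bar> \<le> 162 * M * \<tau>^3" if k: "3 \<le> k" "k \<le> N" and x: "x \<in> closure \<Omega>" for k x
    proof -
      have "\<bar>(\<Sum>j=1..k. bdf3 t k (k - j) * ((Du 0 (t j) x - Du 0 (t (j - 1)) x) / tau t j)) - Du 1 (t k) x\<bar> \<le> 162 * M * \<tau>^3"
      proof (rule bdf3_consistency[OF k, where \<phi> = "\<lambda>j s. Du j s x"])
        show "((\<lambda>s. Du j s x) has_real_derivative Du (Suc j) z x) (at z within {0..t N})"
          if "j < 4" "z \<in> {0..t N}" for j z using Du_deriv that x tN by simp
        show "\<bar>Du 4 z x\<bar> \<le> M" if "z \<in> {0..t N}" for z using M(2) that x tN by simp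
      qed (rule step)
      thus ?thesis unfolding \<eta>_def D3_def dtau_def Du0 .
    qed
    have \<eta>_sq: "square_integrable \<Omega> (\<eta> k)" if k: "3 \<le> k" "k \<le> N" for k
    proof (rule square_integrable_continuous[OF dom(1,4)])
      have du: "continuous_on (closure \<Omega>) (Du 1 (t k))" using cont_u[of 1 "t k"] tT[OF k(2)] by simp
      have "continuous_on (closure \<Omega>) (\<lambda>x. bdf3 t k (k - j) * ((u (t j) x - u (t (j - 1)) x) / tau t j))"
        if j: "j \<in> {1..k}" for j
      proof -
        have jN: "j \<le> N" "j - 1 \<le> N" using j k by auto
        have "tau t j \<noteq> 0" using tau_pos[of j] j k by simp
        thus ?thesis
          by (intro continuous_on_mult continuous_on_divide continuous_on_diff continuous_on_const uk_cont jN) blast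
      qed
      thus "continuous_on (closure \<Omega>) (\<eta> k)"
        unfolding \<eta>_def[abs_def] D3_def dtau_def by (intro continuous_on_diff[OF continuous_on_sum du])
    qed
    have \<eta>_norm: "L2norm \<Omega> (\<eta> k) \<le> Ku * \<tau>^3" if k: "3 \<le> k" "k \<le> N" for k
    proof -
      have "L2norm \<Omega> (\<eta> k) \<le> (162 * M * \<tau>^3) * L2norm \<Omega> (\<lambda>_. 1)"
        using \<eta>_le[OF k] closure_subset[of \<Omega>] M(1) \<tau>
        by (intro L2norm_le \<eta>_sq k one) auto
      thus ?thesis by (simp add: Ku_def mult_ac)
    qed
    have \<kappa>_sq: "square_integrable \<Omega> (\<lambda>x. \<kappa> x * e k x)" if "k \<le> N" for k
    proof (rule square_integrable_bound[OF e_sq[OF that], where c = \<kappa>star])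
      have "(\<lambda>x. (indicator \<Omega> x *\<^sub>R \<kappa> x) * (indicator \<Omega> x *\<^sub>R e k x)) \<in> borel_measurable lebesgue"
        using set_borel_measurable_continuous_on_open[OF dom(1) \<kappa>_cont] e_sq[OF that]
        unfolding square_integrable_def set_borel_measurable_def by (intro borel_measurable_times) auto
      moreover have "(indicator \<Omega> x *\<^sub>R \<kappa> x) * (indicator \<Omega> x *\<^sub>R e k x) = indicator \<Omega> x *\<^sub>R (\<kappa> x * e k x)" for x
        by (simp add: indicator_def)
      ultimately show "set_borel_measurable lebesgue \<Omega> (\<lambda>x. \<kappa> x * e k x)"
        unfolding set_borel_measurable_def by (simp only:)
      show "\<bar>\<kappa> x * e k x\<bar> \<le> \<kappa>star * \<bar>e k x\<bar>" if "x \<in> \<Omega>" for x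
        using kap(3) that by (auto simp: abs_mult intro: mult_right_mono)
    qed
    have \<kappa>_norm: "L2norm \<Omega> (\<lambda>x. \<kappa> x * e k x) \<le> \<kappa>star * L2norm \<Omega> (e k)" if "k \<le> N" for k
      using kap(2,3) by (intro L2norm_le \<kappa>_sq e_sq that) (auto simp: abs_mult intro: mult_right_mono)
    \<comment> \<open>The terms j = 1 and j = 2 of \<open>D3\<close>; they involve only the given
      starting values and are treated as data.\<close>
    define init where "init k x = bdf3 t k (k - 1) * dtau t e 1 x + bdf3 t k (k - 2) * dtau t e 2 x" for k x
    define X1 X2 where "X1 = L2norm \<Omega> (dtau t e 1)" and "X2 = L2norm \<Omega> (dtau t e 2)"
    define I where "I k = \<bar>bdf3 t k (k - 1)\<bar> * X1 + \<bar>bdf3 t k (k - 2)\<bar> * X2" for k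
    have X: "X1 \<ge> 0" "X2 \<ge> 0" unfolding X1_def X2_def by (simp_all add: L2norm_nonneg)
    have I_nonneg: "I k \<ge> 0" for k using X by (simp add: I_def)
    have init_sq: "square_integrable \<Omega> (init k)" for k
      unfolding init_def[abs_def] using n by (intro square_integrable_add square_integrable_cmult dtau_sq) auto
    have init_norm: "L2norm \<Omega> (init k) \<le> I k" for k
    proof -
      have c: "L2norm \<Omega> (\<lambda>x. c * dtau t e j x) \<le> \<bar>c\<bar> * L2norm \<Omega> (dtau t e j)" if "j \<in> {1, 2}" for c j
        using that n by (intro L2norm_le square_integrable_cmult dtau_sq) (auto simp: abs_mult)
      have "L2norm \<Omega> (init k) \<le> L2norm \<Omega> (\<lambda>x. bdf3 t k (k - 1) * dtau t e 1 x)
          + L2norm \<Omega> (\<lambda>x. bdf3 t k (k - 2) * dtau t e 2 x)"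
        unfolding init_def[abs_def] using n by (intro L2norm_triangle square_integrable_cmult dtau_sq) auto
      also have "\<dots> \<le> I k" unfolding I_def X1_def X2_def by (intro add_mono c) auto
      finally show ?thesis .
    qed
    \<comment> \<open>Kernels of index above 2 vanish, so only k = 3 and k = 4 contribute: the first
      quotient through \<open>d2\<close> at k = 3, the second through \<open>d1\<close> at k = 3 and
      \<open>d2\<close> at k = 4.\<close>
    define J where "J = 27/38 * X1 + (9/5 + 27/38) * X2"
    have I_sum: "(\<Sum>k=3..m. I k) \<le> J" if "m \<le> n" for m
    proof -
      have N3: "3 \<le> N" using n by simp
      have b3: "\<bar>bdf3 t 3 2\<bar> \<le> 27/38" "\<bar>bdf3 t 3 1\<bar> \<le> 9/5"
        using bdf3_bounds[of "ratio t 3" "ratio t 2"] ratio_pos[of 3] ratio_pos[of 2] ratio_le[of 3] ratio_le[of 2] N3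
        by (simp_all add: bdf3_def)
      have I3: "I 3 \<le> 27/38 * X1 + 9/5 * X2"
      proof -
        have "I 3 = \<bar>bdf3 t 3 2\<bar> * X1 + \<bar>bdf3 t 3 1\<bar> * X2" by (simp add: I_def)
        also have "\<dots> \<le> 27/38 * X1 + 9/5 * X2" by (intro add_mono mult_right_mono b3 X)
        finally show ?thesis .
      qed
      have J0: "J \<ge> 0" using X by (simp add: J_def)
      have I4: "I 4 \<le> 27/38 * X2" if "4 \<le> N"
      proof -
        have "bdf3 t 4 3 = 0" by (simp add: bdf3_def)
        hence "I 4 = \<bar>bdf3 t 4 2\<bar> * X2" by (simp add: I_def)
        also have "\<bar>bdf3 t 4 2\<bar> \<le> 27/38"
          using bdf3_bounds[of "ratio t 4" "ratio t 3"] ratio_pos[of 4] ratio_pos[of 3] ratio_le[of 4] ratio_le[of 3] that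
          by (simp add: bdf3_def)
        hence "\<bar>bdf3 t 4 2\<bar> * X2 \<le> 27/38 * X2" by (rule mult_right_mono[OF _ X(2)])
        finally show ?thesis .
      qed
      have I5: "I k = 0" if "5 \<le> k" for k
      proof -
        have "k - 1 \<notin> {0, 1, 2}" "k - 2 \<notin> {0, 1, 2}" using that by auto
        thus ?thesis by (simp add: I_def bdf3_def Let_def)
      qed
      consider "m < 3" | "m = 3" | "4 \<le> m" by linarith
      thus ?thesis
      proof cases
        case 2
        thus ?thesis using I3 X by (simp add: J_def algebra_simps)
      next
        case 3
        hence "(\<Sum>k=3..m. I k) = (\<Sum>k\<in>{3, 4}. I k)"
          by (intro sum.mono_neutral_right) (auto intro!: I5)
        thus ?thesis using I3 I4 3 that n by (simp add: J_def algebra_simps)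
      qed (use J0 in simp)
    qed
    define S where "S k x = \<kappa> x * e k x + \<eta> k x - init k x" for k x
    have S_sq: "square_integrable \<Omega> (S k)" if "3 \<le> k" "k \<le> N" for k
      unfolding S_def[abs_def] using that
      by (intro square_integrable_add square_integrable_diff \<kappa>_sq \<eta>_sq init_sq)
    have S_norm: "L2norm \<Omega> (S k) \<le> \<kappa>star * L2norm \<Omega> (e k) + Ku * \<tau>^3 + I k" if k: "3 \<le> k" "k \<le> N" for k
    proof -
      have m: "square_integrable \<Omega> (\<lambda>x. - init k x)" using square_integrable_cmult[OF init_sq, of "-1"] by simp
      have "L2norm \<Omega> (S k) = L2norm \<Omega> (\<lambda>x. (\<kappa> x * e k x + \<eta> k x) + - init k x)" by (simp add: S_def[abs_def])
      also have "\<dots> \<le> L2norm \<Omega> (\<lambda>x. \<kappa> x * e k x + \<eta> k x) + L2norm \<Omega> (\<lambda>x. - init k x)"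
        using k by (intro L2norm_triangle square_integrable_add \<kappa>_sq \<eta>_sq m)
      also have "\<dots> \<le> (L2norm \<Omega> (\<lambda>x. \<kappa> x * e k x) + L2norm \<Omega> (\<eta> k)) + L2norm \<Omega> (init k)"
        unfolding L2norm_uminus using k by (intro add_right_mono L2norm_triangle \<kappa>_sq \<eta>_sq)
      also have "\<dots> \<le> \<kappa>star * L2norm \<Omega> (e k) + Ku * \<tau>^3 + I k"
        using k by (intro add_mono \<kappa>_norm \<eta>_norm init_norm)
      finally show ?thesis .
    qed
    have "\<exists>G H. (\<forall>b\<in>Basis. \<forall>x\<in>\<Omega>. ((\<lambda>s. e k (x + s *\<^sub>R b)) has_real_derivative G b x) (at 0)
        \<and> ((\<lambda>s. G b (x + s *\<^sub>R b)) has_real_derivative H b x) (at 0))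
      \<and> (\<forall>b\<in>Basis. continuous_on \<Omega> (G b) \<and> continuous_on \<Omega> (H b))
      \<and> (\<forall>x\<in>\<Omega>. laplacian (u (t k)) x - laplacian (v k) x = (\<Sum>b\<in>Basis. H b x))" if k: "3 \<le> k" "k \<le> N" for k
    proof -
      have "Ck_on 2 \<Omega> (u (t k))" using u_space tT[of k] k by blast
      then obtain G1 H1 where 1: "\<And>b x. b \<in> Basis \<Longrightarrow> x \<in> \<Omega> \<Longrightarrow> ((\<lambda>s. u (t k) (x + s *\<^sub>R b)) has_real_derivative G1 b x) (at 0)"
        "\<And>b x. b \<in> Basis \<Longrightarrow> x \<in> \<Omega> \<Longrightarrow> ((\<lambda>s. G1 b (x + s *\<^sub>R b)) has_real_derivative H1 b x) (at 0)"
        "\<And>b. b \<in> Basis \<Longrightarrow> continuous_on \<Omega> (G1 b)" "\<And>b. b \<in> Basis \<Longrightarrow> continuous_on \<Omega> (H1 b)"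
        "\<And>x. x \<in> \<Omega> \<Longrightarrow> laplacian (u (t k)) x = (\<Sum>b\<in>Basis. H1 b x)"
        using Ck_on_2_second_derivatives[OF dom(1)] by blast
      have "Ck_on 2 \<Omega> (v k)" using vk k by blast
      then obtain G2 H2 where 2: "\<And>b x. b \<in> Basis \<Longrightarrow> x \<in> \<Omega> \<Longrightarrow> ((\<lambda>s. v k (x + s *\<^sub>R b)) has_real_derivative G2 b x) (at 0)"
        "\<And>b x. b \<in> Basis \<Longrightarrow> x \<in> \<Omega> \<Longrightarrow> ((\<lambda>s. G2 b (x + s *\<^sub>R b)) has_real_derivative H2 b x) (at 0)"
        "\<And>b. b \<in> Basis \<Longrightarrow> continuous_on \<Omega> (G2 b)" "\<And>b. b \<in> Basis \<Longrightarrow> continuous_on \<Omega> (H2 b)"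
        "\<And>x. x \<in> \<Omega> \<Longrightarrow> laplacian (v k) x = (\<Sum>b\<in>Basis. H2 b x)"
        using Ck_on_2_second_derivatives[OF dom(1)] by blast
      show ?thesis unfolding e_def
        by (rule exI[of _ "\<lambda>b x. G1 b x - G2 b x"], rule exI[of _ "\<lambda>b x. H1 b x - H2 b x"])
          (simp add: 1 2 DERIV_diff continuous_on_diff sum_subtractf)
    qed
    hence "\<forall>k. \<exists>G H. 3 \<le> k \<and> k \<le> N \<longrightarrow> (\<forall>b\<in>Basis. \<forall>x\<in>\<Omega>. ((\<lambda>s. e k (x + s *\<^sub>R b)) has_real_derivative G b x) (at 0)
        \<and> ((\<lambda>s. G b (x + s *\<^sub>R b)) has_real_derivative H b x) (at 0))
      \<and> (\<forall>b\<in>Basis. continuous_on \<Omega> (G b) \<and> continuous_on \<Omega> (H b))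
      \<and> (\<forall>x\<in>\<Omega>. laplacian (u (t k)) x - laplacian (v k) x = (\<Sum>b\<in>Basis. H b x))" by blast
    then obtain G H where GH: "\<And>k. 3 \<le> k \<Longrightarrow> k \<le> N \<Longrightarrow> (\<forall>b\<in>Basis. \<forall>x\<in>\<Omega>. ((\<lambda>s. e k (x + s *\<^sub>R b)) has_real_derivative G k b x) (at 0)
        \<and> ((\<lambda>s. G k b (x + s *\<^sub>R b)) has_real_derivative H k b x) (at 0))
      \<and> (\<forall>b\<in>Basis. continuous_on \<Omega> (G k b) \<and> continuous_on \<Omega> (H k b))
      \<and> (\<forall>x\<in>\<Omega>. laplacian (u (t k)) x - laplacian (v k) x = (\<Sum>b\<in>Basis. H k b x))" by metis
    have D3_e: "D3 t e k x = D3 t (\<lambda>j. u (t j)) k x - D3 t v k x" for k x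
      unfolding D3_def dtau_def e_def
      unfolding sum_subtractf[symmetric]
      by (intro sum.cong refl) (simp add: diff_divide_distrib right_diff_distrib)
    have full_eq: "D3 t e k x = \<epsilon> * (\<Sum>b\<in>Basis. H k b x) + \<kappa> x * e k x + \<eta> k x"
      if k: "3 \<le> k" "k \<le> N" and x: "x \<in> \<Omega>" for k x
    proof -
      \<comment> \<open>The differential equation holds at positive times only.\<close>
      have "t k > 0" using t_less_Suc[of 0] t_mono[of 1 k] k t0 by simp
      hence "t k \<in> {0<..T}" using tT[of k] k by auto
      hence "Du 1 (t k) x - \<epsilon> * laplacian (u (t k)) x = \<kappa> x * u (t k) x + f (t k) x"
        using pde x by blast
      moreover have "D3 t v k x = \<epsilon> * laplacian (v k) x + \<kappa> x * v k x + f (t k) x" using vk k x by blast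
      moreover have "(\<Sum>b\<in>Basis. H k b x) = laplacian (u (t k)) x - laplacian (v k) x" using GH[OF k] x by simp
      hence "\<epsilon> * (\<Sum>b\<in>Basis. H k b x) = \<epsilon> * laplacian (u (t k)) x - \<epsilon> * laplacian (v k) x"
        by (simp only: right_diff_distrib)
      ultimately show ?thesis unfolding D3_e \<eta>_def e_def by (simp add: algebra_simps)
    qed
    have D3_init: "D3 t e k x = (\<Sum>j=3..k. bdf3 t k (k - j) * dtau t e j x) + init k x" if "3 \<le> k" for k x
    proof -
      have "{1..k} = {1, 2} \<union> {3..k}" using that by auto
      hence "D3 t e k x = (\<Sum>j\<in>{1, 2}. bdf3 t k (k - j) * dtau t e j x) + (\<Sum>j=3..k. bdf3 t k (k - j) * dtau t e j x)"
        unfolding D3_def by (simp only:) (rule sum.union_disjoint, auto)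
      thus ?thesis by (simp add: init_def)
    qed
    have error_eq: "(\<Sum>j=3..k. bdf3 t k (k - j) * dtau t e j x) = \<epsilon> * (\<Sum>b\<in>Basis. H k b x) + S k x"
      if "3 \<le> k" "k \<le> N" "x \<in> \<Omega>" for k x
      using full_eq[OF that] D3_init[OF that(1), of x] by (simp add: S_def)
    \<comment> \<open>Solved for the Laplacian, the error equation expresses it through difference
      quotients and the source, all square integrable. Here division by \<epsilon> enters.\<close>
    have lap_sq: "square_integrable \<Omega> (\<lambda>x. \<Sum>b\<in>Basis. H k b x)" if k: "3 \<le> k" "k \<le> N" for k
    proof -
      have "square_integrable \<Omega> (\<lambda>x. (1 / \<epsilon>) * ((\<Sum>j=3..k. bdf3 t k (k - j) * dtau t e j x) - S k x))"
        using k by (intro square_integrable_cmult square_integrable_diff square_integrable_sum dtau_sq S_sq) auto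
      thus ?thesis
        by (subst square_integrable_cong[where h = "\<lambda>x. (1 / \<epsilon>) * ((\<Sum>j=3..k. bdf3 t k (k - j) * dtau t e j x) - S k x)"])
          (use error_eq[OF k] eps in auto)
    qed
    have energy: "(L2norm \<Omega> (e m))\<^sup>2 \<le> (L2norm \<Omega> (e 2))\<^sup>2
       + 2 * (\<Sum>i=3..m. tau t i * (\<Sum>k=3..i. \<bar>doc t i (i - k)\<bar> * (\<kappa>star * L2norm \<Omega> (e k) + Ku * \<tau>^3 + I k)) * L2norm \<Omega> (e i))"
      if m: "3 \<le> m" "m \<le> n" for m
    proof -
      have mN: "m \<le> N" using m n by simp
      have df: "dirichlet_family \<Omega> {3..m} e G H"
      proof
        show "continuous_on (closure \<Omega>) (e k)" if "k \<in> {3..m}" for k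
          unfolding e_def[abs_def] using that mN vk by (intro continuous_on_diff uk_cont) auto
        show "e k x = 0" if "k \<in> {3..m}" "x \<in> frontier \<Omega>" for k x
          using that mN vk bc tT[of k] by (simp add: e_def)
        show "set_integrable lebesgue \<Omega> (\<lambda>x. (\<Sum>b\<in>Basis. H k b x)\<^sup>2)" if "k \<in> {3..m}" for k
          using lap_sq[of k] that mN by (simp add: square_integrable_def)
      qed (use dom GH mN in auto)
      have "(L2norm \<Omega> (e m))\<^sup>2 \<le> (L2norm \<Omega> (e 2))\<^sup>2
        + 2 * (\<Sum>i=3..m. tau t i * (\<Sum>k=3..i. \<bar>doc t i (i - k)\<bar> * L2norm \<Omega> (S k)) * L2norm \<Omega> (e i))"
        by (rule energy_estimate[OF m(1) mN less_imp_le[OF eps] df]) (use mN in \<open>auto intro: e_sq S_sq error_eq\<close>)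
      also have "\<dots> \<le> (L2norm \<Omega> (e 2))\<^sup>2
       + 2 * (\<Sum>i=3..m. tau t i * (\<Sum>k=3..i. \<bar>doc t i (i - k)\<bar> * (\<kappa>star * L2norm \<Omega> (e k) + Ku * \<tau>^3 + I k)) * L2norm \<Omega> (e i))"
        using mN by (intro add_left_mono mult_left_mono sum_mono mult_right_mono S_norm L2norm_nonneg)
          (auto intro!: less_imp_le[OF tau_pos])
      finally show ?thesis .
    qed
    have "L2norm \<Omega> (e n) \<le> exp (4 * K3 * \<kappa>star * t (n - 1)) * 2
       * (19/27 * (L2norm \<Omega> (e 2) + 2 * K3 * \<tau> * J + 2 * K3 * (Ku * \<tau>^3) * t n))"
    proof (rule bound_from_energy_estimate[where a = "\<lambda>k. L2norm \<Omega> (e k)" and I = I])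
      show "0 \<le> Ku * \<tau>^3" using Ku \<tau> by simp
      show "\<tau> \<le> 1 / (4 * K3 * \<kappa>star)" using small by (simp add: \<tau>_def)
    qed (use n K3 kap(2) L2norm_nonneg I_nonneg I_sum step row col energy in auto)
    also have "\<dots> \<le> exp (4 * K3 * \<kappa>star * t (n - 1)) * 2
       * (L2norm \<Omega> (e 2) + K3 * \<tau> * X1 + 4 * K3 * \<tau> * X2 + 2 * K3 * Ku * t n * \<tau>^3)"
    \<comment> \<open>Twice 27/38 times 19/27 is exactly the required coefficient 1 of
      \<open>X1\<close>. For \<open>X2\<close>, with 477/95 equal to 2 * (9/5 + 27/38), the product
      with 19/27 is about 3.53 and stays below 4.\<close>
    proof (rule mult_left_mono)
      have "K3 * \<tau> * X2 \<ge> 0" using K3 \<tau> X by simp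
      moreover have "L2norm \<Omega> (e 2) \<ge> 0" by (rule L2norm_nonneg)
      moreover have "2 * K3 * Ku * t n * \<tau>^3 \<ge> 0" using K3 \<tau> Ku tT[of n] n by simp
      moreover have "19/27 * (L2norm \<Omega> (e 2) + 2 * K3 * \<tau> * J + 2 * K3 * (Ku * \<tau>^3) * t n)
        = 19/27 * L2norm \<Omega> (e 2) + K3 * \<tau> * X1 + 19/27 * (477/95) * (K3 * \<tau> * X2) + 19/27 * (2 * K3 * Ku * t n * \<tau>^3)"
        by (simp add: J_def field_simps)
      ultimately show "19/27 * (L2norm \<Omega> (e 2) + 2 * K3 * \<tau> * J + 2 * K3 * (Ku * \<tau>^3) * t n)
        \<le> L2norm \<Omega> (e 2) + K3 * \<tau> * X1 + 4 * K3 * \<tau> * X2 + 2 * K3 * Ku * t n * \<tau>^3" by linarith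
    qed simp
    finally show "let e = (\<lambda>k x. u (t k) x - v k x); \<tau> = max_step t N in
            L2norm \<Omega> (e n)
              \<le> 2 * exp (4 * K3 * \<kappa>star * t (n - 1))
                 * (L2norm \<Omega> (e 2) + K3 * \<tau> * L2norm \<Omega> (dtau t e 1)
                    + 4 * K3 * \<tau> * L2norm \<Omega> (dtau t e 2) + 2 * K3 * Ku * t n * \<tau> ^ 3)"
      unfolding Let_def X1_def X2_def \<tau>_def e_def[abs_def] by (simp only: mult_ac)
  qed
qed

end
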